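(* Assume the Axiom of Determinacy in addition to the Zermelo-Fraenkel axioms (ZF + AD). Let $a_0,b_0\in\mathbb{R}$ with $a_0<b_0$, and consider the Cantor game on $[a_0,b_0]$. Then: (1) there does not exist an uncountable set $S\subset[a_0,b_0]$ such that player A does not have a winning strategy (for target set $S$); (2) there does not exist an uncountable set $S\subset[a_0,b_0]$ such that player B has a winning strategy; (3) there does not exist an uncountable set $S\subset[a_0,b_0]$ such that neither player A nor player B has a winning strategy.
   Context: "Countable" includes finite; "uncountable" means not countable. The Axiom of Determinacy (AD): for every set $X\subset\mathbb{N}^{\mathbb{N}}$, in the infinite game in which two players alternately choose natural numbers $n_0,n_1,n_2,\dots$ and the first player wins iff $(n_0,n_1,n_2,\dots)\in X$, one of the two players has a winning strategy. The Axiom of Choice is not assumed. Cantor game on $[a_0,b_0]$ with target set $S\subset[a_0,b_0]$: $a_0<b_0$ are fixed reals. At turn $n\ge1$ player A chooses a real $a_n$ with $a_{n-1}<a_n<b_{n-1}$, then player B chooses a real $b_n$ with $a_n<b_n<b_{n-1}$. Player A wins if $\lim_{n\to\infty}a_n\in S$; otherwise player B wins. A play is a pair of sequences $((a_n)_{n\ge0},(b_n)_{n\ge0})$, starting with the fixed $a_0,b_0$, with $a_{n-1}<a_n<b_n<b_{n-1}$ for all $n\ge1$. A strategy for player A is a sequence of real-valued functions $(f_n)_{n\ge0}$, where for $n\ge1$ the function $f_{n-1}$ is defined on all tuples $(a_0,b_0,a_1,b_1,\dots,a_{n-1},b_{n-1})$ (with $a_0,b_0$ the fixed values) satisfying $a_0<a_1<\dots<a_{n-1}<b_{n-1}<\dots<b_1<b_0$,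 and $a_{n-1}<f_{n-1}(a_0,b_0,\dots,a_{n-1},b_{n-1})<b_{n-1}$. A strategy for player B is a sequence of real-valued functions $(g_n)_{n\ge0}$, where for $n\ge1$ the function $g_{n-1}$ is defined on all tuples $(a_0,b_0,a_1,b_1,\dots,a_{n-1},b_{n-1},a_n)$ satisfying $a_0<a_1<\dots<a_n<b_{n-1}<\dots<b_1<b_0$, and $a_n<g_{n-1}(a_0,b_0,\dots,a_{n-1},b_{n-1},a_n)<b_{n-1}$. A play is consistent with $(f_n)$ if $a_n=f_{n-1}(a_0,b_0,\dots,a_{n-1},b_{n-1})$ for all $n\ge1$, and consistent with $(g_n)$ if $b_n=g_{n-1}(a_0,b_0,\dots,a_{n-1},b_{n-1},a_n)$ for all $n\ge1$. The limit set $L(\cdot)$ of a strategy is the set of all $\lim_{n\to\infty}a_n$ over plays consistent with it. $(f_n)$ is winning for player A if $L((f_n))\subset S$; $(g_n)$ is winning for player B if $L((g_n))\subset[a_0,b_0]-S$. *)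

theory Defs
  imports Main
begin

text \<open>
  HOL proves the axiom of choice at every type, so determinacy stated for sets of HOL sequences is
  refutable and would make any theorem assuming it vacuous. Here ``ZF + AD proves \<open>\<phi>\<close>'' is
  therefore rendered semantically: \<open>\<phi>\<close> holds in every first-order structure \<open>('v, mem)\<close> that
  satisfies all axioms of ZF and in which AD holds (by the completeness theorem, this is the same
  as provability). Natural numbers, reals, functions, sequences, games and strategies are all
  objects of the structure, and apart from the formulas and assignments in the two axiom schemata
  every quantifier in the definitions below ranges over elements of the structure. HOL sets such as \<open>elts A\<close> occur only as notation for definable classes of elements.
\<close>

datatype fm = Mem nat nat | Eq nat nat | Neg fm | Conj fm fm | All nat fm

locale set_universe =
  fixes mem :: "'v \<Rightarrow> 'v \<Rightarrow> bool"  (infix "\<epsilon>" 50)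
begin

definition elts :: "'v \<Rightarrow> 'v set"
  where "elts A = {x. x \<epsilon> A}"

primrec sat :: "fm \<Rightarrow> (nat \<Rightarrow> 'v) \<Rightarrow> bool" where
  "sat (Mem i j) env \<longleftrightarrow> env i \<epsilon> env j"
| "sat (Eq i j) env \<longleftrightarrow> env i = env j"
| "sat (Neg p) env \<longleftrightarrow> \<not> sat p env"
| "sat (Conj p q) env \<longleftrightarrow> sat p env \<and> sat q env"
| "sat (All i p) env \<longleftrightarrow> (\<forall>x. sat p (env(i := x)))"


subsection \<open>The axioms of ZF\<close>

definition Extensionality :: bool
  where "Extensionality \<longleftrightarrow> (\<forall>x y. elts x = elts y \<longrightarrow> x = y)"

definition Foundation :: bool
  where "Foundation \<longleftrightarrow> (\<forall>x. elts x \<noteq> {} \<longrightarrow> (\<exists>y\<in>elts x. elts y \<inter> elts x = {}))"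

definition Pairing :: bool
  where "Pairing \<longleftrightarrow> (\<forall>x y. \<exists>z. \<forall>w. w \<epsilon> z \<longleftrightarrow> w = x \<or> w = y)"

definition Union_axiom :: bool
  where "Union_axiom \<longleftrightarrow> (\<forall>x. \<exists>u. \<forall>w. w \<epsilon> u \<longleftrightarrow> (\<exists>y\<in>elts x. w \<epsilon> y))"

definition Power_set :: bool
  where "Power_set \<longleftrightarrow> (\<forall>x. \<exists>p. \<forall>w. w \<epsilon> p \<longleftrightarrow> elts w \<subseteq> elts x)"

definition Infinity :: bool
  where "Infinity \<longleftrightarrow> (\<exists>I. (\<exists>e\<in>elts I. elts e = {}) \<and>
    (\<forall>x\<in>elts I. \<exists>y\<in>elts I. elts y = insert x (elts x)))"

text \<open>
  In both schemata all variables of the formula other than 0 (and 1) act as parameters through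
  \<open>env\<close>.
\<close>

definition Separation :: bool
  where "Separation \<longleftrightarrow>
    (\<forall>p env A. \<exists>B. \<forall>x. x \<epsilon> B \<longleftrightarrow> x \<epsilon> A \<and> sat p (env(0 := x)))"

definition Replacement :: bool
  where "Replacement \<longleftrightarrow>
    (\<forall>p env A.
      (\<forall>x\<in>elts A. \<forall>y y'.
         sat p (env(0 := x, 1 := y)) \<and> sat p (env(0 := x, 1 := y')) \<longrightarrow> y = y') \<longrightarrow>
      (\<exists>B. \<forall>y. y \<epsilon> B \<longleftrightarrow> (\<exists>x\<in>elts A. sat p (env(0 := x, 1 := y)))))"

definition ZF :: bool
  where "ZF \<longleftrightarrow> Extensionality \<and> Foundation \<and> Pairing \<and> Union_axiom \<and> Power_set \<and>
    Infinity \<and> Separation \<and> Replacement"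


subsection \<open>Functions and natural numbers inside the structure\<close>

text \<open>
  The element whose members are exactly those satisfying \<open>P\<close>. It is used only for \<open>P\<close> whose
  extension is a set by the axioms of ZF.
\<close>

definition the_set :: "('v \<Rightarrow> bool) \<Rightarrow> 'v"
  where "the_set P = (THE z. \<forall>w. w \<epsilon> z \<longleftrightarrow> P w)"

definition upair :: "'v \<Rightarrow> 'v \<Rightarrow> 'v"
  where "upair x y = the_set (\<lambda>w. w = x \<or> w = y)"

definition opair :: "'v \<Rightarrow> 'v \<Rightarrow> 'v"
  where "opair x y = upair (upair x x) (upair x y)"

definition prod_set :: "'v \<Rightarrow> 'v \<Rightarrow> 'v"
  where "prod_set A B = the_set (\<lambda>p. \<exists>x\<in>elts A. \<exists>y\<in>elts B. p = opair x y)"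

definition fun_on :: "'v \<Rightarrow> 'v \<Rightarrow> bool"
  where "fun_on f A \<longleftrightarrow> (\<forall>p\<in>elts f. \<exists>x\<in>elts A. \<exists>y. p = opair x y) \<and>
    (\<forall>x\<in>elts A. \<exists>!y. opair x y \<epsilon> f)"

definition app :: "'v \<Rightarrow> 'v \<Rightarrow> 'v"
  where "app f x = (THE y. opair x y \<epsilon> f)"

definition func :: "'v \<Rightarrow> 'v \<Rightarrow> 'v \<Rightarrow> bool"
  where "func f A B \<longleftrightarrow> fun_on f A \<and> (\<forall>x\<in>elts A. app f x \<epsilon> B)"

definition restr :: "'v \<Rightarrow> 'v \<Rightarrow> 'v"
  where "restr f A = the_set (\<lambda>p. p \<epsilon> f \<and> (\<exists>x\<in>elts A. \<exists>y. p = opair x y))"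

definition zero :: 'v
  where "zero = the_set (\<lambda>w. False)"

definition succ :: "'v \<Rightarrow> 'v"
  where "succ n = the_set (\<lambda>w. w \<epsilon> n \<or> w = n)"

definition omega :: 'v
  where "omega = the_set (\<lambda>n. \<forall>I. zero \<epsilon> I \<and> (\<forall>k\<in>elts I. succ k \<epsilon> I) \<longrightarrow> n \<epsilon> I)"

definition countable_set :: "'v \<Rightarrow> bool"
  where "countable_set S \<longleftrightarrow> (\<exists>f. func f S omega \<and> inj_on (app f) (elts S))"


subsection \<open>The axiom of determinacy\<close>

definition even_num :: "'v \<Rightarrow> bool"
  where "even_num n \<longleftrightarrow> n \<epsilon> omega \<and>
    (\<forall>I. zero \<epsilon> I \<and> (\<forall>k\<in>elts I. succ (succ k) \<epsilon> I) \<longrightarrow> n \<epsilon> I)"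

definition odd_num :: "'v \<Rightarrow> bool"
  where "odd_num n \<longleftrightarrow> n \<epsilon> omega \<and> \<not> even_num n"

text \<open>
  A finite sequence of length \<open>n\<close> is a function on the von Neumann numeral \<open>n = {0,\<dots>,n-1}\<close>.
  The predicate \<open>T\<close> below says at which positions it is the player's turn: the first player moves
  at the even positions, the second at the odd ones.
\<close>

definition nat_strategy :: "('v \<Rightarrow> bool) \<Rightarrow> 'v \<Rightarrow> bool"
  where "nat_strategy T s \<longleftrightarrow>
    func s (the_set (\<lambda>p. \<exists>n\<in>elts omega. T n \<and> func p n omega)) omega"

definition nat_consistent :: "('v \<Rightarrow> bool) \<Rightarrow> 'v \<Rightarrow> 'v \<Rightarrow> bool"
  where "nat_consistent T s z \<longleftrightarrow>
    (\<forall>n\<in>elts omega. T n \<longrightarrow> app z n = app s (restr z n))"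

definition AD :: bool
  where "AD \<longleftrightarrow> (\<forall>X. (\<forall>z\<in>elts X. func z omega omega) \<longrightarrow>
    (\<exists>s. nat_strategy even_num s \<and>
       (\<forall>z. func z omega omega \<and> nat_consistent even_num s z \<longrightarrow> z \<epsilon> X)) \<or>
    (\<exists>s. nat_strategy odd_num s \<and>
       (\<forall>z. func z omega omega \<and> nat_consistent odd_num s z \<longrightarrow> \<not> z \<epsilon> X)))"

end


subsection \<open>The real numbers inside the structure\<close>

locale reals_in_universe = set_universe mem
  for mem :: "'v \<Rightarrow> 'v \<Rightarrow> bool"  (infix "\<epsilon>" 50) +
  fixes R addR multR ltR :: 'v
begin

definition plus_R :: "'v \<Rightarrow> 'v \<Rightarrow> 'v"  (infixl "\<oplus>" 65)
  where "x \<oplus> y = app addR (opair x y)"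

definition times_R :: "'v \<Rightarrow> 'v \<Rightarrow> 'v"  (infixl "\<otimes>" 70)
  where "x \<otimes> y = app multR (opair x y)"

definition less_R :: "'v \<Rightarrow> 'v \<Rightarrow> bool"  (infix "\<prec>" 50)
  where "x \<prec> y \<longleftrightarrow> opair x y \<epsilon> ltR"

definition le_R :: "'v \<Rightarrow> 'v \<Rightarrow> bool"  (infix "\<preceq>" 50)
  where "x \<preceq> y \<longleftrightarrow> x \<prec> y \<or> x = y"

definition zero_R :: 'v
  where "zero_R = (THE z. z \<epsilon> R \<and> (\<forall>x\<in>elts R. x \<oplus> z = x))"

definition one_R :: 'v
  where "one_R = (THE u. u \<epsilon> R \<and> (\<forall>x\<in>elts R. x \<otimes> u = x))"

definition field_axioms :: bool
  where "field_axioms \<longleftrightarrow>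
    func addR (prod_set R R) R \<and> func multR (prod_set R R) R \<and>
    (\<forall>x\<in>elts R. \<forall>y\<in>elts R. \<forall>z\<in>elts R. (x \<oplus> y) \<oplus> z = x \<oplus> (y \<oplus> z)) \<and>
    (\<forall>x\<in>elts R. \<forall>y\<in>elts R. x \<oplus> y = y \<oplus> x) \<and>
    (\<forall>x\<in>elts R. \<forall>y\<in>elts R. \<forall>z\<in>elts R. (x \<otimes> y) \<otimes> z = x \<otimes> (y \<otimes> z)) \<and>
    (\<forall>x\<in>elts R. \<forall>y\<in>elts R. x \<otimes> y = y \<otimes> x) \<and>
    (\<forall>x\<in>elts R. \<forall>y\<in>elts R. \<forall>z\<in>elts R. x \<otimes> (y \<oplus> z) = (x \<otimes> y) \<oplus> (x \<otimes> z)) \<and>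
    zero_R \<epsilon> R \<and> one_R \<epsilon> R \<and> zero_R \<noteq> one_R \<and>
    (\<forall>x\<in>elts R. x \<oplus> zero_R = x) \<and> (\<forall>x\<in>elts R. x \<otimes> one_R = x) \<and>
    (\<forall>x\<in>elts R. \<exists>y\<in>elts R. x \<oplus> y = zero_R) \<and>
    (\<forall>x\<in>elts R. x \<noteq> zero_R \<longrightarrow> (\<exists>y\<in>elts R. x \<otimes> y = one_R))"

definition order_axioms :: bool
  where "order_axioms \<longleftrightarrow>
    elts ltR \<subseteq> elts (prod_set R R) \<and>
    (\<forall>x\<in>elts R. \<not> x \<prec> x) \<and>
    (\<forall>x\<in>elts R. \<forall>y\<in>elts R. \<forall>z\<in>elts R. x \<prec> y \<and> y \<prec> z \<longrightarrow> x \<prec> z) \<and>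
    (\<forall>x\<in>elts R. \<forall>y\<in>elts R. x \<prec> y \<or> x = y \<or> y \<prec> x) \<and>
    (\<forall>x\<in>elts R. \<forall>y\<in>elts R. \<forall>z\<in>elts R. x \<prec> y \<longrightarrow> x \<oplus> z \<prec> y \<oplus> z) \<and>
    (\<forall>x\<in>elts R. \<forall>y\<in>elts R. zero_R \<prec> x \<and> zero_R \<prec> y \<longrightarrow> zero_R \<prec> x \<otimes> y)"

definition upper_bound :: "'v \<Rightarrow> 'v \<Rightarrow> bool"
  where "upper_bound S u \<longleftrightarrow> u \<epsilon> R \<and> (\<forall>x\<in>elts S. x \<preceq> u)"

definition completeness :: bool
  where "completeness \<longleftrightarrow>
    (\<forall>S. elts S \<subseteq> elts R \<and> elts S \<noteq> {} \<and> (\<exists>u. upper_bound S u) \<longrightarrow>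
      (\<exists>u. upper_bound S u \<and> (\<forall>v. upper_bound S v \<longrightarrow> u \<preceq> v)))"

text \<open>
  The reals are specified as a Dedekind-complete ordered field of the structure; ZF proves that
  such a field exists and is unique up to a unique isomorphism.
\<close>

definition real_field :: bool
  where "real_field \<longleftrightarrow> field_axioms \<and> order_axioms \<and> completeness"

definition closed_interval :: "'v \<Rightarrow> 'v \<Rightarrow> 'v set"
  where "closed_interval a b = {x \<in> elts R. a \<preceq> x \<and> x \<preceq> b}"

text \<open>\<open>|s\<^sub>n - x| < e\<close> is written as \<open>s\<^sub>n < x + e\<close> and \<open>x < s\<^sub>n + e\<close>.\<close>

definition limit_of :: "'v \<Rightarrow> 'v \<Rightarrow> bool"
  where "limit_of s x \<longleftrightarrow> x \<epsilon> R \<and>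
    (\<forall>e\<in>elts R. zero_R \<prec> e \<longrightarrow>
      (\<exists>N\<in>elts omega. \<forall>n\<in>elts omega. N = n \<or> N \<epsilon> n \<longrightarrow>
        app s n \<prec> x \<oplus> e \<and> x \<prec> app s n \<oplus> e))"

end


subsection \<open>The Cantor game on the interval from \<open>a0\<close> to \<open>b0\<close>\<close>

text \<open>
  A tuple \<open>(a\<^sub>0,b\<^sub>0,\<dots>,a\<^sub>m,b\<^sub>m)\<close> is represented by the ordered pair of the finite sequences
  \<open>(a\<^sub>0,\<dots>,a\<^sub>m)\<close> and \<open>(b\<^sub>0,\<dots>,b\<^sub>m)\<close>, and likewise \<open>(a\<^sub>0,b\<^sub>0,\<dots>,a\<^sub>m,b\<^sub>m,a\<^sub>m\<^sub>+\<^sub>1)\<close> by the pair of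
  \<open>(a\<^sub>0,\<dots>,a\<^sub>m\<^sub>+\<^sub>1)\<close> and \<open>(b\<^sub>0,\<dots>,b\<^sub>m)\<close>. These are the arguments of the strategy functions \<open>f\<^sub>m\<close>
  and \<open>g\<^sub>m\<close>, that is, the move at turn \<open>n\<close> is given by the function with index \<open>m = n - 1\<close>.
\<close>

locale cantor_game = reals_in_universe mem R addR multR ltR
  for mem :: "'v \<Rightarrow> 'v \<Rightarrow> bool"  (infix "\<epsilon>" 50)
  and R addR multR ltR :: 'v +
  fixes a0 b0 :: 'v
begin

definition position_A :: "'v \<Rightarrow> 'v \<Rightarrow> 'v \<Rightarrow> bool"
  where "position_A m a b \<longleftrightarrow>
    func a (succ m) R \<and> func b (succ m) R \<and> app a zero = a0 \<and> app b zero = b0 \<and>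
    (\<forall>i\<in>elts m. app a i \<prec> app a (succ i)) \<and>
    app a m \<prec> app b m \<and>
    (\<forall>i\<in>elts m. app b (succ i) \<prec> app b i)"

definition position_B :: "'v \<Rightarrow> 'v \<Rightarrow> 'v \<Rightarrow> bool"
  where "position_B m a b \<longleftrightarrow>
    func a (succ (succ m)) R \<and> func b (succ m) R \<and> app a zero = a0 \<and> app b zero = b0 \<and>
    (\<forall>i\<in>elts (succ m). app a i \<prec> app a (succ i)) \<and>
    app a (succ m) \<prec> app b m \<and>
    (\<forall>i\<in>elts m. app b (succ i) \<prec> app b i)"

definition strategy_A :: "'v \<Rightarrow> bool"
  where "strategy_A f \<longleftrightarrow> fun_on f omega \<and>
    (\<forall>m\<in>elts omega.
      func (app f m) (the_set (\<lambda>p. \<exists>a b. position_A m a b \<and> p = opair a b)) R \<and>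
      (\<forall>a b. position_A m a b \<longrightarrow>
        app a m \<prec> app (app f m) (opair a b) \<and> app (app f m) (opair a b) \<prec> app b m))"

definition strategy_B :: "'v \<Rightarrow> bool"
  where "strategy_B g \<longleftrightarrow> fun_on g omega \<and>
    (\<forall>m\<in>elts omega.
      func (app g m) (the_set (\<lambda>p. \<exists>a b. position_B m a b \<and> p = opair a b)) R \<and>
      (\<forall>a b. position_B m a b \<longrightarrow>
        app a (succ m) \<prec> app (app g m) (opair a b) \<and> app (app g m) (opair a b) \<prec> app b m))"

definition play :: "'v \<Rightarrow> 'v \<Rightarrow> bool"
  where "play a b \<longleftrightarrow>
    func a omega R \<and> func b omega R \<and> app a zero = a0 \<and> app b zero = b0 \<and>
    (\<forall>n\<in>elts omega. app a n \<prec> app a (succ n) \<and> app a (succ n) \<prec> app b (succ n) \<and>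
      app b (succ n) \<prec> app b n)"

definition consistent_A :: "'v \<Rightarrow> 'v \<Rightarrow> 'v \<Rightarrow> bool"
  where "consistent_A f a b \<longleftrightarrow>
    (\<forall>m\<in>elts omega. app a (succ m) =
      app (app f m) (opair (restr a (succ m)) (restr b (succ m))))"

definition consistent_B :: "'v \<Rightarrow> 'v \<Rightarrow> 'v \<Rightarrow> bool"
  where "consistent_B g a b \<longleftrightarrow>
    (\<forall>m\<in>elts omega. app b (succ m) =
      app (app g m) (opair (restr a (succ (succ m))) (restr b (succ m))))"

definition limit_set_A :: "'v \<Rightarrow> 'v set"
  where "limit_set_A f = {x. \<exists>a b. play a b \<and> consistent_A f a b \<and> limit_of a x}"

definition limit_set_B :: "'v \<Rightarrow> 'v set"
  where "limit_set_B g = {x. \<exists>a b. play a b \<and> consistent_B g a b \<and> limit_of a x}"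

definition winning_A :: "'v \<Rightarrow> 'v \<Rightarrow> bool"
  where "winning_A S f \<longleftrightarrow> strategy_A f \<and> limit_set_A f \<subseteq> elts S"

definition winning_B :: "'v \<Rightarrow> 'v \<Rightarrow> bool"
  where "winning_B S g \<longleftrightarrow> strategy_B g \<and> limit_set_B g \<subseteq> closed_interval a0 b0 - elts S"

definition A_has_winning_strategy :: "'v \<Rightarrow> bool"
  where "A_has_winning_strategy S \<longleftrightarrow> (\<exists>f. winning_A S f)"

definition B_has_winning_strategy :: "'v \<Rightarrow> bool"
  where "B_has_winning_strategy S \<longleftrightarrow> (\<exists>g. winning_B S g)"

definition uncountable_target :: "'v \<Rightarrow> bool"
  where "uncountable_target S \<longleftrightarrow> elts S \<subseteq> closed_interval a0 b0 \<and> \<not> countable_set S"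

end

end

(*
  By bisection a real of the interval is a subset of the natural numbers. In the perfect set game the
  first player produces such a subset bit by bit, passing the choice of infinitely many bits to the
  opponent, and tries to hit S. If he has a winning strategy, its outcomes form a perfect subset of S
  (lexicographically ordered by the sets Y of the bits the opponent answers with 1), and player A wins
  the Cantor game by moving to the outcomes of finite Y: the next move adds to Y one sufficiently
  large element, so that the limit is the outcome of the union of the sets Y. If the second player
  has a winning strategy, then the first player, aiming at x in S and passing whenever the answer
  will be the right bit, passes only finitely often; from then on the bits of x are determined by
  the strategy, so a finite sequence determines x and S is countable. Hence under AD player A wins
  for every uncountable S, and B cannot win as well, because the two strategies can be played
  against each other.

  Inside the structure, separation, replacement and induction are available only for first-order
  formulas. Hence every predicate and operation in use is shown to be definable with parameters,
  and recursion takes the form of a fixed point theorem for causal definable operators.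
*)
theory Submission
  imports Defs
begin

subsection \<open>Definable predicates and terms\<close>

text \<open>\<open>Def\<close> is a property of HOL predicates on environments, so statements are
  written in HOL and their formulas are never spelled out: \<open>intro dfi\<close> assembles them
  from closure rules. A value given by \<open>THE\<close> is out of control when there is no unique
  witness and need not be definable; therefore \<open>ap\<close> and \<open>\<boxplus>\<close> redo
  \<open>app\<close> and \<open>\<oplus>\<close> in definable form and agree with them on proper
  arguments. In the main argument the obstacle is that a dyadic real has two expansions, one ending
  in zeros and one in ones. A finite Y leaves zeros at unboundedly many passed positions, and this
  makes the order of the outcomes strict. Consequently distinct finite Y have distinct outcomes, and
  player A needs no memory: the current Y is read off from the last move.\<close>

primrec rename_fm :: "(nat \<Rightarrow> nat) \<Rightarrow> fm \<Rightarrow> fm" where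
  "rename_fm f (Mem i j) = Mem (f i) (f j)"
| "rename_fm f (Eq i j) = Eq (f i) (f j)"
| "rename_fm f (Neg p) = Neg (rename_fm f p)"
| "rename_fm f (Conj p q) = Conj (rename_fm f p) (rename_fm f q)"
| "rename_fm f (All i p) = All (f i) (rename_fm f p)"

definition interleave :: "(nat \<Rightarrow> 'v) \<Rightarrow> (nat \<Rightarrow> 'v) \<Rightarrow> nat \<Rightarrow> 'v"
  where "interleave e c n = (if even n then e (n div 2) else c (n div 2))"

lemma interleave_simps [simp]:
  "interleave e c (2 * n) = e n" "interleave e c (Suc (2 * n)) = c n"
  "interleave e c 0 = e 0" "interleave e c (Suc 0) = c 0"
  by (auto simp: interleave_def)

lemma nat_parity_cases:
  obtains k where "n = 2 * k" | k where "n = Suc (2 * k)"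
  by (metis evenE oddE Suc_eq_plus1)

lemma inj_parityI:
  fixes f g :: "nat \<Rightarrow> nat"
  assumes "inj f" "inj g" "\<And>i j. f i \<noteq> g j"
  shows "inj (\<lambda>n. if even n then f (n div 2) else g (n div 2))"
proof (rule injI)
  fix m n
  assume eq: "(if even m then f (m div 2) else g (m div 2)) = (if even n then f (n div 2) else g (n div 2))"
  have "even m \<longleftrightarrow> even n"
    using eq assms(3) by (metis (full_types))
  moreover from this have "m div 2 = n div 2"
    using eq assms(1,2) by (metis (full_types) injD)
  ultimately show "m = n"
    by presburger
qed

context set_universe
begin

text \<open>Binders are renamed as well; injectivity keeps a renamed bound variable apart from the
  renamed free ones.\<close>

lemma sat_rename: "inj f \<Longrightarrow> sat (rename_fm f p) env = sat p (\<lambda>i. env (f i))"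
proof (induction p arbitrary: env)
  case (All i p)
  have "(\<lambda>j. (env(f i := x)) (f j)) = (\<lambda>j. env (f j))(i := x)" for x
    using \<open>inj f\<close> by (auto simp: fun_eq_iff inj_eq)
  with All show ?case by simp
qed auto

text \<open>
  Variables are de Bruijn indices into \<open>e\<close>; in the formula they occupy the even indices, while the
  odd indices hold the parameters \<open>c\<close>.
\<close>

definition Def :: "((nat \<Rightarrow> 'v) \<Rightarrow> bool) \<Rightarrow> bool"
  where "Def P \<longleftrightarrow> (\<exists>p c. \<forall>e. P e \<longleftrightarrow> sat p (interleave e c))"

definition DefT :: "((nat \<Rightarrow> 'v) \<Rightarrow> 'v) \<Rightarrow> bool"
  where "DefT t \<longleftrightarrow> Def (\<lambda>e. e 0 = t (\<lambda>i. e (Suc i)))"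

lemma DefI: "(\<And>e. P e \<longleftrightarrow> sat p (interleave e c)) \<Longrightarrow> Def P"
  unfolding Def_def by blast

lemma DefE:
  assumes "Def P"
  obtains p c where "\<And>e. P e \<longleftrightarrow> sat p (interleave e c)"
  using assms unfolding Def_def by blast

lemma Def_rename:
  assumes "Def P" "inj f"
  shows "Def (\<lambda>e. P (\<lambda>i. e (f i)))"
proof -
  obtain p c where p: "\<And>e. P e \<longleftrightarrow> sat p (interleave e c)"
    by (rule DefE[OF assms(1)], rule that, assumption)
  define g where "g n = (if even n then 2 * f (n div 2) else Suc (2 * (n div 2)))" for n
  have g: "inj g" unfolding g_def
    by (rule inj_parityI) (use \<open>inj f\<close> in \<open>auto simp: inj_def, presburger\<close>)
  have "interleave e c (g n) = interleave (\<lambda>i. e (f i)) c n" for e n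
    by (cases n rule: nat_parity_cases) (auto simp: g_def)
  then show ?thesis
    by (intro DefI[where p = "rename_fm g p" and c = c]) (simp add: p sat_rename[OF g])
qed

text \<open>The parameters of one formula move to the even slots of a common parameter list, which
  leaves the odd slots to a second formula; \<open>Def_conj\<close> merges two lists in this way.
  The next lemma is the twin for the odd slots.\<close>

lemma Def_params_cong:
  assumes "Def P"
  obtains p c where "\<forall>e c'. (\<forall>n. c' (2 * n) = c n) \<longrightarrow> (P e \<longleftrightarrow> sat p (interleave e c'))"
proof -
  obtain p c where p: "\<And>e. P e \<longleftrightarrow> sat p (interleave e c)"
    by (rule DefE[OF assms], rule that, assumption)
  define g where "g n = (if even n then 2 * (n div 2) else Suc (2 * (2 * (n div 2))))" for n
  have g: "inj g" unfolding g_def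
    by (rule inj_parityI) (auto simp: inj_def, presburger)
  have "interleave e c' (g n) = interleave e c n" if "\<And>n. c' (2 * n) = c n" for e c' n
    using that interleave_simps(2)[of e c' "2 * k" for k]
    by (cases n rule: nat_parity_cases) (auto simp: g_def)
  then show ?thesis
    by (intro that[of c "rename_fm g p"]) (simp add: p sat_rename[OF g])
qed

lemma Def_params_cong':
  assumes "Def P"
  obtains p c where "\<forall>e c'. (\<forall>n. c' (Suc (2 * n)) = c n) \<longrightarrow> (P e \<longleftrightarrow> sat p (interleave e c'))"
proof -
  obtain p c where p: "\<And>e. P e \<longleftrightarrow> sat p (interleave e c)"
    by (rule DefE[OF assms], rule that, assumption)
  define g where "g n = (if even n then 2 * (n div 2) else Suc (2 * Suc (2 * (n div 2))))" for n
  have g: "inj g" unfolding g_def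
    by (rule inj_parityI) (auto simp: inj_def, presburger)
  have "interleave e c' (g n) = interleave e c n" if "\<And>n. c' (Suc (2 * n)) = c n" for e c' n
    using that interleave_simps(2)[of e c' "Suc (2 * k)" for k]
    by (cases n rule: nat_parity_cases) (auto simp: g_def simp del: mult_Suc_right)
  then show ?thesis
    by (intro that[of c "rename_fm g p"]) (simp add: p sat_rename[OF g])
qed

section \<open>Closure of definability under connectives and quantifiers\<close>

named_theorems dfi

lemma Def_const [dfi]: "Def (\<lambda>e. b)"
proof (cases b)
  case True
  then show ?thesis by (intro DefI[where p = "Eq 0 0"]) simp
next
  case False
  then show ?thesis by (intro DefI[where p = "Neg (Eq 0 0)"]) simp
qed

lemma Def_not [dfi]:
  assumes "Def P" shows "Def (\<lambda>e. \<not> P e)"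
proof -
  obtain p c where p: "\<And>e. P e \<longleftrightarrow> sat p (interleave e c)"
    by (rule DefE[OF assms], rule that, assumption)
  then show ?thesis by (intro DefI[where p = "Neg p" and c = c]) simp
qed

lemma Def_conj [dfi]:
  assumes "Def P" "Def Q" shows "Def (\<lambda>e. P e \<and> Q e)"
proof -
  obtain p c where p: "\<forall>e c'. (\<forall>n. c' (2 * n) = c n) \<longrightarrow> (P e \<longleftrightarrow> sat p (interleave e c'))"
    by (rule Def_params_cong[OF assms(1)])
  obtain q d where q: "\<forall>e c'. (\<forall>n. c' (Suc (2 * n)) = d n) \<longrightarrow> (Q e \<longleftrightarrow> sat q (interleave e c'))"
    by (rule Def_params_cong'[OF assms(2)])
  show ?thesis
    by (intro DefI[where p = "Conj p q" and c = "interleave c d"]) (use p[rule_format, of "interleave c d"] q[rule_format, of "interleave c d"] in simp)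
qed

lemma Def_disj [dfi]:
  assumes "Def P" "Def Q" shows "Def (\<lambda>e. P e \<or> Q e)"
proof -
  have "Def (\<lambda>e. \<not> (\<not> P e \<and> \<not> Q e))"
    by (rule Def_not, rule Def_conj; rule Def_not, rule assms)
  then show ?thesis by simp
qed

lemma Def_imp [dfi]:
  assumes "Def P" "Def Q" shows "Def (\<lambda>e. P e \<longrightarrow> Q e)"
proof -
  have "Def (\<lambda>e. \<not> P e \<or> Q e)"
    by (rule Def_disj, rule Def_not) (rule assms)+
  then show ?thesis by simp
qed

lemma Def_iff [dfi]:
  assumes "Def P" "Def Q" shows "Def (\<lambda>e. P e \<longleftrightarrow> Q e)"
proof -
  have "Def (\<lambda>e. (P e \<longrightarrow> Q e) \<and> (Q e \<longrightarrow> P e))"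
    by (intro Def_conj Def_imp assms)
  then show ?thesis
    by (simp only: iff_conv_conj_imp[of "P e" "Q e" for e])
qed

lemma Def_all [dfi]:
  assumes "Def (\<lambda>e. Q (\<lambda>i. e (Suc i)) (e 0))"
  shows "Def (\<lambda>e. \<forall>x. Q e x)"
proof -
  define P where "P e = Q (\<lambda>i. e (Suc i)) (e 0)" for e :: "nat \<Rightarrow> 'v"
  have "Def P"
    unfolding P_def by (rule assms)
  then obtain p c where p: "\<And>e. P e \<longleftrightarrow> sat p (interleave e c)"
    using DefE by blast
  \<comment> \<open>Index 1, the first parameter slot, is freed for the bound variable: de Bruijn
    variable 0 goes there, the other variables move down by one and the parameters up by
    one.\<close>
  define f where "f n = (if even n then (case n div 2 of 0 \<Rightarrow> 1 | Suc i \<Rightarrow> 2 * i)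
                                   else Suc (2 * Suc (n div 2)))" for n :: nat
  have f: "inj f" unfolding f_def
    by (rule inj_parityI) (auto simp: inj_def split: nat.splits, presburger+)
  have "((interleave e (case_nat undefined c))(1 := x)) (f n) = interleave (case_nat x e) c n" for e x n
  proof (cases n rule: nat_parity_cases)
    case (1 k)
    then show ?thesis
      using interleave_simps(1)[of "case_nat x e" c k] by (cases k) (auto simp: f_def)
  next
    case (2 k)
    then show ?thesis by (auto simp: f_def simp del: mult_Suc_right)
  qed
  then have "sat (All 1 (rename_fm f p)) (interleave e (case_nat undefined c)) \<longleftrightarrow> (\<forall>x. Q e x)" for e
    using p[of "case_nat x e" for x] by (simp add: P_def sat_rename[OF f])
  then show ?thesis unfolding Def_def by metis
qed

lemma Def_ex [dfi]:
  assumes "Def (\<lambda>e. Q (\<lambda>i. e (Suc i)) (e 0))"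
  shows "Def (\<lambda>e. \<exists>x. Q e x)"
  using Def_not[OF Def_all[of "\<lambda>e x. \<not> Q e x", OF Def_not[OF assms]]] by simp

text \<open>Variables from \<open>n\<close> on are frozen at the values \<open>d\<close> by turning
  them into parameters. The axiom schemata need this when they are applied under a fixed
  environment.\<close>

lemma Def_fix_params:
  assumes "Def P"
  shows "Def (\<lambda>e. P (\<lambda>i. if i < n then e i else d i))"
proof -
  obtain p c where p: "\<And>e. P e \<longleftrightarrow> sat p (interleave e c)"
    by (rule DefE[OF assms], rule that, assumption)
  define f where "f k = (if even k then (if k div 2 < n then 2 * (k div 2) else Suc (2 * (2 * (k div 2))))
                                   else Suc (2 * Suc (2 * (k div 2))))" for k
  have f: "inj f" unfolding f_def
    by (rule inj_parityI) (auto simp: inj_def, presburger+)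
  have "interleave e (interleave d c) (f k) = interleave (\<lambda>i. if i < n then e i else d i) c k" for e k
    using interleave_simps(2)[of e "interleave d c" "2 * i" for i]
      interleave_simps(2)[of e "interleave d c" "Suc (2 * i)" for i]
    by (cases k rule: nat_parity_cases) (auto simp: f_def simp del: mult_Suc_right)
  then show ?thesis
    by (intro DefI[where p = "rename_fm f p" and c = "interleave d c"]) (simp add: p sat_rename[OF f])
qed

lemma Def_fix:
  assumes "Def (\<lambda>e. Q (\<lambda>i. e (Suc i)) (e 0))"
  shows "Def (\<lambda>e. Q d (e 0))"
  using Def_fix_params[OF assms, of "Suc 0" "case_nat undefined d"] by simp

lemma Def_fix2:
  assumes "Def (\<lambda>e. Q (\<lambda>i. e (Suc (Suc i))) (e 0) (e (Suc 0)))"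
  shows "Def (\<lambda>e. Q d (e 0) (e (Suc 0)))"
  using Def_fix_params[OF assms, of "Suc (Suc 0)" "case_nat undefined (case_nat undefined d)"] by simp

section \<open>Definable terms and their substitution\<close>

lemma Def_var_mem: "Def (\<lambda>e. e i \<epsilon> e j)"
  by (rule DefI[where p = "Mem (2 * i) (2 * j)"]) simp

lemma DefT_var [dfi]: "DefT (\<lambda>e. e i)"
  unfolding DefT_def by (rule DefI[where p = "Eq 0 (2 * Suc i)"]) (simp del: mult_Suc_right)

lemma DefT_const [dfi]: "DefT (\<lambda>e. a)"
  unfolding DefT_def by (rule DefI[where p = "Eq 0 1" and c = "\<lambda>_. a"]) simp

text \<open>Terms are substituted through their graphs, \<open>P (t e)\<close> being read as
  \<open>\<exists>x. x = t e \<and> P x\<close>, because formulas have no function symbols.\<close>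

lemma Def_subst1:
  assumes "Def (\<lambda>e. P (e 0))" "DefT t"
  shows "Def (\<lambda>e. P (t e))"
proof -
  have "Def (\<lambda>e. \<exists>x. x = t e \<and> P x)"
    by (intro dfi assms(2)[unfolded DefT_def] assms(1))
  then show ?thesis by simp
qed

lemma DefT_weaken: "DefT t \<Longrightarrow> DefT (\<lambda>e. t (\<lambda>i. e (Suc i)))"
  unfolding DefT_def
  by (drule Def_rename[where f = "case_nat 0 (\<lambda>i. Suc (Suc i))"]) (auto simp: inj_def split: nat.splits)

lemma Def_subst2:
  assumes "Def (\<lambda>e. P (e 0) (e (Suc 0)))" "DefT s" "DefT t"
  shows "Def (\<lambda>e. P (s e) (t e))"
proof -
  have "Def (\<lambda>e. P (e (Suc 0)) (e 0))"
    using Def_rename[OF assms(1), of "\<lambda>n. if n = 0 then 1 else if n = 1 then 0 else n"]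
    by (auto simp: inj_def)
  then have "Def (\<lambda>e. \<exists>x. x = s e \<and> (\<exists>y. y = t e \<and> P x y))"
    by (intro dfi assms(2)[unfolded DefT_def] DefT_weaken[OF assms(3), unfolded DefT_def])
  then show ?thesis by simp
qed

lemma Def_subst3:
  assumes "Def (\<lambda>e. P (e 0) (e (Suc 0)) (e (Suc (Suc 0))))" "DefT s" "DefT t" "DefT u"
  shows "Def (\<lambda>e. P (s e) (t e) (u e))"
proof -
  have "Def (\<lambda>e. P (e (Suc (Suc 0))) (e (Suc 0)) (e 0))"
    using Def_rename[OF assms(1), of "\<lambda>n. if n = 0 then 2 else if n = 2 then 0 else n"]
    by (auto simp: inj_def numeral_2_eq_2)
  then have "Def (\<lambda>e. \<exists>x. x = s e \<and> (\<exists>y. y = t e \<and> (\<exists>z. z = u e \<and> P x y z)))"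
    by (intro dfi assms(2)[unfolded DefT_def] DefT_weaken[OF assms(3), unfolded DefT_def]
        DefT_weaken[OF DefT_weaken[OF assms(4)], unfolded DefT_def])
  then show ?thesis by simp
qed

lemma Def_mem [dfi]: "DefT s \<Longrightarrow> DefT t \<Longrightarrow> Def (\<lambda>e. s e \<epsilon> t e)"
  by (rule Def_subst2[where P = "(\<epsilon>)", OF Def_var_mem])

lemma Def_eq [dfi]: "DefT s \<Longrightarrow> DefT t \<Longrightarrow> Def (\<lambda>e. s e = t e)"
  by (rule Def_subst2[where P = "(=)"]) (rule DefI[where p = "Eq 0 2"], simp add: interleave_def)

lemma Def_elts [dfi]: "DefT s \<Longrightarrow> DefT t \<Longrightarrow> Def (\<lambda>e. s e \<in> elts (t e))"
  unfolding elts_def by (simp add: Def_mem)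

lemma Def_subset [dfi]: "DefT s \<Longrightarrow> DefT t \<Longrightarrow> Def (\<lambda>e. elts (s e) \<subseteq> elts (t e))"
  by (rule Def_subst2[where P = "\<lambda>x y. elts x \<subseteq> elts y"]) (unfold subset_iff, intro dfi)

lemma Def_ball [dfi]:
  assumes "DefT t" "Def (\<lambda>e. Q (\<lambda>i. e (Suc i)) (e 0))"
  shows "Def (\<lambda>e. \<forall>x\<in>elts (t e). Q e x)"
  unfolding Ball_def by (intro dfi assms(2) DefT_weaken[OF assms(1)])

lemma Def_bex [dfi]:
  assumes "DefT t" "Def (\<lambda>e. Q (\<lambda>i. e (Suc i)) (e 0))"
  shows "Def (\<lambda>e. \<exists>x\<in>elts (t e). Q e x)"
  unfolding Bex_def by (intro dfi assms(2) DefT_weaken[OF assms(1)])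

text \<open>Makes room for one more binder, as required when a predicate occurs under two nested
  quantifiers, for instance in the expansion of \<open>\<exists>!\<close>.\<close>

lemma Def_insert_var:
  assumes "Def (\<lambda>e. Q (\<lambda>i. e (Suc i)) (e 0))"
  shows "Def (\<lambda>e. Q (\<lambda>i. e (Suc (Suc i))) (e 0))"
  using Def_rename[OF assms, of "case_nat 0 (\<lambda>i. Suc (Suc i))"]
  by (auto simp: inj_def split: nat.splits)

lemma Def_ex1 [dfi]:
  assumes "Def (\<lambda>e. Q (\<lambda>i. e (Suc i)) (e 0))"
  shows "Def (\<lambda>e. \<exists>!x. Q e x)"
  unfolding Ex1_def by (intro dfi assms Def_insert_var[of Q])

lemma DefT_graph:
  assumes "\<And>e y. y = t e \<longleftrightarrow> Q e y" "Def (\<lambda>e. Q (\<lambda>i. e (Suc i)) (e 0))"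
  shows "DefT t"
  unfolding DefT_def assms(1) by (rule assms(2))

lemma DefT_subst1:
  assumes "DefT (\<lambda>e. F (e 0))" "DefT t"
  shows "DefT (\<lambda>e. F (t e))"
  unfolding DefT_def
  by (rule Def_subst2[where P = "\<lambda>y x. y = F x", OF _ DefT_var DefT_weaken[OF assms(2)]])
     (rule assms(1)[unfolded DefT_def])

lemma DefT_subst2:
  assumes "DefT (\<lambda>e. F (e 0) (e (Suc 0)))" "DefT s" "DefT t"
  shows "DefT (\<lambda>e. F (s e) (t e))"
  unfolding DefT_def
  by (rule Def_subst3[where P = "\<lambda>y x z. y = F x z",
        OF _ DefT_var DefT_weaken[OF assms(2)] DefT_weaken[OF assms(3)]])
     (rule assms(1)[unfolded DefT_def])

lemma DefT_if [dfi]: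
  assumes "Def P" "DefT s" "DefT t"
  shows "DefT (\<lambda>e. if P e then s e else t e)"
proof (rule DefT_graph[where Q = "\<lambda>e y. (P e \<and> y = s e) \<or> (\<not> P e \<and> y = t e)"])
  have "Def (\<lambda>e. P (\<lambda>i. e (Suc i)))"
    by (rule Def_rename[OF assms(1)]) simp
  then show "Def (\<lambda>e. (P (\<lambda>i. e (Suc i)) \<and> e 0 = s (\<lambda>i. e (Suc i))) \<or>
      (\<not> P (\<lambda>i. e (Suc i)) \<and> e 0 = t (\<lambda>i. e (Suc i))))"
    by (intro dfi assms(2,3)[unfolded DefT_def])
qed auto

text \<open>
  Unlike \<open>The\<close>, this is definable from a definable predicate even when there is no unique witness.
\<close>

definition the1 :: "('v \<Rightarrow> bool) \<Rightarrow> 'v"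
  where "the1 P = (if \<exists>!x. P x then THE x. P x else zero)"

lemma the1_eqI:
  assumes "P x" "\<And>y. P y \<Longrightarrow> y = x"
  shows "the1 P = x"
proof -
  have "\<exists>!x. P x"
    using assms by blast
  then show ?thesis
    using the_equality[of P x, OF assms] by (simp add: the1_def)
qed

lemma the1I: "\<exists>!x. P x \<Longrightarrow> P (the1 P)"
  unfolding the1_def by (simp add: theI')

lemma DefT_the1 [dfi]:
  assumes "Def (\<lambda>e. P (\<lambda>i. e (Suc i)) (e 0))"
  shows "DefT (\<lambda>e. the1 (P e))"
proof (rule DefT_graph[where Q = "\<lambda>e y. (P e y \<and> (\<forall>x. P e x \<longrightarrow> x = y)) \<or> (\<not> (\<exists>!x. P e x) \<and> y = zero)"])
  fix e y
  show "y = the1 (P e) \<longleftrightarrow> (P e y \<and> (\<forall>x. P e x \<longrightarrow> x = y)) \<or> (\<not> (\<exists>!x. P e x) \<and> y = zero)"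
  proof (cases "\<exists>!x. P e x")
    case True
    with the1I[OF this] show ?thesis by auto
  next
    case False
    then show ?thesis by (auto simp: the1_def)
  qed
next
  show "Def (\<lambda>e. (P (\<lambda>i. e (Suc i)) (e 0) \<and> (\<forall>x. P (\<lambda>i. e (Suc i)) x \<longrightarrow> x = e 0)) \<or>
      (\<not> (\<exists>!x. P (\<lambda>i. e (Suc i)) x) \<and> e 0 = zero))"
    by (intro dfi assms Def_insert_var[of P])
qed

end

subsection \<open>Set constructions in a universe of ZF\<close>

locale zf_universe = set_universe mem for mem :: "'v \<Rightarrow> 'v \<Rightarrow> bool"  (infix "\<epsilon>" 50) +
  assumes ZF: ZF
begin

lemma elts_iff [simp]: "x \<in> elts A \<longleftrightarrow> x \<epsilon> A"
  by (simp add: elts_def)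

lemma ext: "(\<And>w. w \<epsilon> x \<longleftrightarrow> w \<epsilon> y) \<Longrightarrow> x = y"
  using ZF unfolding ZF_def Extensionality_def elts_def by auto

lemma the_set_eqI: "(\<And>w. w \<epsilon> z \<longleftrightarrow> P w) \<Longrightarrow> the_set P = z"
  unfolding the_set_def by (rule the_equality) (auto intro: ext)

lemma the_set_mem: "\<exists>z. \<forall>w. w \<epsilon> z \<longleftrightarrow> P w \<Longrightarrow> w \<epsilon> the_set P \<longleftrightarrow> P w"
  using the_set_eqI[of _ P] by blast

text \<open>\<open>the_set\<close> is a \<open>THE\<close> and uncontrolled on proper classes; the
  existence assumption makes its graph expressible by membership alone.\<close>

lemma DefT_the_set:
  assumes "\<And>e. \<exists>z. \<forall>w. w \<epsilon> z \<longleftrightarrow> P e w" "Def (\<lambda>e. P (\<lambda>i. e (Suc i)) (e 0))"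
  shows "DefT (\<lambda>e. the_set (P e))"
proof (rule DefT_graph[where Q = "\<lambda>e y. \<forall>w. w \<epsilon> y \<longleftrightarrow> P e w"])
  show "y = the_set (P e) \<longleftrightarrow> (\<forall>w. w \<epsilon> y \<longleftrightarrow> P e w)" for e y
    using the_set_mem[OF assms(1)] by (auto intro: ext)
  show "Def (\<lambda>e. \<forall>w. w \<epsilon> e 0 \<longleftrightarrow> P (\<lambda>i. e (Suc i)) w)"
    by (intro dfi Def_insert_var[of P] assms(2))
qed

lemma separation:
  assumes "Def (\<lambda>e. P (e 0))"
  shows "\<exists>B. \<forall>x. x \<epsilon> B \<longleftrightarrow> x \<epsilon> A \<and> P x"
proof -
  obtain p c where p: "\<And>e. P (e 0) \<longleftrightarrow> sat p (interleave e c)"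
    by (rule DefE[OF assms], rule that, assumption)
  have "P x \<longleftrightarrow> sat p ((interleave (\<lambda>_. undefined) c)(0 := x))" for x
  proof -
    have "(interleave (\<lambda>_. undefined) c)(0 := x) = interleave ((\<lambda>_. undefined)(0 := x)) c"
      by (auto simp: fun_eq_iff interleave_def)
    with p[of "(\<lambda>_. undefined)(0 := x)"] show ?thesis by simp
  qed
  moreover have Separation
    using ZF unfolding ZF_def by blast
  ultimately show ?thesis
    unfolding Separation_def by simp
qed

lemma replacement:
  assumes "DefT (\<lambda>e. t (e 0))"
  shows "\<exists>B. \<forall>y. y \<epsilon> B \<longleftrightarrow> (\<exists>x. x \<epsilon> A \<and> y = t x)"
proof -
  have D: "Def (\<lambda>e. e (Suc 0) = t (e 0))"
    by (intro dfi assms)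
  obtain p c where p: "\<And>e. e (Suc 0) = t (e 0) \<longleftrightarrow> sat p (interleave e c)"
    by (rule DefE[OF D], rule that, assumption)
  \<comment> \<open>The schema reads its arguments from variables 0 and 1, whereas de Bruijn
    variable 1 sits at index 2; \<open>f\<close> redirects it and shifts everything else past
    1.\<close>
  define f :: "nat \<Rightarrow> nat" where "f n = (if n = 0 then 0 else if n = 2 then 1 else n + 2)" for n
  have f: "inj f"
    by (auto simp: f_def inj_def)
  define env where "env n = interleave (\<lambda>_. undefined) c (n - 2)" for n
  have sat: "sat (rename_fm f p) (env(0 := x, 1 := y)) \<longleftrightarrow> y = t x" for x y
  proof -
    have "(env(0 := x, 1 := y)) (f n) = interleave ((\<lambda>_. undefined)(0 := x, 1 := y)) c n" for n
      by (cases n rule: nat_parity_cases) (auto simp: f_def env_def interleave_def)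
    with p[of "(\<lambda>_. undefined)(0 := x, 1 := y)"] show ?thesis
      by (simp add: sat_rename[OF f])
  qed
  have Replacement
    using ZF unfolding ZF_def by blast
  then have "\<exists>B. \<forall>y. y \<epsilon> B \<longleftrightarrow> (\<exists>x\<in>elts A. sat (rename_fm f p) (env(0 := x, 1 := y)))"
    unfolding Replacement_def by (metis sat)
  then show ?thesis
    unfolding sat Bex_def elts_iff .
qed

definition sep :: "'v \<Rightarrow> ('v \<Rightarrow> bool) \<Rightarrow> 'v"
  where "sep A P = the_set (\<lambda>x. x \<epsilon> A \<and> P x)"

lemma sep_iff: "Def (\<lambda>e. P (e 0)) \<Longrightarrow> x \<epsilon> sep A P \<longleftrightarrow> x \<epsilon> A \<and> P x"
  unfolding sep_def by (rule the_set_mem) (rule separation)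

lemma DefT_sep [dfi]:
  assumes "DefT A" "Def (\<lambda>e. P (\<lambda>i. e (Suc i)) (e 0))"
  shows "DefT (\<lambda>e. sep (A e) (P e))"
  unfolding sep_def
  by (rule DefT_the_set) (auto intro!: separation dfi DefT_weaken assms Def_fix[where Q = P])

lemma upair_iff [simp]: "w \<epsilon> upair x y \<longleftrightarrow> w = x \<or> w = y"
  unfolding upair_def using ZF by (intro the_set_mem) (simp add: ZF_def Pairing_def)

lemma DefT_upair [dfi]: "DefT s \<Longrightarrow> DefT t \<Longrightarrow> DefT (\<lambda>e. upair (s e) (t e))"
proof (rule DefT_subst2[where F = upair])
  show "DefT (\<lambda>e. upair (e 0) (e (Suc 0)))"
    unfolding upair_def
    by (rule DefT_the_set) (use ZF in \<open>auto simp: ZF_def Pairing_def intro!: dfi\<close>)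
qed

lemma DefT_opair [dfi]: "DefT s \<Longrightarrow> DefT t \<Longrightarrow> DefT (\<lambda>e. opair (s e) (t e))"
  unfolding opair_def by (intro dfi)

lemma upair_eq_iff: "upair a b = upair c d \<longleftrightarrow> (a = c \<and> b = d) \<or> (a = d \<and> b = c)"
proof -
  have "upair a b = upair c d \<longleftrightarrow> (\<forall>w. w = a \<or> w = b \<longleftrightarrow> w = c \<or> w = d)"
    by (metis upair_iff ext)
  then show ?thesis by metis
qed

lemma opair_eq [simp]: "opair a b = opair c d \<longleftrightarrow> a = c \<and> b = d"
  unfolding opair_def upair_eq_iff by auto

definition union :: "'v \<Rightarrow> 'v"
  where "union A = the_set (\<lambda>w. \<exists>y\<in>elts A. w \<epsilon> y)"

lemma union_iff [simp]: "w \<epsilon> union A \<longleftrightarrow> (\<exists>y. y \<epsilon> A \<and> w \<epsilon> y)"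
  unfolding union_def using ZF by (subst the_set_mem) (auto simp: ZF_def Union_axiom_def)

lemma DefT_union [dfi]: "DefT t \<Longrightarrow> DefT (\<lambda>e. union (t e))"
proof (rule DefT_subst1[where F = union])
  show "DefT (\<lambda>e. union (e 0))"
    unfolding union_def
    by (rule DefT_the_set) (use ZF in \<open>auto simp: ZF_def Union_axiom_def intro!: dfi simp del: elts_iff\<close>)
qed

definition un :: "'v \<Rightarrow> 'v \<Rightarrow> 'v"
  where "un A B = union (upair A B)"

lemma un_iff [simp]: "w \<epsilon> un A B \<longleftrightarrow> w \<epsilon> A \<or> w \<epsilon> B"
  unfolding un_def by auto

lemma DefT_un [dfi]: "DefT s \<Longrightarrow> DefT t \<Longrightarrow> DefT (\<lambda>e. un (s e) (t e))"
  unfolding un_def by (intro dfi)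

definition pow :: "'v \<Rightarrow> 'v"
  where "pow A = the_set (\<lambda>w. elts w \<subseteq> elts A)"

lemma pow_iff [simp]: "w \<epsilon> pow A \<longleftrightarrow> elts w \<subseteq> elts A"
  unfolding pow_def using ZF by (subst the_set_mem) (auto simp: ZF_def Power_set_def)

lemma DefT_pow [dfi]: "DefT t \<Longrightarrow> DefT (\<lambda>e. pow (t e))"
proof (rule DefT_subst1[where F = pow])
  show "DefT (\<lambda>e. pow (e 0))"
    unfolding pow_def
    by (rule DefT_the_set) (use ZF in \<open>auto simp: ZF_def Power_set_def intro!: dfi\<close>)
qed

lemma the_set_bounded_mem:
  assumes "\<And>w. P w \<Longrightarrow> w \<epsilon> A" "Def (\<lambda>e. P (e 0))"
  shows "w \<epsilon> the_set P \<longleftrightarrow> P w"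
  by (rule the_set_mem) (use separation[OF assms(2), of A] assms(1) in blast)

lemma opair_in_pow: "x \<epsilon> A \<Longrightarrow> y \<epsilon> B \<Longrightarrow> opair x y \<epsilon> pow (pow (un A B))"
  unfolding opair_def by (auto simp: subset_iff)

lemma prod_set_iff [simp]: "p \<epsilon> prod_set A B \<longleftrightarrow> (\<exists>x y. x \<epsilon> A \<and> y \<epsilon> B \<and> p = opair x y)"
  unfolding prod_set_def
  by (subst the_set_bounded_mem[where A = "pow (pow (un A B))"]) 
     (auto intro: opair_in_pow simp del: pow_iff intro!: dfi)

lemma DefT_prod_set [dfi]: "DefT s \<Longrightarrow> DefT t \<Longrightarrow> DefT (\<lambda>e. prod_set (s e) (t e))"
proof (rule DefT_subst2[where F = prod_set])
  show "DefT (\<lambda>e. prod_set (e 0) (e (Suc 0)))"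
    unfolding prod_set_def
  proof (rule DefT_the_set)
    show "\<exists>z. \<forall>w. w \<epsilon> z \<longleftrightarrow> (\<exists>x\<in>elts (e 0). \<exists>y\<in>elts (e (Suc 0)). w = opair x y)" for e
      by (rule exI[of _ "prod_set (e 0) (e (Suc 0))"]) auto
  qed (intro dfi)
qed

subsection \<open>Functions\<close>

text \<open>Total and definable counterpart of \<open>app\<close>: outside the domain it gives the
  default of \<open>the1\<close> instead of an uncontrolled \<open>THE\<close>.\<close>

definition ap :: "'v \<Rightarrow> 'v \<Rightarrow> 'v"
  where "ap f x = the1 (\<lambda>y. opair x y \<epsilon> f)"

lemma DefT_ap [dfi]: "DefT s \<Longrightarrow> DefT t \<Longrightarrow> DefT (\<lambda>e. ap (s e) (t e))"
  by (rule DefT_subst2[where F = ap]) (unfold ap_def, intro dfi)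

lemma Def_fun_on [dfi]: "DefT s \<Longrightarrow> DefT t \<Longrightarrow> Def (\<lambda>e. fun_on (s e) (t e))"
  by (rule Def_subst2[where P = fun_on]) (unfold fun_on_def, intro dfi)

lemma app_eq_ap: "fun_on f A \<Longrightarrow> x \<epsilon> A \<Longrightarrow> app f x = ap f x"
  unfolding app_def ap_def the1_def fun_on_def by auto

lemma ap_mem: "fun_on f A \<Longrightarrow> x \<epsilon> A \<Longrightarrow> opair x (ap f x) \<epsilon> f"
  unfolding ap_def fun_on_def by (rule the1I) auto

lemma ap_unique:
  assumes "fun_on f A" "opair x y \<epsilon> f"
  shows "x \<epsilon> A \<and> y = ap f x"
proof -
  have "x \<epsilon> A"
    using assms unfolding fun_on_def Ball_def Bex_def elts_iff by (metis opair_eq)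
  moreover from this have "\<exists>!y. opair x y \<epsilon> f" "opair x (ap f x) \<epsilon> f"
    using assms ap_mem by (auto simp: fun_on_def)
  ultimately show ?thesis
    using assms(2) by blast
qed

lemma func_iff: "func f A B \<longleftrightarrow> fun_on f A \<and> (\<forall>x\<in>elts A. ap f x \<epsilon> B)"
  unfolding func_def by (auto simp: app_eq_ap)

lemma Def_func [dfi]: "DefT s \<Longrightarrow> DefT t \<Longrightarrow> DefT u \<Longrightarrow> Def (\<lambda>e. func (s e) (t e) (u e))"
  by (rule Def_subst3[where P = func]) (unfold func_iff, intro dfi)

lemma func_fun_on [simp]: "func f A B \<Longrightarrow> fun_on f A"
  by (simp add: func_iff)

lemma func_ap [simp]: "func f A B \<Longrightarrow> x \<epsilon> A \<Longrightarrow> ap f x \<epsilon> B"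
  by (simp add: func_iff)

lemma func_app: "func f A B \<Longrightarrow> x \<epsilon> A \<Longrightarrow> app f x = ap f x"
  using app_eq_ap func_fun_on by blast

lemma fun_on_ext:
  assumes "fun_on f A" "fun_on g A" "\<And>x. x \<epsilon> A \<Longrightarrow> ap f x = ap g x"
  shows "f = g"
proof (rule ext)
  have *: "w \<epsilon> g" if "w \<epsilon> f" "fun_on f A" "fun_on g A" "\<And>x. x \<epsilon> A \<Longrightarrow> ap f x = ap g x" for w f g
  proof -
    obtain x y where w: "w = opair x y"
      using \<open>w \<epsilon> f\<close> \<open>fun_on f A\<close> unfolding fun_on_def Ball_def Bex_def elts_iff by blast
    then show ?thesis
      using ap_unique[of f A x y] ap_mem[of g A x] that by auto
  qed
  then show "w \<epsilon> f \<longleftrightarrow> w \<epsilon> g" for w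
    using assms by metis
qed

text \<open>The graph is a set by replacement, so no codomain has to be known in advance.\<close>

definition lam :: "'v \<Rightarrow> ('v \<Rightarrow> 'v) \<Rightarrow> 'v"
  where "lam A t = the_set (\<lambda>p. \<exists>x. x \<epsilon> A \<and> p = opair x (t x))"

lemma lam_exists:
  assumes "DefT (\<lambda>e. t (e 0))"
  shows "\<exists>z. \<forall>w. w \<epsilon> z \<longleftrightarrow> (\<exists>x. x \<epsilon> A \<and> w = opair x (t x))"
  by (rule replacement) (intro dfi assms)

lemma lam_iff: "DefT (\<lambda>e. t (e 0)) \<Longrightarrow> p \<epsilon> lam A t \<longleftrightarrow> (\<exists>x. x \<epsilon> A \<and> p = opair x (t x))"
  unfolding lam_def by (rule the_set_mem) (rule lam_exists)

lemma DefT_fix: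
  assumes "DefT (\<lambda>e. t (\<lambda>i. e (Suc i)) (e 0))"
  shows "DefT (\<lambda>e. t d (e 0))"
  using Def_fix2[where Q = "\<lambda>e y x. y = t e x"] assms unfolding DefT_def by blast

lemma DefT_lam [dfi]:
  assumes "DefT A" "DefT (\<lambda>e. t (\<lambda>i. e (Suc i)) (e 0))"
  shows "DefT (\<lambda>e. lam (A e) (t e))"
  unfolding lam_def
proof (rule DefT_the_set)
  show "\<exists>z. \<forall>w. w \<epsilon> z \<longleftrightarrow> (\<exists>x. x \<epsilon> A e \<and> w = opair x (t e x))" for e
    by (intro lam_exists DefT_fix[where t = t] assms)
  have "DefT (\<lambda>e. t (\<lambda>i. e (Suc (Suc i))) (e 0))"
    using Def_rename[OF assms(2)[unfolded DefT_def], of "\<lambda>i. if i < 2 then i else Suc i"]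
    unfolding DefT_def by (auto simp: inj_def)
  then show "Def (\<lambda>e. \<exists>x. x \<epsilon> A (\<lambda>i. e (Suc i)) \<and> e 0 = opair x (t (\<lambda>i. e (Suc i)) x))"
    by (intro dfi DefT_weaken[OF DefT_weaken[OF assms(1)]])
qed

lemma fun_on_lam: "DefT (\<lambda>e. t (e 0)) \<Longrightarrow> fun_on (lam A t) A"
  unfolding fun_on_def by (auto simp: lam_iff)

lemma ap_lam: "DefT (\<lambda>e. t (e 0)) \<Longrightarrow> x \<epsilon> A \<Longrightarrow> ap (lam A t) x = t x"
  using ap_mem[OF fun_on_lam] lam_iff by fastforce

lemma func_lam: "DefT (\<lambda>e. t (e 0)) \<Longrightarrow> (\<And>x. x \<epsilon> A \<Longrightarrow> t x \<epsilon> B) \<Longrightarrow> func (lam A t) A B"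
  by (simp add: func_iff fun_on_lam ap_lam)

lemma restr_iff [simp]: "p \<epsilon> restr f A \<longleftrightarrow> p \<epsilon> f \<and> (\<exists>x\<in>elts A. \<exists>y. p = opair x y)"
  unfolding restr_def
  by (subst the_set_bounded_mem[where A = f]) (auto intro!: dfi)

lemma DefT_restr [dfi]: "DefT s \<Longrightarrow> DefT t \<Longrightarrow> DefT (\<lambda>e. restr (s e) (t e))"
proof (rule DefT_subst2[where F = restr])
  show "DefT (\<lambda>e. restr (e 0) (e (Suc 0)))"
    unfolding restr_def
  proof (rule DefT_the_set)
    show "\<exists>z. \<forall>w. w \<epsilon> z \<longleftrightarrow> (w \<epsilon> e 0 \<and> (\<exists>x\<in>elts (e (Suc 0)). \<exists>y. w = opair x y))" for e
      by (rule exI[of _ "restr (e 0) (e (Suc 0))"]) auto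
  qed (intro dfi)
qed

lemma fun_on_restr: "fun_on f A \<Longrightarrow> elts B \<subseteq> elts A \<Longrightarrow> fun_on (restr f B) B"
  unfolding fun_on_def Ball_def Bex_def elts_iff subset_iff restr_iff opair_eq by blast

lemma ap_restr:
  assumes "fun_on f A" "elts B \<subseteq> elts A" "x \<epsilon> B"
  shows "ap (restr f B) x = ap f x"
  using ap_mem[OF fun_on_restr[OF assms(1,2)] assms(3)] ap_unique[OF assms(1), of x "ap (restr f B) x"]
  by simp

lemma func_restr: "func f A C \<Longrightarrow> elts B \<subseteq> elts A \<Longrightarrow> func (restr f B) B C"
  unfolding func_iff using fun_on_restr ap_restr by fastforce

definition funset :: "'v \<Rightarrow> 'v \<Rightarrow> 'v"
  where "funset A B = sep (pow (prod_set A B)) (\<lambda>f. func f A B)"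

lemma funset_iff [simp]: "f \<epsilon> funset A B \<longleftrightarrow> func f A B"
proof -
  have "w \<epsilon> prod_set A B" if f: "func f A B" "w \<epsilon> f" for w
  proof -
    obtain x y where w: "w = opair x y"
      using f unfolding func_iff fun_on_def Ball_def Bex_def elts_iff by blast
    then have "x \<epsilon> A" "y = ap f x"
      using ap_unique[of f A x y] f by auto
    with w f show ?thesis by simp
  qed
  then show ?thesis
    unfolding funset_def by (subst sep_iff) (auto intro!: dfi simp del: prod_set_iff)
qed

lemma DefT_funset [dfi]: "DefT s \<Longrightarrow> DefT t \<Longrightarrow> DefT (\<lambda>e. funset (s e) (t e))"
  by (rule DefT_subst2[where F = funset]) (unfold funset_def, intro dfi)

definition fst_of :: "'v \<Rightarrow> 'v"
  where "fst_of p = the1 (\<lambda>a. \<exists>b. p = opair a b)"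

definition snd_of :: "'v \<Rightarrow> 'v"
  where "snd_of p = the1 (\<lambda>b. \<exists>a. p = opair a b)"

lemma fst_of [simp]: "fst_of (opair a b) = a"
  unfolding fst_of_def by (rule the1_eqI) auto

lemma snd_of [simp]: "snd_of (opair a b) = b"
  unfolding snd_of_def by (rule the1_eqI) auto

lemma DefT_fst_of [dfi]: "DefT t \<Longrightarrow> DefT (\<lambda>e. fst_of (t e))"
  by (rule DefT_subst1[where F = fst_of]) (unfold fst_of_def, intro dfi)

lemma DefT_snd_of [dfi]: "DefT t \<Longrightarrow> DefT (\<lambda>e. snd_of (t e))"
  by (rule DefT_subst1[where F = snd_of]) (unfold snd_of_def, intro dfi)

subsection \<open>Natural numbers\<close>

lemma ball_elts [simp]: "(\<forall>x\<in>elts A. P x) \<longleftrightarrow> (\<forall>x. x \<epsilon> A \<longrightarrow> P x)"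
  by (simp add: Ball_def)

lemma bex_elts [simp]: "(\<exists>x\<in>elts A. P x) \<longleftrightarrow> (\<exists>x. x \<epsilon> A \<and> P x)"
  by (simp add: Bex_def)

lemma zero_iff [simp]: "\<not> w \<epsilon> zero"
proof -
  have "\<exists>z. \<forall>w. w \<epsilon> z \<longleftrightarrow> False"
    using separation[of "\<lambda>_. False" undefined] by (simp add: Def_const)
  then show ?thesis
    unfolding zero_def using the_set_mem[of "\<lambda>_. False"] by blast
qed

lemma succ_eq: "succ n = un n (upair n n)"
  unfolding succ_def by (rule the_set_eqI) auto

lemma succ_iff [simp]: "w \<epsilon> succ n \<longleftrightarrow> w \<epsilon> n \<or> w = n"
  unfolding succ_eq by auto

lemma DefT_succ [dfi]: "DefT t \<Longrightarrow> DefT (\<lambda>e. succ (t e))"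
  unfolding succ_eq by (intro dfi)

lemma succ_neq_zero [simp]: "succ n \<noteq> zero" "zero \<noteq> succ n"
  by (metis succ_iff zero_iff)+

lemma foundation: "\<exists>y. y \<epsilon> x \<Longrightarrow> \<exists>y. y \<epsilon> x \<and> (\<forall>z. z \<epsilon> y \<longrightarrow> \<not> z \<epsilon> x)"
  using ZF unfolding ZF_def Foundation_def elts_def by blast

lemma not_mem_self [simp]: "\<not> x \<epsilon> x"
  using foundation[of "upair x x"] by auto

lemma mem_asym: "x \<epsilon> y \<Longrightarrow> \<not> y \<epsilon> x"
  using foundation[of "upair x y"] by auto

text \<open>The class of all elements common to the inductive sets is bounded by the inductive set
  from Infinity, so separation makes it a set.\<close>

lemma omega_iff: "n \<epsilon> omega \<longleftrightarrow> (\<forall>I. zero \<epsilon> I \<and> (\<forall>k\<in>elts I. succ k \<epsilon> I) \<longrightarrow> n \<epsilon> I)"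
proof -
  obtain I e where I: "e \<epsilon> I" "elts e = {}" "\<And>x. x \<epsilon> I \<Longrightarrow> \<exists>y. y \<epsilon> I \<and> elts y = insert x (elts x)"
    using ZF unfolding ZF_def Infinity_def Bex_def Ball_def elts_iff by blast
  have "e = zero"
    by (rule ext) (use I(2) in \<open>auto simp: elts_def\<close>)
  moreover have "y = succ x" if "elts y = insert x (elts x)" for x y
    by (rule ext) (use that in \<open>auto simp: elts_def\<close>)
  ultimately have "zero \<epsilon> I \<and> (\<forall>k\<in>elts I. succ k \<epsilon> I)"
    using I by (metis elts_iff)
  then show ?thesis
    unfolding omega_def by (subst the_set_bounded_mem[where A = I]) (auto intro!: dfi simp del: elts_iff)
qed

lemma zero_omega [simp]: "zero \<epsilon> omega"
  unfolding omega_iff by auto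

lemma succ_omega [simp]: "n \<epsilon> omega \<Longrightarrow> succ n \<epsilon> omega"
  unfolding omega_iff by auto

text \<open>Separation collects the numbers satisfying \<open>P\<close> into an inductive set; hence
  the definability premise.\<close>

lemma omega_induct [consumes 1, case_names Def zero succ]:
  assumes "n \<epsilon> omega" "Def (\<lambda>e. P (e 0))" "P zero" "\<And>k. k \<epsilon> omega \<Longrightarrow> P k \<Longrightarrow> P (succ k)"
  shows "P n"
proof -
  have "zero \<epsilon> sep omega P" "\<forall>k\<in>elts (sep omega P). succ k \<epsilon> sep omega P"
    using assms(3,4) by (auto simp: sep_iff[OF assms(2)])
  then have "n \<epsilon> sep omega P"
    using assms(1) unfolding omega_iff by blast
  then show ?thesis
    by (simp add: sep_iff[OF assms(2)])
qed

lemma omega_cases: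
  assumes "n \<epsilon> omega"
  obtains "n = zero" | k where "k \<epsilon> omega" "n = succ k"
proof -
  have "n = zero \<or> (\<exists>k. k \<epsilon> omega \<and> n = succ k)"
    using assms by (rule omega_induct) (auto intro!: dfi)
  then show ?thesis using that by blast
qed

lemma omega_trans: "k \<epsilon> n \<Longrightarrow> n \<epsilon> omega \<Longrightarrow> k \<epsilon> omega"
proof -
  assume "n \<epsilon> omega" "k \<epsilon> n"
  have "\<forall>k. k \<epsilon> n \<longrightarrow> k \<epsilon> omega"
    using \<open>n \<epsilon> omega\<close> by (induct rule: omega_induct) (auto intro!: dfi)
  with \<open>k \<epsilon> n\<close> show ?thesis by blast
qed

lemma elts_omega_subset [simp]: "n \<epsilon> omega \<Longrightarrow> elts n \<subseteq> elts omega"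
  using omega_trans by auto

lemma less_trans:
  assumes "j \<epsilon> k" "k \<epsilon> n" "n \<epsilon> omega" shows "j \<epsilon> n"
proof -
  have "\<forall>k\<in>elts n. \<forall>j\<in>elts k. j \<epsilon> n"
    using \<open>n \<epsilon> omega\<close> by (rule omega_induct) (intro dfi, auto)
  with assms show ?thesis by auto
qed

lemma omega_less_induct [consumes 1, case_names Def less]:
  assumes "n \<epsilon> omega" "Def (\<lambda>e. P (e 0))"
    and "\<And>n. n \<epsilon> omega \<Longrightarrow> (\<And>k. k \<epsilon> n \<Longrightarrow> P k) \<Longrightarrow> P n"
  shows "P n"
proof -
  have "\<forall>k\<in>elts n. P k"
    using assms(1)
  proof (rule omega_induct)
    show "Def (\<lambda>e. \<forall>k\<in>elts (e 0). P k)"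
      by (intro dfi Def_subst1[OF assms(2)])
  qed (use assms(3) in auto)
  with assms show ?thesis by auto
qed

lemma omega_least:
  assumes "P n" "n \<epsilon> omega" "Def (\<lambda>e. P (e 0))"
  obtains m where "m \<epsilon> omega" "P m" "\<And>k. k \<epsilon> m \<Longrightarrow> \<not> P k"
proof -
  have "\<exists>m. m \<epsilon> omega \<and> P m \<and> (\<forall>k\<in>elts m. \<not> P k)"
  proof (rule ccontr)
    assume neg: "\<not> ?thesis"
    have "\<not> P n"
      using assms(2)
    proof (rule omega_less_induct)
      show "Def (\<lambda>e. \<not> P (e 0))" by (intro dfi assms)
    qed (use neg in auto)
    with assms(1) show False by simp
  qed
  then show ?thesis using that by auto
qed

lemma succ_less_succ: "k \<epsilon> n \<Longrightarrow> n \<epsilon> omega \<Longrightarrow> succ k \<epsilon> succ n"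
proof -
  assume "n \<epsilon> omega" "k \<epsilon> n"
  have "\<forall>k. k \<epsilon> n \<longrightarrow> succ k \<epsilon> succ n"
    using \<open>n \<epsilon> omega\<close> by (induct rule: omega_induct) (intro dfi, auto)
  with \<open>k \<epsilon> n\<close> show ?thesis by auto
qed

lemma zero_less_succ: "n \<epsilon> omega \<Longrightarrow> zero \<epsilon> succ n"
  by (induct rule: omega_induct) (intro dfi, auto)

lemma omega_linear:
  assumes "m \<epsilon> omega" "n \<epsilon> omega"
  shows "m \<epsilon> n \<or> m = n \<or> n \<epsilon> m"
proof -
  have "\<forall>n. n \<epsilon> omega \<longrightarrow> m \<epsilon> n \<or> m = n \<or> n \<epsilon> m"
    using assms(1)
  proof (induct rule: omega_induct)
    case Def show ?case by (intro dfi)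
  next
    case zero
    show ?case
      using zero_less_succ by (metis omega_cases)
  next
    case (succ k)
    have "succ k \<epsilon> n \<or> succ k = n \<or> n \<epsilon> succ k" if "n \<epsilon> omega" for n
      using succ succ_less_succ[of k n] that by auto
    then show ?case by auto
  qed
  with assms show ?thesis by auto
qed

lemma max_exists:
  assumes "m \<epsilon> omega" "n \<epsilon> omega"
  obtains k where "k \<epsilon> omega" "m \<epsilon> succ k" "n \<epsilon> succ k"
  using omega_linear[OF assms] assms that by (metis succ_iff)

lemma succ_inject [simp]: "succ m = succ n \<longleftrightarrow> m = n"
  by (metis mem_asym succ_iff)

lemma less_le_trans: "i \<epsilon> j \<Longrightarrow> j \<epsilon> succ k \<Longrightarrow> k \<epsilon> omega \<Longrightarrow> i \<epsilon> k"
  by (auto intro: less_trans)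

lemma elts_less_subset: "m \<epsilon> succ n \<Longrightarrow> n \<epsilon> omega \<Longrightarrow> elts m \<subseteq> elts n"
  by (auto intro: less_trans)

text \<open>Makes \<open>union\<close> a definable predecessor function, by which recursive
  definitions reach the previous index.\<close>

lemma union_succ: "k \<epsilon> omega \<Longrightarrow> union (succ k) = k"
  using less_trans[of _ _ k] by (intro ext) auto

subsection \<open>Course-of-values recursion\<close>

lemma causal_eq_unique:
  assumes h: "DefT (\<lambda>e. h (e 0) (e (Suc 0)))"
    and causal: "\<And>n x y. n \<epsilon> omega \<Longrightarrow> func x omega A \<Longrightarrow> func y omega A \<Longrightarrow>
      (\<And>k. k \<epsilon> n \<Longrightarrow> ap x k = ap y k) \<Longrightarrow> h n x = h n y"
    and x: "func x omega A" "\<And>k. k \<epsilon> n \<Longrightarrow> ap x k = h k x"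
    and y: "func y omega A" "\<And>k. k \<epsilon> n \<Longrightarrow> ap y k = h k y"
    and n: "n \<epsilon> omega" "k \<epsilon> n"
  shows "ap x k = ap y k"
proof -
  have "k \<epsilon> n \<longrightarrow> ap x k = ap y k"
    using omega_trans[OF n(2,1)]
  proof (rule omega_less_induct)
    show "Def (\<lambda>e. e 0 \<epsilon> n \<longrightarrow> ap x (e 0) = ap y (e 0))" by (intro dfi)
  next
    fix k assume "k \<epsilon> omega" "\<And>j. j \<epsilon> k \<Longrightarrow> j \<epsilon> n \<longrightarrow> ap x j = ap y j"
    then show "k \<epsilon> n \<longrightarrow> ap x k = ap y k"
      using causal[of k x y] x y n less_trans[OF _ _ n(1)] by simp
  qed
  with n show ?thesis by blast
qed

text \<open>Approximations that are correct below n exist by induction on n: overwriting entry n by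
  \<open>h n x\<close> changes nothing that \<open>h\<close> reads there. They agree where they are
  correct, so their diagonal is the fixed point. Total sequences spare a theory of finite ones;
  \<open>d\<close> fills the entries that are not yet determined.\<close>

theorem causal_fixpoint:
  assumes h: "DefT (\<lambda>e. h (e 0) (e (Suc 0)))"
    and closed: "\<And>n x. n \<epsilon> omega \<Longrightarrow> func x omega A \<Longrightarrow> h n x \<epsilon> A"
    and causal: "\<And>n x y. n \<epsilon> omega \<Longrightarrow> func x omega A \<Longrightarrow> func y omega A \<Longrightarrow>
      (\<And>k. k \<epsilon> n \<Longrightarrow> ap x k = ap y k) \<Longrightarrow> h n x = h n y"
    and "d \<epsilon> A"
  obtains x where "func x omega A" "\<And>n. n \<epsilon> omega \<Longrightarrow> ap x n = h n x"
proof -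
  note [dfi] = DefT_subst2[where F = h, OF h]
  define good where "good n x \<longleftrightarrow> func x omega A \<and> (\<forall>k\<in>elts n. ap x k = h k x)" for n x
  have [dfi]: "Def (\<lambda>e. good (s e) (t e))" if "DefT s" "DefT t" for s t
    by (rule Def_subst2[where P = good, OF _ that]) (unfold good_def, intro dfi)
  have good_ex: "\<exists>x. good n x" if "n \<epsilon> omega" for n
    using that
  proof (induct rule: omega_induct)
    case Def show ?case by (intro dfi)
  next
    case zero
    have "func (lam omega (\<lambda>_. d)) omega A"
      by (rule func_lam) (use \<open>d \<epsilon> A\<close> in \<open>auto intro: dfi\<close>)
    then show ?case unfolding good_def by auto
  next
    case (succ n)
    then obtain x where x: "func x omega A" "\<And>k. k \<epsilon> n \<Longrightarrow> ap x k = h k x"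
      unfolding good_def by auto
    define x' where "x' = lam omega (\<lambda>k. if k = n then h n x else ap x k)"
    have D: "DefT (\<lambda>e. if e 0 = n then h n x else ap x (e 0))"
      by (intro dfi)
    have x': "func x' omega A"
      unfolding x'_def by (rule func_lam[OF D]) (use x closed succ in auto)
    have ap: "ap x' k = (if k = n then h n x else ap x k)" if "k \<epsilon> omega" for k
      unfolding x'_def by (rule ap_lam[OF D that])
    have "ap x' k = h k x'" if "k \<epsilon> succ n" for k
    proof -
      have k: "k \<epsilon> omega" using that succ omega_trans[of k "succ n"] by simp
      have "ap x' k = h k x"
        using ap[OF k] that x(2) by auto
      moreover have "ap x j = ap x' j" if "j \<epsilon> k" for j
      proof -
        have "j \<epsilon> n"
          using less_le_trans[OF \<open>j \<epsilon> k\<close> \<open>k \<epsilon> succ n\<close>] succ by blast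
        then show ?thesis
          using ap[OF omega_trans[OF _ \<open>n \<epsilon> omega\<close>]] by auto
      qed
      ultimately show ?thesis
        using causal[OF k x(1) x'] by simp
    qed
    with x' show ?case unfolding good_def by auto
  qed
  have agree: "ap x k = ap y k" if "good (succ k) x" "good (succ k) y" "k \<epsilon> omega" for x y k
    by (rule causal_eq_unique[where n = "succ k" and h = h, OF h causal])
       (use that in \<open>auto simp: good_def\<close>)
  \<comment> \<open>All approximations correct up to and including k share their value at k, so the
    value is determined without choosing one of them.\<close>
  define X where "X = lam omega (\<lambda>k. the1 (\<lambda>v. \<exists>x. good (succ k) x \<and> v = ap x k))"
  have D: "DefT (\<lambda>e. the1 (\<lambda>v. \<exists>x. good (succ (e 0)) x \<and> v = ap x (e 0)))"
    by (intro dfi)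
  have X: "ap X k = ap x k" if "k \<epsilon> omega" "good (succ k) x" for k x
    unfolding X_def ap_lam[OF D that(1)]
    by (rule the1_eqI) (use that in blast, use that agree in metis)
  have X': "func X omega A"
    unfolding func_iff
  proof (intro conjI ballI)
    show "fun_on X omega" unfolding X_def by (rule fun_on_lam[OF D])
  next
    fix k assume "k \<in> elts omega"
    then have k: "k \<epsilon> omega" by simp
    then obtain x where x: "good (succ k) x"
      using good_ex[of "succ k"] by auto
    then have "func x omega A" by (simp add: good_def)
    with k show "ap X k \<epsilon> A"
      unfolding X[OF k x] by simp
  qed
  moreover have "ap X n = h n X" if n: "n \<epsilon> omega" for n
  proof -
    obtain x where x: "good (succ n) x"
      using good_ex[of "succ n"] n by auto
    have "ap x k = ap X k" if "k \<epsilon> n" for k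
    proof -
      have "good (succ k) x"
        using x that n less_trans[of _ k n] unfolding good_def by auto
      then show ?thesis
        using X omega_trans[OF that n] by simp
    qed
    then have "h n x = h n X"
      using causal[OF n _ X'] x unfolding good_def by simp
    then show ?thesis
      using X[OF n x] x unfolding good_def by simp
  qed
  ultimately show ?thesis using that by blast
qed

text \<open>Characteristic functions with values 0 and 1 reduce this to
  \<open>causal_fixpoint\<close>.\<close>

theorem causal_subset:
  assumes P: "Def (\<lambda>e. P (e 0) (e (Suc 0)))"
    and causal: "\<And>n X Y. n \<epsilon> omega \<Longrightarrow> elts X \<subseteq> elts omega \<Longrightarrow> elts Y \<subseteq> elts omega \<Longrightarrow>
      (\<And>k. k \<epsilon> n \<Longrightarrow> k \<epsilon> X \<longleftrightarrow> k \<epsilon> Y) \<Longrightarrow> P n X \<longleftrightarrow> P n Y"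
  obtains X where "elts X \<subseteq> elts omega" "\<And>n. n \<epsilon> omega \<Longrightarrow> n \<epsilon> X \<longleftrightarrow> P n X"
proof -
  note [dfi] = Def_subst2[where P = P, OF P]
  define supp where "supp x = sep omega (\<lambda>k. ap x k = succ zero)" for x
  have supp [simp]: "k \<epsilon> supp x \<longleftrightarrow> k \<epsilon> omega \<and> ap x k = succ zero" for k x
    unfolding supp_def by (subst sep_iff) (intro dfi, simp)
  have [dfi]: "DefT (\<lambda>e. supp (t e))" if "DefT t" for t
    by (rule DefT_subst1[where F = supp, OF _ that]) (unfold supp_def, intro dfi)
  have D: "DefT (\<lambda>e. if P (e 0) (supp (e (Suc 0))) then succ zero else zero)"
    by (intro dfi)
  obtain x where x: "func x omega (upair zero (succ zero))"
    "\<And>n. n \<epsilon> omega \<Longrightarrow> ap x n = (if P n (supp x) then succ zero else zero)"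
  proof (rule causal_fixpoint[OF D, where A = "upair zero (succ zero)"])
    fix n x y assume n: "n \<epsilon> omega" and "\<And>k. k \<epsilon> n \<Longrightarrow> ap x k = ap y k"
    then have "P n (supp x) \<longleftrightarrow> P n (supp y)"
      by (intro causal) auto
    then show "(if P n (supp x) then succ zero else zero) = (if P n (supp y) then succ zero else zero)"
      by simp
  qed auto
  then show ?thesis
    by (intro that[of "supp x"]) auto
qed

theorem omega_recursion:
  assumes g: "DefT (\<lambda>e. g (e 0) (e (Suc 0)))"
    and closed: "\<And>n v. n \<epsilon> omega \<Longrightarrow> v \<epsilon> A \<Longrightarrow> g n v \<epsilon> A" and "a \<epsilon> A"
  obtains x where "func x omega A" "ap x zero = a" "\<And>n. n \<epsilon> omega \<Longrightarrow> ap x (succ n) = g n (ap x n)"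
proof -
  note [dfi] = DefT_subst2[where F = g, OF g]
  define h where "h n x = (if n = zero then a else g (union n) (ap x (union n)))" for n x
  have h: "DefT (\<lambda>e. h (e 0) (e (Suc 0)))"
    unfolding h_def by (intro dfi)
  obtain x where x: "func x omega A" "\<And>n. n \<epsilon> omega \<Longrightarrow> ap x n = h n x"
  proof (rule causal_fixpoint[OF h, where A = A])
    show "h n x \<epsilon> A" if "n \<epsilon> omega" "func x omega A" for n x
      using that(1) by (rule omega_cases) (use that closed \<open>a \<epsilon> A\<close> in \<open>auto simp: h_def union_succ\<close>)
    show "h n x = h n y" if "n \<epsilon> omega" "\<And>k. k \<epsilon> n \<Longrightarrow> ap x k = ap y k" for n x y
      using that(1) by (rule omega_cases) (use that(2) in \<open>auto simp: h_def union_succ\<close>)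
  qed (use \<open>a \<epsilon> A\<close> in auto)
  show ?thesis
    by (rule that[OF x(1)]) (use x(2) in \<open>auto simp: h_def union_succ\<close>)
qed

subsection \<open>Even and odd numbers\<close>

text \<open>Doubling as an element of the structure. The \<open>SOME\<close> is harmless: it fixes
  one element, which then occurs in formulas as a parameter.\<close>

definition dbl :: 'v
  where "dbl = (SOME x. func x omega omega \<and> ap x zero = zero \<and>
    (\<forall>n. n \<epsilon> omega \<longrightarrow> ap x (succ n) = succ (succ (ap x n))))"

lemma dbl: "func dbl omega omega \<and> ap dbl zero = zero \<and>
    (\<forall>n. n \<epsilon> omega \<longrightarrow> ap dbl (succ n) = succ (succ (ap dbl n)))"
proof -
  have "DefT (\<lambda>e. succ (succ (e (Suc 0))))" by (intro dfi)
  then obtain x where "func x omega omega" "ap x zero = zero"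
    "\<And>n. n \<epsilon> omega \<Longrightarrow> ap x (succ n) = succ (succ (ap x n))"
    by (rule omega_recursion[where A = omega]) auto
  then show ?thesis
    unfolding dbl_def by (intro someI_ex[where P = "\<lambda>x. func x omega omega \<and> _ x"]) blast
qed

lemma dbl_omega [simp]: "n \<epsilon> omega \<Longrightarrow> ap dbl n \<epsilon> omega"
  and dbl_zero [simp]: "ap dbl zero = zero"
  and dbl_succ [simp]: "n \<epsilon> omega \<Longrightarrow> ap dbl (succ n) = succ (succ (ap dbl n))"
  using dbl by auto

lemma parity_cases:
  assumes "n \<epsilon> omega"
  obtains k where "k \<epsilon> omega" "n = ap dbl k" | k where "k \<epsilon> omega" "n = succ (ap dbl k)"
proof -
  have "\<exists>k. k \<epsilon> omega \<and> (n = ap dbl k \<or> n = succ (ap dbl k))"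
    using assms
  proof (induct rule: omega_induct)
    case Def show ?case by (intro dfi)
  next
    case zero show ?case by (rule exI[of _ zero]) simp
  next
    case (succ n)
    then show ?case by (metis dbl_succ succ_omega)
  qed
  then show ?thesis using that by blast
qed

lemma dbl_neq_succ_dbl:
  assumes "m \<epsilon> omega" "n \<epsilon> omega" shows "ap dbl m \<noteq> succ (ap dbl n)"
proof -
  have "\<forall>n\<in>elts omega. ap dbl m \<noteq> succ (ap dbl n)"
    using assms(1)
  proof (induct rule: omega_induct)
    case Def show ?case by (intro dfi)
  next
    case (succ m)
    have "ap dbl (succ m) \<noteq> succ (ap dbl n)" if "n \<epsilon> omega" for n
      using that by (rule omega_cases) (use succ in auto)
    then show ?case by simp
  qed simp
  with assms show ?thesis by simp
qed

lemma dbl_less: "m \<epsilon> n \<Longrightarrow> n \<epsilon> omega \<Longrightarrow> succ (ap dbl m) \<epsilon> ap dbl n"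
proof -
  assume "n \<epsilon> omega" "m \<epsilon> n"
  have "\<forall>m\<in>elts n. succ (ap dbl m) \<epsilon> ap dbl n"
    using \<open>n \<epsilon> omega\<close>
    by (induct rule: omega_induct) (intro dfi, auto)
  with \<open>m \<epsilon> n\<close> show ?thesis by simp
qed

lemma dbl_inject: "m \<epsilon> omega \<Longrightarrow> n \<epsilon> omega \<Longrightarrow> ap dbl m = ap dbl n \<Longrightarrow> m = n"
  using omega_linear[of m n] dbl_less[of m n] dbl_less[of n m] by (metis not_mem_self succ_iff mem_asym)

lemma even_num_dbl: "n \<epsilon> omega \<Longrightarrow> even_num (ap dbl n)"
proof -
  assume n: "n \<epsilon> omega"
  have "\<forall>I. zero \<epsilon> I \<and> (\<forall>k\<in>elts I. succ (succ k) \<epsilon> I) \<longrightarrow> ap dbl n \<epsilon> I"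
    using n by (induct rule: omega_induct) (intro dfi, auto)
  with n show ?thesis unfolding even_num_def by simp
qed

text \<open>The doubles form a set that contains 0 and is closed under adding 2, so everything even
  in the sense of \<open>even_num\<close> is a double.\<close>

lemma odd_num_dbl: "n \<epsilon> omega \<Longrightarrow> odd_num (succ (ap dbl n))"
proof -
  assume n: "n \<epsilon> omega"
  define E where "E = sep omega (\<lambda>m. \<exists>k\<in>elts omega. m = ap dbl k)"
  have E: "m \<epsilon> E \<longleftrightarrow> m \<epsilon> omega \<and> (\<exists>k. k \<epsilon> omega \<and> m = ap dbl k)" for m
    unfolding E_def by (subst sep_iff) (intro dfi, simp)
  have "zero \<epsilon> E"
    unfolding E by (auto intro!: exI[of _ zero])
  moreover have "succ (succ m) \<epsilon> E" if "m \<epsilon> E" for m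
  proof -
    obtain k where "k \<epsilon> omega" "m = ap dbl k"
      using \<open>m \<epsilon> E\<close> unfolding E by blast
    then show ?thesis
      unfolding E by (auto intro!: exI[of _ "succ k"])
  qed
  moreover have "\<not> succ (ap dbl n) \<epsilon> E"
    unfolding E using dbl_neq_succ_dbl n by metis
  ultimately show ?thesis
    using n unfolding odd_num_def even_num_def by auto
qed

lemma Def_even_num [dfi]: "DefT t \<Longrightarrow> Def (\<lambda>e. even_num (t e))"
  by (rule Def_subst1[where P = even_num]) (unfold even_num_def, intro dfi)

lemma Def_odd_num [dfi]: "DefT t \<Longrightarrow> Def (\<lambda>e. odd_num (t e))"
  unfolding odd_num_def by (intro dfi)

text \<open>Rounds down, so that positions 2i and 2i + 1 both yield the number i of their
  round.\<close>

definition half :: "'v \<Rightarrow> 'v"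
  where "half n = the1 (\<lambda>k. k \<epsilon> omega \<and> (n = ap dbl k \<or> n = succ (ap dbl k)))"

lemma half_dbl [simp]: "k \<epsilon> omega \<Longrightarrow> half (ap dbl k) = k"
  unfolding half_def using dbl_inject dbl_neq_succ_dbl by (intro the1_eqI) auto

lemma half_succ_dbl [simp]: "k \<epsilon> omega \<Longrightarrow> half (succ (ap dbl k)) = k"
  unfolding half_def using dbl_inject dbl_neq_succ_dbl by (intro the1_eqI) (auto, metis)

lemma DefT_half [dfi]: "DefT t \<Longrightarrow> DefT (\<lambda>e. half (t e))"
  by (rule DefT_subst1[where F = half]) (unfold half_def, intro dfi)

lemma half_omega [simp]: "n \<epsilon> omega \<Longrightarrow> half n \<epsilon> omega"
  by (erule parity_cases) simp_all

definition evens :: "'v \<Rightarrow> 'v"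
  where "evens z = lam omega (\<lambda>i. ap z (ap dbl i))"

definition odds :: "'v \<Rightarrow> 'v"
  where "odds z = lam omega (\<lambda>i. ap z (succ (ap dbl i)))"

lemma DefT_evens [dfi]: "DefT t \<Longrightarrow> DefT (\<lambda>e. evens (t e))"
  by (rule DefT_subst1[where F = evens]) (unfold evens_def, intro dfi)

lemma DefT_odds [dfi]: "DefT t \<Longrightarrow> DefT (\<lambda>e. odds (t e))"
  by (rule DefT_subst1[where F = odds]) (unfold odds_def, intro dfi)

lemma fun_on_evens: "fun_on (evens z) omega"
  unfolding evens_def by (rule fun_on_lam) (intro dfi)

lemma fun_on_odds: "fun_on (odds z) omega"
  unfolding odds_def by (rule fun_on_lam) (intro dfi)

lemma ap_evens: "i \<epsilon> omega \<Longrightarrow> ap (evens z) i = ap z (ap dbl i)"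
  unfolding evens_def by (rule ap_lam) (intro dfi)

lemma ap_odds: "i \<epsilon> omega \<Longrightarrow> ap (odds z) i = ap z (succ (ap dbl i))"
  unfolding odds_def by (rule ap_lam) (intro dfi)

subsection \<open>Strategies as causal operators\<close>

lemma func_subset: "func f A B \<Longrightarrow> elts f \<subseteq> elts (prod_set A B)"
  using funset_iff[of f A B] unfolding funset_def by (subst (asm) sep_iff) (auto intro!: dfi simp del: prod_set_iff)

text \<open>Finite sequences of numbers are subsets of a fixed product, so the positions form a set
  and \<open>the_set\<close> has its intended meaning.\<close>

lemma nat_strategy_dom:
  assumes "Def (\<lambda>e. T (e 0))"
  shows "p \<epsilon> the_set (\<lambda>p. \<exists>n\<in>elts omega. T n \<and> func p n omega) \<longleftrightarrow>
    (\<exists>n\<in>elts omega. T n \<and> func p n omega)"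
proof (rule the_set_bounded_mem)
  show "w \<epsilon> pow (prod_set omega omega)" if "\<exists>n\<in>elts omega. T n \<and> func w n omega" for w
    using that func_subset[of w _ omega] by (fastforce simp: subset_iff dest: omega_trans)
  show "Def (\<lambda>e. \<exists>n\<in>elts omega. T n \<and> func (e 0) n omega)"
    by (intro dfi Def_subst1[OF assms])
qed

text \<open>The list \<open>y\<close> contains only the opponent's moves, counted by rounds; hence
  the index \<open>half n\<close>.\<close>

definition play_move :: "('v \<Rightarrow> bool) \<Rightarrow> 'v \<Rightarrow> 'v \<Rightarrow> 'v \<Rightarrow> 'v \<Rightarrow> 'v"
  where "play_move T s y n z = (if T n then ap s (restr z n) else ap y (half n))"

definition nat_play :: "('v \<Rightarrow> bool) \<Rightarrow> 'v \<Rightarrow> 'v \<Rightarrow> 'v"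
  where "nat_play T s y =
    the1 (\<lambda>z. func z omega omega \<and> (\<forall>n\<in>elts omega. ap z n = play_move T s y n z))"

lemma DefT_nat_play:
  assumes "Def (\<lambda>e. T (e 0))" "DefT t"
  shows "DefT (\<lambda>e. nat_play T s (t e))"
proof (rule DefT_subst1[where F = "nat_play T s", OF _ assms(2)])
  note [dfi] = Def_subst1[where P = T, OF assms(1)]
  show "DefT (\<lambda>e. nat_play T s (e 0))"
    unfolding nat_play_def play_move_def by (intro dfi)
qed

lemma restr_cong:
  assumes "fun_on x omega" "fun_on y omega" "n \<epsilon> omega" "\<And>k. k \<epsilon> n \<Longrightarrow> ap x k = ap y k"
  shows "restr x n = restr y n"
proof (rule fun_on_ext[where A = n])
  note xy = assms(1,2)
  have n: "elts n \<subseteq> elts omega"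
    using assms(3) by simp
  show "fun_on (restr x n) n" "fun_on (restr y n) n"
    using fun_on_restr xy n by blast+
  show "ap (restr x n) k = ap (restr y n) k" if "k \<epsilon> n" for k
    using ap_restr[OF _ n that] xy assms(4)[OF that] by simp
qed

lemma nat_play:
  assumes T: "Def (\<lambda>e. T (e 0))" and s: "nat_strategy T s" and y: "func y omega omega"
  shows "func (nat_play T s y) omega omega \<and> 
    (\<forall>n\<in>elts omega. ap (nat_play T s y) n = play_move T s y n (nat_play T s y))"
proof -
  note [dfi] = Def_subst1[where P = T, OF T]
  have D: "DefT (\<lambda>e. play_move T s y (e 0) (e (Suc 0)))"
    unfolding play_move_def by (intro dfi)
  have closed: "play_move T s y n z \<epsilon> omega" if "n \<epsilon> omega" "func z omega omega" for n z
  proof (cases "T n")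
    case True
    have "restr z n \<epsilon> the_set (\<lambda>p. \<exists>n\<in>elts omega. T n \<and> func p n omega)"
      unfolding nat_strategy_dom[OF T] using func_restr that True by auto
    with s True show ?thesis
      unfolding nat_strategy_def play_move_def by simp
  next
    case False
    with y that show ?thesis by (simp add: play_move_def)
  qed
  have causal: "play_move T s y n x = play_move T s y n x'"
    if "n \<epsilon> omega" "func x omega omega" "func x' omega omega" "\<And>k. k \<epsilon> n \<Longrightarrow> ap x k = ap x' k" for n x x'
    unfolding play_move_def using restr_cong[OF func_fun_on[OF that(2)] func_fun_on[OF that(3)] that(1,4)] by simp
  obtain z where z: "func z omega omega" "\<And>n. n \<epsilon> omega \<Longrightarrow> ap z n = play_move T s y n z"
    by (rule causal_fixpoint[OF D closed causal zero_omega], assumption+, rule that, assumption, simp)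
  have unique: "z' = z" if z': "func z' omega omega" "\<And>n. n \<epsilon> omega \<Longrightarrow> ap z' n = play_move T s y n z'" for z'
  proof (rule fun_on_ext[of _ omega])
    fix k assume k: "k \<epsilon> omega"
    show "ap z' k = ap z k"
      by (rule causal_eq_unique[OF D causal, where n = "succ k"])
         (use z z' k omega_trans[of _ k] in auto)
  qed (use z z' in auto)
  have "\<exists>!z. func z omega omega \<and> (\<forall>n\<in>elts omega. ap z n = play_move T s y n z)"
  proof (rule ex1I[of _ z])
    show "func z omega omega \<and> (\<forall>n\<in>elts omega. ap z n = play_move T s y n z)"
      using z by simp
  qed (rule unique, simp_all)
  then show ?thesis
    unfolding nat_play_def by (rule the1I)
qed

lemma nat_play_consistent:
  assumes "Def (\<lambda>e. T (e 0))" "nat_strategy T s" "func y omega omega"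
  shows "nat_consistent T s (nat_play T s y)"
  unfolding nat_consistent_def
proof (intro ballI impI)
  fix n assume "n \<in> elts omega" and n: "T n"
  then have n': "n \<epsilon> omega" by simp
  have "restr (nat_play T s y) n \<epsilon> the_set (\<lambda>p. \<exists>n\<in>elts omega. T n \<and> func p n omega)"
    unfolding nat_strategy_dom[OF assms(1)] using func_restr nat_play[OF assms] n n' by auto
  then have "app s (restr (nat_play T s y) n) = ap s (restr (nat_play T s y) n)"
    using assms(2) func_app unfolding nat_strategy_def by blast
  then show "app (nat_play T s y) n = app s (restr (nat_play T s y) n)"
    using nat_play[OF assms] n n' func_app[of "nat_play T s y" omega omega n] by (simp add: play_move_def)
qed

lemma nat_play_cong:
  assumes T: "Def (\<lambda>e. T (e 0))" and s: "nat_strategy T s"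
    and y: "func y omega omega" "func y' omega omega"
    and eq: "\<And>k. k \<epsilon> n \<Longrightarrow> \<not> T k \<Longrightarrow> ap y (half k) = ap y' (half k)" and n: "n \<epsilon> omega"
    and k: "k \<epsilon> n"
  shows "ap (nat_play T s y) k = ap (nat_play T s y') k"
proof -
  note [dfi] = DefT_nat_play[OF T]
  have "k \<epsilon> n \<longrightarrow> ap (nat_play T s y) k = ap (nat_play T s y') k"
    using omega_trans[OF k n]
  proof (induct rule: omega_less_induct)
    case Def show ?case by (intro dfi)
  next
    case (less k)
    show ?case
    proof
      assume k: "k \<epsilon> n"
      have "restr (nat_play T s y) k = restr (nat_play T s y') k"
        using less k less_trans[OF _ k n] nat_play[OF T s y(1)] nat_play[OF T s y(2)]
        by (intro restr_cong func_fun_on[of _ omega omega]) auto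
      then have "play_move T s y k (nat_play T s y) = play_move T s y' k (nat_play T s y')"
        unfolding play_move_def using eq[OF k] by simp
      then show "ap (nat_play T s y) k = ap (nat_play T s y') k"
        using nat_play[OF T s] y less(1) by simp
    qed
  qed
  with k show ?thesis by blast
qed

text \<open>A strategy becomes the map from the opponent's moves to the own moves of the resulting
  run, and the order of play becomes causality: move i of the first player depends on answers below
  i, move i of the second player on moves up to and including i. Splitting a run into its even and
  odd entries turns \<open>W\<close> into a payoff set.\<close>

theorem AD_causal:
  assumes AD: AD and W: "Def (\<lambda>e. W (e 0) (e (Suc 0)))"
  obtains
    (first) F where "DefT (\<lambda>e. F (e 0))" "\<And>y. func y omega omega \<Longrightarrow> func (F y) omega omega"
      "\<And>y y' i. func y omega omega \<Longrightarrow> func y' omega omega \<Longrightarrow> i \<epsilon> omega \<Longrightarrow>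
        (\<And>j. j \<epsilon> i \<Longrightarrow> ap y j = ap y' j) \<Longrightarrow> ap (F y) i = ap (F y') i"
      "\<And>y. func y omega omega \<Longrightarrow> W (F y) y"
  | (second) G where "DefT (\<lambda>e. G (e 0))" "\<And>x. func x omega omega \<Longrightarrow> func (G x) omega omega"
      "\<And>x x' i. func x omega omega \<Longrightarrow> func x' omega omega \<Longrightarrow> i \<epsilon> omega \<Longrightarrow>
        (\<And>j. j \<epsilon> succ i \<Longrightarrow> ap x j = ap x' j) \<Longrightarrow> ap (G x) i = ap (G x') i"
      "\<And>x. func x omega omega \<Longrightarrow> \<not> W x (G x)"
proof -
  note [dfi] = Def_subst2[where P = W, OF W]
  define X where "X = sep (funset omega omega) (\<lambda>z. W (evens z) (odds z))"
  have X: "z \<epsilon> X \<longleftrightarrow> func z omega omega \<and> W (evens z) (odds z)" for z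
    unfolding X_def by (subst sep_iff) (intro dfi, simp)
  have E: "Def (\<lambda>e. even_num (e 0))" and O: "Def (\<lambda>e. odd_num (e 0))"
    by (intro dfi)+
  consider s where "nat_strategy even_num s"
      "\<And>z. func z omega omega \<Longrightarrow> nat_consistent even_num s z \<Longrightarrow> z \<epsilon> X"
    | s where "nat_strategy odd_num s"
      "\<And>z. func z omega omega \<Longrightarrow> nat_consistent odd_num s z \<Longrightarrow> \<not> z \<epsilon> X"
    using AD[unfolded AD_def, rule_format, of X] X by auto
  then show ?thesis
  proof cases
    case (1 s)
    define F where "F y = evens (nat_play even_num s y)" for y
    note play = nat_play[OF E 1(1)]
    show ?thesis
    proof (rule first)
      show "DefT (\<lambda>e. F (e 0))"
        unfolding F_def by (intro dfi DefT_nat_play[OF E])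
    next
      fix y assume y: "func y omega omega"
      show "func (F y) omega omega"
        unfolding F_def func_iff using func_ap[OF conjunct1[OF play[OF y]]] fun_on_evens by (auto simp: ap_evens)
      have "odds (nat_play even_num s y) = y"
        by (rule fun_on_ext[of _ omega])
           (use y play[OF y] odd_num_dbl in \<open>auto simp: fun_on_odds ap_odds play_move_def odd_num_def\<close>)
      then show "W (F y) y"
        using 1(2)[OF _ nat_play_consistent[OF E 1(1) y]] play[OF y] by (simp add: X F_def)
    next
      fix y y' i
      assume y: "func y omega omega" "func y' omega omega" "i \<epsilon> omega" "\<And>j. j \<epsilon> i \<Longrightarrow> ap y j = ap y' j"
      \<comment> \<open>An odd k up to 2i is 2j + 1 with j < i.\<close>
      have eq: "ap y (half k) = ap y' (half k)" if k: "k \<epsilon> succ (ap dbl i)" "\<not> even_num k" for k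
      proof -
        have "k \<epsilon> omega" using k y omega_trans[of k "succ (ap dbl i)"] by simp
        then obtain j where j: "j \<epsilon> omega" "k = succ (ap dbl j)"
          using even_num_dbl k by (auto elim: parity_cases)
        have "j \<epsilon> i"
        proof (rule ccontr)
          assume "\<not> j \<epsilon> i"
          then have "j = i \<or> i \<epsilon> j"
            using omega_linear j y by blast
          then show False
            using k j dbl_less[of i j] y less_trans[of "succ (ap dbl j)" "ap dbl i" ] mem_asym 
            by (metis dbl_omega not_mem_self succ_iff less_trans)
        qed
        with y(4) j show ?thesis by simp
      qed
      have "ap (nat_play even_num s y) (ap dbl i) = ap (nat_play even_num s y') (ap dbl i)"
        by (rule nat_play_cong[where n = "succ (ap dbl i)", OF E 1(1) y(1,2)], rule eq) (use y in simp_all)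
      then show "ap (F y) i = ap (F y') i"
        using y unfolding F_def by (simp add: ap_evens)
    qed
  next
    case (2 s)
    define G where "G x = odds (nat_play odd_num s x)" for x
    note play = nat_play[OF O 2(1)]
    show ?thesis
    proof (rule second)
      show "DefT (\<lambda>e. G (e 0))"
        unfolding G_def by (intro dfi DefT_nat_play[OF O])
    next
      fix x assume x: "func x omega omega"
      show "func (G x) omega omega"
        unfolding G_def func_iff using func_ap[OF conjunct1[OF play[OF x]]] fun_on_odds by (auto simp: ap_odds)
      have "evens (nat_play odd_num s x) = x"
        by (rule fun_on_ext[of _ omega])
           (use x play[OF x] even_num_dbl in \<open>auto simp: fun_on_evens ap_evens play_move_def odd_num_def\<close>)
      then show "\<not> W x (G x)"
        using 2(2)[OF _ nat_play_consistent[OF O 2(1) x]] play[OF x] by (simp add: X G_def)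
    next
      fix x x' i
      assume x: "func x omega omega" "func x' omega omega" "i \<epsilon> omega" "\<And>j. j \<epsilon> succ i \<Longrightarrow> ap x j = ap x' j"
      \<comment> \<open>An even k up to 2i + 1 is 2j with j at most i; this is where
        \<open>succ i\<close> in the causality of \<open>G\<close> comes from.\<close>
      have eq: "ap x (half k) = ap x' (half k)" if k: "k \<epsilon> succ (succ (ap dbl i))" "\<not> odd_num k" for k
      proof -
        have "k \<epsilon> omega" using k x omega_trans[of k "succ (succ (ap dbl i))"] by simp
        then obtain j where j: "j \<epsilon> omega" "k = ap dbl j"
          using odd_num_dbl k by (auto elim: parity_cases)
        have "j \<epsilon> succ i"
        proof (rule ccontr)
          assume "\<not> j \<epsilon> succ i"
          then have "i \<epsilon> j"
            using omega_linear j x by auto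
          then show False
            using k j dbl_less[of i j] x mem_asym by (metis not_mem_self succ_iff)
        qed
        with x(4) j show ?thesis by simp
      qed
      have "ap (nat_play odd_num s x) (succ (ap dbl i)) = ap (nat_play odd_num s x') (succ (ap dbl i))"
        by (rule nat_play_cong[where n = "succ (succ (ap dbl i))", OF O 2(1) x(1,2)], rule eq) (use x in simp_all)
      then show "ap (G x) i = ap (G x') i"
        using x unfolding G_def by (simp add: ap_odds)
    qed
  qed
qed

end

subsection \<open>Ordered field arithmetic\<close>

locale zf_reals = reals_in_universe mem R addR multR ltR + zf_universe mem
  for mem :: "'v \<Rightarrow> 'v \<Rightarrow> bool"  (infix "\<epsilon>" 50) and R addR multR ltR :: 'v +
  assumes real_field: real_field
begin

definition pl :: "'v \<Rightarrow> 'v \<Rightarrow> 'v"  (infixl "\<boxplus>" 65)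
  where "x \<boxplus> y = ap addR (opair x y)"

lemma DefT_pl [dfi]: "DefT s \<Longrightarrow> DefT t \<Longrightarrow> DefT (\<lambda>e. s e \<boxplus> t e)"
  unfolding pl_def by (intro dfi)

lemma Def_less_R [dfi]: "DefT s \<Longrightarrow> DefT t \<Longrightarrow> Def (\<lambda>e. s e \<prec> t e)"
  unfolding less_R_def by (intro dfi)

lemma Def_le_R [dfi]: "DefT s \<Longrightarrow> DefT t \<Longrightarrow> Def (\<lambda>e. s e \<preceq> t e)"
  unfolding le_R_def by (intro dfi)

lemma field_axioms: field_axioms and order_axioms: order_axioms and completeness: completeness
  using real_field unfolding real_field_def by auto

lemma plus_R_assoc: "x \<epsilon> R \<Longrightarrow> y \<epsilon> R \<Longrightarrow> z \<epsilon> R \<Longrightarrow> (x \<oplus> y) \<oplus> z = x \<oplus> (y \<oplus> z)"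
  and plus_R_commute: "x \<epsilon> R \<Longrightarrow> y \<epsilon> R \<Longrightarrow> x \<oplus> y = y \<oplus> x"
  and times_R_commute: "x \<epsilon> R \<Longrightarrow> y \<epsilon> R \<Longrightarrow> x \<otimes> y = y \<otimes> x"
  and distrib_R: "x \<epsilon> R \<Longrightarrow> y \<epsilon> R \<Longrightarrow> z \<epsilon> R \<Longrightarrow> x \<otimes> (y \<oplus> z) = (x \<otimes> y) \<oplus> (x \<otimes> z)"
  and zero_R [simp]: "zero_R \<epsilon> R" and one_R: "one_R \<epsilon> R" and zero_neq_one_R: "zero_R \<noteq> one_R"
  and plus_zero_R: "x \<epsilon> R \<Longrightarrow> x \<oplus> zero_R = x"
  and times_one_R: "x \<epsilon> R \<Longrightarrow> x \<otimes> one_R = x"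
  and minus_R_exists: "x \<epsilon> R \<Longrightarrow> \<exists>y. y \<epsilon> R \<and> x \<oplus> y = zero_R"
  and inverse_R_exists: "x \<epsilon> R \<Longrightarrow> x \<noteq> zero_R \<Longrightarrow> \<exists>y. y \<epsilon> R \<and> x \<otimes> y = one_R"
  and addR: "func addR (prod_set R R) R" and multR: "func multR (prod_set R R) R"
  using field_axioms unfolding field_axioms_def by simp_all

lemma less_R_subset: "elts ltR \<subseteq> elts (prod_set R R)"
  and less_R_irrefl': "x \<epsilon> R \<Longrightarrow> \<not> x \<prec> x"
  and less_R_trans': "x \<epsilon> R \<Longrightarrow> y \<epsilon> R \<Longrightarrow> z \<epsilon> R \<Longrightarrow> x \<prec> y \<Longrightarrow> y \<prec> z \<Longrightarrow> x \<prec> z"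
  and less_R_linear: "x \<epsilon> R \<Longrightarrow> y \<epsilon> R \<Longrightarrow> x \<prec> y \<or> x = y \<or> y \<prec> x"
  and plus_R_strict_mono: "x \<epsilon> R \<Longrightarrow> y \<epsilon> R \<Longrightarrow> z \<epsilon> R \<Longrightarrow> x \<prec> y \<Longrightarrow> x \<oplus> z \<prec> y \<oplus> z"
  using order_axioms unfolding order_axioms_def ball_elts by metis+

lemma plus_R_eq: "x \<epsilon> R \<Longrightarrow> y \<epsilon> R \<Longrightarrow> x \<oplus> y = x \<boxplus> y"
  using func_app[OF addR, of "opair x y"] unfolding pl_def plus_R_def by simp

lemma pl_closed [simp]: "x \<epsilon> R \<Longrightarrow> y \<epsilon> R \<Longrightarrow> x \<boxplus> y \<epsilon> R"
  using func_ap[OF addR, of "opair x y"] unfolding pl_def by simp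

lemma pl_assoc: "x \<epsilon> R \<Longrightarrow> y \<epsilon> R \<Longrightarrow> z \<epsilon> R \<Longrightarrow> x \<boxplus> y \<boxplus> z = x \<boxplus> (y \<boxplus> z)"
  using plus_R_assoc[of x y z] by (simp add: plus_R_eq)

lemma pl_commute: "x \<epsilon> R \<Longrightarrow> y \<epsilon> R \<Longrightarrow> x \<boxplus> y = y \<boxplus> x"
  using plus_R_commute[of x y] by (simp add: plus_R_eq)

lemma pl_zero [simp]: "x \<epsilon> R \<Longrightarrow> x \<boxplus> zero_R = x"
  using plus_zero_R[of x] by (simp add: plus_R_eq)

lemma neg_exists: "x \<epsilon> R \<Longrightarrow> \<exists>y. y \<epsilon> R \<and> x \<boxplus> y = zero_R"
  using minus_R_exists[of x] plus_R_eq by metis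

lemma less_R_carrier: "x \<prec> y \<Longrightarrow> x \<epsilon> R \<and> y \<epsilon> R"
  using less_R_subset unfolding less_R_def subset_iff by fastforce

lemma less_R_irrefl [simp]: "\<not> x \<prec> x"
  using less_R_carrier less_R_irrefl' by blast

lemma less_R_trans [trans]: "x \<prec> y \<Longrightarrow> y \<prec> z \<Longrightarrow> x \<prec> z"
  using less_R_carrier less_R_trans' by blast

lemma less_R_asym: "x \<prec> y \<Longrightarrow> \<not> y \<prec> x"
  using less_R_trans less_R_irrefl by blast

lemma le_R_refl [simp]: "x \<preceq> x"
  by (simp add: le_R_def)

lemma less_imp_le_R: "x \<prec> y \<Longrightarrow> x \<preceq> y"
  by (simp add: le_R_def)

lemma le_R_trans [trans]: "x \<preceq> y \<Longrightarrow> y \<preceq> z \<Longrightarrow> x \<preceq> z"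
  unfolding le_R_def using less_R_trans by blast

lemma le_less_R_trans [trans]: "x \<preceq> y \<Longrightarrow> y \<prec> z \<Longrightarrow> x \<prec> z"
  unfolding le_R_def using less_R_trans by blast

lemma less_le_R_trans [trans]: "x \<prec> y \<Longrightarrow> y \<preceq> z \<Longrightarrow> x \<prec> z"
  unfolding le_R_def using less_R_trans by blast

lemma not_less_R: "x \<epsilon> R \<Longrightarrow> y \<epsilon> R \<Longrightarrow> \<not> x \<prec> y \<longleftrightarrow> y \<preceq> x"
  unfolding le_R_def using less_R_linear less_R_asym by auto

lemma not_le_R: "x \<epsilon> R \<Longrightarrow> y \<epsilon> R \<Longrightarrow> \<not> x \<preceq> y \<longleftrightarrow> y \<prec> x"
  unfolding le_R_def using less_R_linear less_R_asym by auto

lemma pl_strict_mono: "x \<prec> y \<Longrightarrow> z \<epsilon> R \<Longrightarrow> x \<boxplus> z \<prec> y \<boxplus> z"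
  using plus_R_strict_mono[of x y z] less_R_carrier[of x y] by (simp add: plus_R_eq)

lemma pl_strict_mono2: "x \<prec> y \<Longrightarrow> z \<epsilon> R \<Longrightarrow> z \<boxplus> x \<prec> z \<boxplus> y"
  using pl_strict_mono less_R_carrier pl_commute by metis

lemma pl_mono: "x \<preceq> y \<Longrightarrow> z \<epsilon> R \<Longrightarrow> x \<boxplus> z \<preceq> y \<boxplus> z"
  unfolding le_R_def using pl_strict_mono by auto

lemma pl_mono2: "x \<preceq> y \<Longrightarrow> z \<epsilon> R \<Longrightarrow> z \<boxplus> x \<preceq> z \<boxplus> y"
  unfolding le_R_def using pl_strict_mono2 by auto

lemma pl_less_cancel: "x \<epsilon> R \<Longrightarrow> y \<epsilon> R \<Longrightarrow> z \<epsilon> R \<Longrightarrow> z \<boxplus> x \<prec> z \<boxplus> y \<longleftrightarrow> x \<prec> y"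
  using pl_strict_mono2 less_R_linear less_R_asym less_R_irrefl by metis

lemma less_pl: "zero_R \<prec> d \<Longrightarrow> x \<epsilon> R \<Longrightarrow> x \<prec> x \<boxplus> d"
  using pl_strict_mono2[of zero_R d x] by simp

lemma diff_exists:
  assumes "x \<epsilon> R" "y \<epsilon> R"
  obtains d where "d \<epsilon> R" "x \<boxplus> d = y"
proof -
  obtain n where n: "n \<epsilon> R" "x \<boxplus> n = zero_R"
    using neg_exists assms by blast
  have "x \<boxplus> (n \<boxplus> y) = y \<boxplus> zero_R"
    using n assms pl_assoc[of x n y] pl_commute[of zero_R y] by simp
  with n assms show ?thesis by (intro that[of "n \<boxplus> y"]) simp_all
qed

lemma pos_diff_exists:
  assumes "x \<prec> y"
  obtains d where "d \<epsilon> R" "zero_R \<prec> d" "x \<boxplus> d = y"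
proof -
  have R: "x \<epsilon> R" "y \<epsilon> R" using assms less_R_carrier by auto
  then obtain d where d: "d \<epsilon> R" "x \<boxplus> d = y" using diff_exists by blast
  then have "x \<boxplus> zero_R \<prec> x \<boxplus> d" using assms R by simp
  then have "zero_R \<prec> d" using pl_less_cancel[of zero_R d x] R d by simp
  with d show ?thesis using that by blast
qed

text \<open>Multiplication by the inverse of 1 + 1 halves x. That 1 + 1 is nonzero follows from the
  order, on whichever side of 0 the element 1 lies.\<close>

lemma half_exists:
  assumes x: "x \<epsilon> R"
  shows "\<exists>h. h \<epsilon> R \<and> h \<boxplus> h = x"
proof -
  note one = one_R zero_neq_one_R
  have closed: "x \<otimes> y \<epsilon> R" if "x \<epsilon> R" "y \<epsilon> R" for x y
    using multR that unfolding func_def times_R_def by simp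
  have "one_R \<boxplus> one_R \<noteq> zero_R"
  proof (cases "zero_R \<prec> one_R")
    case True
    then show ?thesis
      using less_R_trans[OF True less_pl[OF True one(1)]] by auto
  next
    case False
    then have neg: "one_R \<prec> zero_R"
      using less_R_linear one by (metis zero_R)
    then have "one_R \<boxplus> one_R \<prec> one_R"
      using pl_strict_mono2[OF neg one(1)] one by simp
    with neg show ?thesis using less_R_trans by (metis less_R_irrefl)
  qed
  then obtain t where t: "t \<epsilon> R" "(one_R \<boxplus> one_R) \<otimes> t = one_R"
    using inverse_R_exists one by (meson pl_closed)
  have "t \<oplus> t = one_R"
    using t times_R_commute[of "one_R \<boxplus> one_R" t] distrib_R[of t one_R one_R] one times_one_R plus_R_eq by simp
  then have "(x \<otimes> t) \<oplus> (x \<otimes> t) = x"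
    using distrib_R[of x t t] x t times_one_R by simp
  then show ?thesis
    using closed x t plus_R_eq by metis
qed

lemma double_strict_mono: "x \<prec> y \<Longrightarrow> x \<boxplus> x \<prec> y \<boxplus> y"
  using pl_strict_mono pl_strict_mono2 less_R_carrier less_R_trans by meson

lemma double_less_cancel: "x \<epsilon> R \<Longrightarrow> y \<epsilon> R \<Longrightarrow> x \<boxplus> x \<prec> y \<boxplus> y \<Longrightarrow> x \<prec> y"
  using double_strict_mono[of y x] less_R_linear[of x y] less_R_asym by auto

lemma double_inject: "x \<epsilon> R \<Longrightarrow> y \<epsilon> R \<Longrightarrow> x \<boxplus> x = y \<boxplus> y \<Longrightarrow> x = y"
  using double_strict_mono[of y x] double_strict_mono[of x y] less_R_linear[of x y] by auto

definition hf :: "'v \<Rightarrow> 'v"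
  where "hf x = the1 (\<lambda>h. h \<epsilon> R \<and> h \<boxplus> h = x)"

lemma DefT_hf [dfi]: "DefT t \<Longrightarrow> DefT (\<lambda>e. hf (t e))"
  by (rule DefT_subst1[where F = hf]) (unfold hf_def, intro dfi)

lemma hf:
  assumes "x \<epsilon> R"
  shows hf_closed [simp]: "hf x \<epsilon> R" and hf_double: "hf x \<boxplus> hf x = x"
proof -
  obtain h where h: "h \<epsilon> R" "h \<boxplus> h = x" using half_exists assms by blast
  have "hf x = h"
    unfolding hf_def
    by (rule the1_eqI) (use h double_inject in auto)
  with h show "hf x \<epsilon> R" "hf x \<boxplus> hf x = x" by auto
qed

lemma hf_pos: "zero_R \<prec> x \<Longrightarrow> zero_R \<prec> hf x"
  using double_less_cancel[of zero_R "hf x"] hf[of x] less_R_carrier[of zero_R x] by simp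

lemma midpoint:
  assumes "a \<prec> b"
  shows "a \<prec> hf (a \<boxplus> b)" "hf (a \<boxplus> b) \<prec> b"
proof -
  have R: "a \<epsilon> R" "b \<epsilon> R" using less_R_carrier assms by auto
  then have h: "hf (a \<boxplus> b) \<epsilon> R" "hf (a \<boxplus> b) \<boxplus> hf (a \<boxplus> b) = a \<boxplus> b" using hf by auto
  have "a \<boxplus> a \<prec> a \<boxplus> b" "a \<boxplus> b \<prec> b \<boxplus> b"
    using pl_strict_mono2[OF assms R(1)] pl_strict_mono[OF assms R(2)] by auto
  then show "a \<prec> hf (a \<boxplus> b)" "hf (a \<boxplus> b) \<prec> b"
    using h R double_less_cancel[of a "hf (a \<boxplus> b)"] double_less_cancel[of "hf (a \<boxplus> b)" b] by auto
qed

lemma supremum: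
  assumes "Def (\<lambda>e. P (e 0))" "x \<epsilon> R" "P x" "b \<epsilon> R" "\<And>x. x \<epsilon> R \<Longrightarrow> P x \<Longrightarrow> x \<preceq> b"
  obtains u where "u \<epsilon> R" "\<And>x. x \<epsilon> R \<Longrightarrow> P x \<Longrightarrow> x \<preceq> u"
    "\<And>v. v \<epsilon> R \<Longrightarrow> (\<And>x. x \<epsilon> R \<Longrightarrow> P x \<Longrightarrow> x \<preceq> v) \<Longrightarrow> u \<preceq> v"
proof -
  define S where "S = sep R P"
  have S: "x \<epsilon> S \<longleftrightarrow> x \<epsilon> R \<and> P x" for x
    unfolding S_def by (rule sep_iff[OF assms(1)])
  have "elts S \<subseteq> elts R" "elts S \<noteq> {}" "upper_bound S b"
    using S assms by (auto simp: upper_bound_def elts_def)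
  then obtain u where "upper_bound S u" "\<forall>v. upper_bound S v \<longrightarrow> u \<preceq> v"
    using completeness unfolding completeness_def by blast
  then show ?thesis
    by (intro that[of u]) (auto simp: upper_bound_def S)
qed

lemma limit_ofD:
  assumes "limit_of s x" "func s omega R" "zero_R \<prec> e"
  obtains N where "N \<epsilon> omega"
    "\<And>n. n \<epsilon> omega \<Longrightarrow> N \<epsilon> succ n \<Longrightarrow> ap s n \<prec> x \<boxplus> e \<and> x \<prec> ap s n \<boxplus> e"
proof -
  have e: "e \<epsilon> R" using less_R_carrier[OF assms(3)] by simp
  have x: "x \<epsilon> R" using assms(1) unfolding limit_of_def by simp
  obtain N where N: "N \<epsilon> omega" "\<forall>n. n \<epsilon> omega \<longrightarrow> N = n \<or> N \<epsilon> n \<longrightarrow>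
      app s n \<prec> x \<oplus> e \<and> x \<prec> app s n \<oplus> e"
    using assms(1,3) e unfolding limit_of_def ball_elts bex_elts by blast
  have "app s n = ap s n" "x \<oplus> e = x \<boxplus> e" "app s n \<oplus> e = ap s n \<boxplus> e" if "n \<epsilon> omega" for n
    using func_app[OF assms(2) that] func_ap[OF assms(2) that] plus_R_eq x e by simp_all
  with N show ?thesis by (intro that[of N]) auto
qed

lemma limit_le:
  assumes "limit_of s x" "func s omega R" "u \<epsilon> R" "\<And>n. n \<epsilon> omega \<Longrightarrow> ap s n \<preceq> u"
  shows "x \<preceq> u"
proof (rule ccontr)
  assume "\<not> x \<preceq> u"
  moreover have x: "x \<epsilon> R" using assms(1) unfolding limit_of_def by simp
  ultimately have "u \<prec> x" using not_le_R assms(3) by blast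
  then obtain e where e: "e \<epsilon> R" "zero_R \<prec> e" "u \<boxplus> e = x" using pos_diff_exists by blast
  obtain N where N: "N \<epsilon> omega" "x \<prec> ap s N \<boxplus> e"
    using limit_ofD[OF assms(1,2) e(2)] by (metis succ_iff)
  have "ap s N \<boxplus> e \<preceq> u \<boxplus> e"
    using pl_mono[OF assms(4)[OF N(1)] e(1)] .
  with N(2) show False
    using e less_le_R_trans by fastforce
qed

lemma limit_ge:
  assumes "limit_of s x" "func s omega R" "v \<epsilon> R" "n \<epsilon> omega"
    "\<And>m. m \<epsilon> omega \<Longrightarrow> n \<epsilon> succ m \<Longrightarrow> v \<preceq> ap s m"
  shows "v \<preceq> x"
proof (rule ccontr)
  assume "\<not> v \<preceq> x"
  moreover have x: "x \<epsilon> R" using assms(1) unfolding limit_of_def by simp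
  ultimately have "x \<prec> v" using not_le_R assms(3) by blast
  then obtain e where e: "e \<epsilon> R" "zero_R \<prec> e" "x \<boxplus> e = v" using pos_diff_exists by blast
  obtain N where N: "N \<epsilon> omega" "\<And>n. n \<epsilon> omega \<Longrightarrow> N \<epsilon> succ n \<Longrightarrow> ap s n \<prec> x \<boxplus> e"
    using limit_ofD[OF assms(1,2) e(2)] by metis
  obtain m where m: "m \<epsilon> omega" "N \<epsilon> succ m" "n \<epsilon> succ m"
    using max_exists N(1) assms(4) by blast
  have "ap s m \<prec> v" using N(2)[OF m(1,2)] e by simp
  then show False
    using assms(5)[OF m(1,3)] less_le_R_trans less_R_irrefl by blast
qed

lemma seq_mono:
  assumes "\<And>n. n \<epsilon> omega \<Longrightarrow> ap s n \<preceq> ap s (succ n)" "m \<epsilon> succ n" "n \<epsilon> omega"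
  shows "ap s m \<preceq> ap s n"
proof -
  have "\<forall>m\<in>elts (succ n). ap s m \<preceq> ap s n"
    using assms(3)
  proof (induct rule: omega_induct)
    case Def show ?case by (intro dfi)
  next
    case (succ n)
    then show ?case using assms(1)[of n] le_R_trans by auto
  qed simp
  with assms show ?thesis by auto
qed

end

subsection \<open>Binary expansions by bisection\<close>

locale zf_cantor = cantor_game mem R addR multR ltR a0 b0 + zf_reals mem R addR multR ltR
  for mem :: "'v \<Rightarrow> 'v \<Rightarrow> bool"  (infix "\<epsilon>" 50) and R addR multR ltR a0 b0 :: 'v +
  assumes a0_less_b0: "a0 \<prec> b0"
begin

lemma ab_R [simp]: "a0 \<epsilon> R" "b0 \<epsilon> R"
  using less_R_carrier[OF a0_less_b0] by auto

text \<open>Entry n is (b0 - a0)/2^n, the length of an interval after n bisections.\<close>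

definition widths :: 'v
  where "widths = (SOME w. func w omega R \<and> zero_R \<prec> ap w zero \<and> a0 \<boxplus> ap w zero = b0 \<and>
    (\<forall>n. n \<epsilon> omega \<longrightarrow> ap w (succ n) = hf (ap w n)))"

lemma widths: "func widths omega R \<and> zero_R \<prec> ap widths zero \<and> a0 \<boxplus> ap widths zero = b0 \<and>
    (\<forall>n. n \<epsilon> omega \<longrightarrow> ap widths (succ n) = hf (ap widths n))"
proof -
  obtain d where d: "d \<epsilon> R" "zero_R \<prec> d" "a0 \<boxplus> d = b0"
    using pos_diff_exists[OF a0_less_b0] by blast
  have D: "DefT (\<lambda>e. hf (e (Suc 0)))" by (intro dfi)
  have "\<exists>w. func w omega R \<and> zero_R \<prec> ap w zero \<and> a0 \<boxplus> ap w zero = b0 \<and>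
    (\<forall>n. n \<epsilon> omega \<longrightarrow> ap w (succ n) = hf (ap w n))"
    by (rule omega_recursion[where A = R and a = d, OF D]) (use d in auto)
  then show ?thesis
    unfolding widths_def by (rule someI_ex)
qed

definition wd :: "'v \<Rightarrow> 'v" where "wd n = ap widths n"

lemma DefT_wd [dfi]: "DefT t \<Longrightarrow> DefT (\<lambda>e. wd (t e))"
  unfolding wd_def by (intro dfi)

lemma wd_R [simp]: "n \<epsilon> omega \<Longrightarrow> wd n \<epsilon> R"
  using widths unfolding wd_def by auto

lemma wd_zero: "a0 \<boxplus> wd zero = b0"
  using widths unfolding wd_def by auto

lemma wd_succ: "n \<epsilon> omega \<Longrightarrow> wd (succ n) \<boxplus> wd (succ n) = wd n"
  using widths hf_double[of "wd n"] unfolding wd_def by auto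

lemma wd_pos: "n \<epsilon> omega \<Longrightarrow> zero_R \<prec> wd n"
proof (induct rule: omega_induct)
  case Def show ?case by (intro dfi)
next
  case zero show ?case using widths unfolding wd_def by auto
next
  case (succ n)
  then show ?case using widths hf_pos unfolding wd_def by auto
qed

text \<open>Since the widths halve, the reals below all of them are closed under doubling.\<close>

lemma wd_archimedean:
  assumes "zero_R \<prec> d"
  obtains n where "n \<epsilon> omega" "wd n \<prec> d"
proof (rule ccontr)
  note obt = that
  assume "\<not> thesis"
  then have neg: "\<not> wd n \<prec> d" if "n \<epsilon> omega" for n
    using obt \<open>\<not> thesis\<close> that by blast
  have d: "d \<epsilon> R" using assms less_R_carrier by blast
  define P where "P e \<longleftrightarrow> (\<forall>n\<in>elts omega. e \<preceq> wd n)" for e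
  have double: "P (e \<boxplus> e)" if e: "e \<epsilon> R" "P e" for e
    unfolding P_def
  proof
    fix n assume "n \<in> elts omega"
    then have n: "n \<epsilon> omega" by simp
    then have "e \<preceq> wd (succ n)" using e(2) unfolding P_def by simp
    then have "e \<boxplus> e \<preceq> wd (succ n) \<boxplus> wd (succ n)"
      using le_R_trans pl_mono[of e _ e] pl_mono2[of e] e(1) n by (metis succ_omega wd_R)
    then show "e \<boxplus> e \<preceq> wd n" using wd_succ n by simp
  qed
  have D: "Def (\<lambda>e. P (e 0))" unfolding P_def by (intro dfi)
  have "P d" using neg d not_less_R unfolding P_def by simp
  have bound: "x \<preceq> wd zero" if "P x" for x
    using that unfolding P_def by simp
  obtain u where u: "u \<epsilon> R" "\<And>x. x \<epsilon> R \<Longrightarrow> P x \<Longrightarrow> x \<preceq> u"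
    "\<And>v. v \<epsilon> R \<Longrightarrow> (\<And>x. x \<epsilon> R \<Longrightarrow> P x \<Longrightarrow> x \<preceq> v) \<Longrightarrow> u \<preceq> v"
    using supremum[OF D d \<open>P d\<close> wd_R[OF zero_omega] bound] by metis
  \<comment> \<open>The double of each such real is again bounded by u, so half of u is an upper
    bound too, although it is smaller than the least one.\<close>
  have "u \<preceq> hf u"
  proof (rule u(3))
    fix x assume x: "x \<epsilon> R" "P x"
    then have "x \<boxplus> x \<preceq> hf u \<boxplus> hf u" using u(1,2) double hf_double by simp
    then show "x \<preceq> hf u"
      using x u double_strict_mono[of "hf u" x] not_le_R[of x "hf u"] le_less_R_trans
      by (metis hf_closed less_R_irrefl)
  qed (use u in simp)
  moreover have "hf u \<prec> u"
  proof -
    have "zero_R \<prec> u" using assms u(2)[OF d \<open>P d\<close>] less_le_R_trans by blast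
    then show ?thesis
      using less_pl[OF hf_pos, of u "hf u"] hf_double u(1) by simp
  qed
  ultimately show False using le_less_R_trans less_R_irrefl by blast
qed

text \<open>Left ends of the nested intervals obtained by bisection, where bit n of \<open>z\<close>
  tells whether step n keeps the right half.\<close>

definition lefts :: "'v \<Rightarrow> 'v"
  where "lefts z = the1 (\<lambda>l. func l omega R \<and> ap l zero = a0 \<and>
    (\<forall>n\<in>elts omega. ap l (succ n) = (if n \<epsilon> z then ap l n \<boxplus> wd (succ n) else ap l n)))"

definition lft :: "'v \<Rightarrow> 'v \<Rightarrow> 'v" where "lft z n = ap (lefts z) n"

definition rgt :: "'v \<Rightarrow> 'v \<Rightarrow> 'v" where "rgt z n = lft z n \<boxplus> wd n"

lemma DefT_lft [dfi]: "DefT s \<Longrightarrow> DefT t \<Longrightarrow> DefT (\<lambda>e. lft (s e) (t e))"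
  by (rule DefT_subst2[where F = lft]) (unfold lft_def lefts_def, intro dfi)

lemma DefT_rgt [dfi]: "DefT s \<Longrightarrow> DefT t \<Longrightarrow> DefT (\<lambda>e. rgt (s e) (t e))"
  unfolding rgt_def by (intro dfi)

lemma lefts: "func (lefts z) omega R \<and> ap (lefts z) zero = a0 \<and>
    (\<forall>n\<in>elts omega. ap (lefts z) (succ n) =
      (if n \<epsilon> z then ap (lefts z) n \<boxplus> wd (succ n) else ap (lefts z) n))"
  unfolding lefts_def
proof (rule the1I)
  have D: "DefT (\<lambda>e. if e 0 \<epsilon> z then e (Suc 0) \<boxplus> wd (succ (e 0)) else e (Suc 0))"
    by (intro dfi)
  have "\<exists>l. func l omega R \<and> ap l zero = a0 \<and>
    (\<forall>n\<in>elts omega. ap l (succ n) = (if n \<epsilon> z then ap l n \<boxplus> wd (succ n) else ap l n))"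
    by (rule omega_recursion[where A = R and a = a0, OF D]) auto
  then obtain l where l: "func l omega R" "ap l zero = a0" 
    "\<And>n. n \<epsilon> omega \<Longrightarrow> ap l (succ n) = (if n \<epsilon> z then ap l n \<boxplus> wd (succ n) else ap l n)"
    by auto
  have eq: "l' = l" if l': "func l' omega R \<and> ap l' zero = a0 \<and>
    (\<forall>n\<in>elts omega. ap l' (succ n) = (if n \<epsilon> z then ap l' n \<boxplus> wd (succ n) else ap l' n))" for l'
  proof (rule fun_on_ext[of _ omega])
    fix n assume "n \<epsilon> omega"
    then show "ap l' n = ap l n"
    proof (induct rule: omega_induct)
      case Def show ?case by (intro dfi)
    qed (use l l' in simp_all)
  qed (use l l' in auto)
  show "\<exists>!l. func l omega R \<and> ap l zero = a0 \<and>
    (\<forall>n\<in>elts omega. ap l (succ n) = (if n \<epsilon> z then ap l n \<boxplus> wd (succ n) else ap l n))"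
  proof (rule ex1I)
    show "func l omega R \<and> ap l zero = a0 \<and>
      (\<forall>n\<in>elts omega. ap l (succ n) = (if n \<epsilon> z then ap l n \<boxplus> wd (succ n) else ap l n))"
      using l by simp
  qed (rule eq)
qed

lemma lft_R [simp]: "n \<epsilon> omega \<Longrightarrow> lft z n \<epsilon> R"
  and lft_zero [simp]: "lft z zero = a0"
  and lft_succ: "n \<epsilon> omega \<Longrightarrow> lft z (succ n) = (if n \<epsilon> z then lft z n \<boxplus> wd (succ n) else lft z n)"
  using lefts[of z] unfolding lft_def by auto

lemma rgt_R [simp]: "n \<epsilon> omega \<Longrightarrow> rgt z n \<epsilon> R"
  unfolding rgt_def by simp

lemma rgt_zero [simp]: "rgt z zero = b0"
  unfolding rgt_def by (simp add: wd_zero)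

lemma rgt_succ: "n \<epsilon> omega \<Longrightarrow> rgt z (succ n) = (if n \<epsilon> z then rgt z n else lft z n \<boxplus> wd (succ n))"
  unfolding rgt_def using wd_succ[of n] by (auto simp: lft_succ pl_assoc)

lemma lft_less_rgt: "n \<epsilon> omega \<Longrightarrow> lft z n \<prec> rgt z n"
  unfolding rgt_def using less_pl wd_pos by simp

lemma lft_cong: "n \<epsilon> omega \<Longrightarrow> (\<And>k. k \<epsilon> n \<Longrightarrow> k \<epsilon> z \<longleftrightarrow> k \<epsilon> z') \<Longrightarrow> lft z n = lft z' n"
proof -
  assume n: "n \<epsilon> omega" and eq: "\<And>k. k \<epsilon> n \<Longrightarrow> k \<epsilon> z \<longleftrightarrow> k \<epsilon> z'"
  have "(\<forall>k\<in>elts n. k \<epsilon> z \<longleftrightarrow> k \<epsilon> z') \<longrightarrow> lft z n = lft z' n"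
    using n
  proof (induct rule: omega_induct)
    case Def show ?case by (intro dfi)
  qed (auto simp: lft_succ)
  with eq show ?thesis by simp
qed

lemma rgt_cong: "n \<epsilon> omega \<Longrightarrow> (\<And>k. k \<epsilon> n \<Longrightarrow> k \<epsilon> z \<longleftrightarrow> k \<epsilon> z') \<Longrightarrow> rgt z n = rgt z' n"
  unfolding rgt_def using lft_cong by metis

lemma lft_step: "n \<epsilon> omega \<Longrightarrow> lft z n \<preceq> lft z (succ n)"
  using less_pl[OF wd_pos, of "succ n" "lft z n"] by (simp add: lft_succ less_imp_le_R)

lemma rgt_step_strict: "n \<epsilon> omega \<Longrightarrow> \<not> n \<epsilon> z \<Longrightarrow> rgt z (succ n) \<prec> rgt z n"
  using less_pl[OF wd_pos, of "succ n" "lft z n \<boxplus> wd (succ n)"] wd_succ[of n]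
  by (simp add: rgt_succ) (simp add: rgt_def pl_assoc)

lemma rgt_step: "n \<epsilon> omega \<Longrightarrow> rgt z (succ n) \<preceq> rgt z n"
  using rgt_step_strict[of n z] by (cases "n \<epsilon> z") (auto simp: rgt_succ less_imp_le_R)

lemma lft_mono: "m \<epsilon> succ n \<Longrightarrow> n \<epsilon> omega \<Longrightarrow> lft z m \<preceq> lft z n"
proof -
  assume m: "m \<epsilon> succ n" and n: "n \<epsilon> omega"
  have "\<forall>m\<in>elts (succ n). lft z m \<preceq> lft z n"
    using n
  proof (induct rule: omega_induct)
    case Def show ?case by (intro dfi)
  next
    case (succ n)
    then show ?case using lft_step[of n z] le_R_trans by auto
  qed simp
  with m show ?thesis by auto
qed

lemma rgt_mono: "m \<epsilon> succ n \<Longrightarrow> n \<epsilon> omega \<Longrightarrow> rgt z n \<preceq> rgt z m"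
proof -
  assume m: "m \<epsilon> succ n" and n: "n \<epsilon> omega"
  have "\<forall>m\<in>elts (succ n). rgt z n \<preceq> rgt z m"
    using n
  proof (induct rule: omega_induct)
    case Def show ?case by (intro dfi)
  next
    case (succ n)
    then show ?case using rgt_step[of n z] le_R_trans by auto
  qed simp
  with m show ?thesis by auto
qed

lemma lft_le_rgt: "m \<epsilon> omega \<Longrightarrow> n \<epsilon> omega \<Longrightarrow> lft z m \<preceq> rgt z n"
proof -
  assume m: "m \<epsilon> omega" and n: "n \<epsilon> omega"
  then consider "m \<epsilon> succ n" | "n \<epsilon> succ m" using omega_linear by auto
  then show ?thesis
  proof cases
    case 1
    then show ?thesis
      using lft_mono[OF 1 n] lft_less_rgt[OF n] less_imp_le_R le_R_trans by blast
  next
    case 2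
    then show ?thesis
      using rgt_mono[OF 2 m] lft_less_rgt[OF m] less_imp_le_R le_R_trans by blast
  qed
qed

text \<open>The intervals are closed, so an inner division point is expanded by two sets, one of
  which has only ones from some place on.\<close>

definition expands :: "'v \<Rightarrow> 'v \<Rightarrow> bool"
  where "expands z x \<longleftrightarrow> x \<epsilon> R \<and> (\<forall>n\<in>elts omega. lft z n \<preceq> x \<and> x \<preceq> rgt z n)"

lemma Def_expands [dfi]: "DefT s \<Longrightarrow> DefT t \<Longrightarrow> Def (\<lambda>e. expands (s e) (t e))"
  by (rule Def_subst2[where P = expands]) (unfold expands_def, intro dfi)

lemma expandsD:
  assumes "expands z x"
  shows "x \<epsilon> R" "n \<epsilon> omega \<Longrightarrow> lft z n \<preceq> x" "n \<epsilon> omega \<Longrightarrow> x \<preceq> rgt z n"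
  using assms unfolding expands_def by auto

lemma expands_bounds: "expands z x \<Longrightarrow> a0 \<preceq> x \<and> x \<preceq> b0"
  using expandsD(2,3)[of z x zero] by simp

text \<open>The supremum of the left ends lies in all the intervals.\<close>

lemma expands_exists: "\<exists>x. expands z x"
proof -
  define P where "P x \<longleftrightarrow> (\<exists>n\<in>elts omega. x = lft z n)" for x
  have D: "Def (\<lambda>e. P (e 0))" unfolding P_def by (intro dfi)
  have "P a0" unfolding P_def by (auto intro!: exI[of _ zero])
  have le: "x \<preceq> rgt z n" if "P x" "n \<epsilon> omega" for x n
    using that lft_le_rgt unfolding P_def by auto
  obtain u where u: "u \<epsilon> R" "\<And>x. x \<epsilon> R \<Longrightarrow> P x \<Longrightarrow> x \<preceq> u"
    "\<And>v. v \<epsilon> R \<Longrightarrow> (\<And>x. x \<epsilon> R \<Longrightarrow> P x \<Longrightarrow> x \<preceq> v) \<Longrightarrow> u \<preceq> v"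
    using supremum[OF D ab_R(1) \<open>P a0\<close> rgt_R[OF zero_omega, of z] le[OF _ zero_omega]] by metis
  have "lft z n \<preceq> u" "u \<preceq> rgt z n" if "n \<epsilon> omega" for n
  proof -
    have "P (lft z n)" using that unfolding P_def by auto
    then show "lft z n \<preceq> u" using u(2) that by simp
    show "u \<preceq> rgt z n" using u(3) le that by simp
  qed
  with u(1) show ?thesis unfolding expands_def by auto
qed

text \<open>The distance of two common points would be bounded by every width, against
  \<open>wd_archimedean\<close>.\<close>

lemma expands_unique:
  assumes "expands z x" "expands z y"
  shows "x = y"
proof -
  have False if xy: "expands z x" "expands z y" "x \<prec> y" for x y
  proof -
    obtain d where d: "d \<epsilon> R" "zero_R \<prec> d" "x \<boxplus> d = y"
      using pos_diff_exists \<open>x \<prec> y\<close> by blast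
    obtain n where n: "n \<epsilon> omega" "wd n \<prec> d"
      using wd_archimedean[OF d(2)] by blast
    have "lft z n \<boxplus> wd n \<preceq> x \<boxplus> wd n"
      using expandsD[OF xy(1)] n pl_mono by simp
    also have "x \<boxplus> wd n \<prec> x \<boxplus> d"
      using pl_strict_mono2[OF n(2) expandsD(1)[OF xy(1)]] .
    finally have "rgt z n \<prec> y" using d by (simp add: rgt_def)
    then show False
      using expandsD(3)[OF xy(2) n(1)] less_le_R_trans less_R_irrefl by blast
  qed
  then show ?thesis
    using assms less_R_linear expandsD(1) by metis
qed

lemma expansion_exists:
  assumes x: "x \<epsilon> R" "a0 \<preceq> x" "x \<preceq> b0"
  shows "\<exists>z. elts z \<subseteq> elts omega \<and> expands z x"
proof -
  \<comment> \<open>Bit n is 1 exactly when the midpoint of the n-th interval is at most x; this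
    midpoint depends on lower bits only, so the condition is causal.\<close>
  have D: "Def (\<lambda>e. lft (e (Suc 0)) (e 0) \<boxplus> wd (succ (e 0)) \<preceq> x)" by (intro dfi)
  obtain z where z: "elts z \<subseteq> elts omega" "\<And>n. n \<epsilon> omega \<Longrightarrow> n \<epsilon> z \<longleftrightarrow> lft z n \<boxplus> wd (succ n) \<preceq> x"
    by (rule causal_subset[OF D]) (use lft_cong in metis)+
  have "lft z n \<preceq> x \<and> x \<preceq> rgt z n" if "n \<epsilon> omega" for n
    using that
  proof (induct rule: omega_induct)
    case Def show ?case by (intro dfi)
  next
    case zero show ?case using x by simp
  next
    case (succ n)
    then show ?case
      using z(2)[of n] x not_le_R[of "lft z n \<boxplus> wd (succ n)" x]
      by (auto simp: lft_succ rgt_succ less_imp_le_R)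
  qed
  with z(1) x(1) show ?thesis unfolding expands_def by auto
qed

text \<open>If no right end were below b, then b would lie in all the intervals as well, against
  uniqueness.\<close>

lemma expands_rgt_less:
  assumes "expands z x" "x \<prec> b"
  obtains n where "n \<epsilon> omega" "rgt z n \<prec> b"
proof (rule ccontr)
  note obt = that
  assume "\<not> thesis"
  then have neg: "\<not> rgt z n \<prec> b" if "n \<epsilon> omega" for n
    using obt \<open>\<not> thesis\<close> that by blast
  have b: "b \<epsilon> R" using assms(2) less_R_carrier by blast
  have "lft z n \<preceq> b" if "n \<epsilon> omega" for n
    using le_less_R_trans[OF expandsD(2)[OF assms(1) that] assms(2)] less_imp_le_R by blast
  then have "expands z b"
    unfolding expands_def using b neg not_less_R by auto
  then show False
    using expands_unique assms less_R_irrefl by blast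
qed

text \<open>At the first difference k the two halves share only the midpoint, which x reaches only
  if all its bits beyond k are 1. The zero at \<open>j\<close> excludes this and makes the
  inequality strict.\<close>

lemma expands_less:
  assumes z: "expands z x" and z': "expands z' x'"
    and k: "k \<epsilon> omega" "\<And>j. j \<epsilon> k \<Longrightarrow> j \<epsilon> z \<longleftrightarrow> j \<epsilon> z'" "\<not> k \<epsilon> z" "k \<epsilon> z'"
    and j: "j \<epsilon> omega" "k \<epsilon> j" "\<not> j \<epsilon> z"
  shows "x \<prec> x'"
proof -
  have "x \<preceq> rgt z (succ j)" using expandsD[OF z] j by simp
  also have "\<dots> \<prec> rgt z j" using rgt_step_strict j by simp
  also have "\<dots> \<preceq> rgt z (succ k)" using rgt_mono[of "succ k" j z] succ_less_succ j by blast
  also have "\<dots> = lft z' (succ k)" using k lft_cong[of k z z'] by (simp add: rgt_succ lft_succ)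
  also have "\<dots> \<preceq> x'" using expandsD[OF z'] k by simp
  finally show ?thesis .
qed

text \<open>Only the expansion all of whose bits are 1 reaches b0.\<close>

lemma expands_less_b0:
  assumes "expands z x" "j \<epsilon> omega" "\<not> j \<epsilon> z"
  shows "x \<prec> b0"
proof -
  have "x \<preceq> rgt z (succ j)" using expandsD[OF assms(1)] assms by simp
  also have "\<dots> \<prec> rgt z j" using rgt_step_strict assms by simp
  also have "\<dots> \<preceq> rgt z zero" using rgt_mono[of zero j z] zero_less_succ assms by blast
  finally show ?thesis by simp
qed

end

context zf_cantor
begin

subsection \<open>Positional strategies for player A\<close>

text \<open>\<open>position_A\<close> with \<open>ap\<close> in place of \<open>app\<close>, and
  hence definable.\<close>

definition pos_A :: "'v \<Rightarrow> 'v \<Rightarrow> 'v \<Rightarrow> bool"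
  where "pos_A m a b \<longleftrightarrow>
    func a (succ m) R \<and> func b (succ m) R \<and> ap a zero = a0 \<and> ap b zero = b0 \<and>
    (\<forall>i\<in>elts m. ap a i \<prec> ap a (succ i)) \<and> ap a m \<prec> ap b m \<and>
    (\<forall>i\<in>elts m. ap b (succ i) \<prec> ap b i)"

lemma Def_pos_A [dfi]: "DefT s \<Longrightarrow> DefT t \<Longrightarrow> DefT u \<Longrightarrow> Def (\<lambda>e. pos_A (s e) (t e) (u e))"
  by (rule Def_subst3[where P = pos_A]) (unfold pos_A_def, intro dfi)

lemma position_A_iff:
  assumes "m \<epsilon> omega"
  shows "position_A m a b \<longleftrightarrow> pos_A m a b"
proof -
  have app: "app s i = ap s i" if "func s (succ m) R" "i \<epsilon> succ m" for s i
    using func_app that by blast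
  show ?thesis
  proof (cases "func a (succ m) R \<and> func b (succ m) R")
    case True
    then show ?thesis
      unfolding position_A_def pos_A_def
      using app[of a] app[of b] zero_less_succ[OF assms] succ_less_succ[OF _ assms]
      by (simp del: succ_iff) (simp add: succ_iff)
  next
    case False
    then show ?thesis
      unfolding position_A_def pos_A_def by blast
  qed
qed

definition positions_A :: "'v \<Rightarrow> 'v"
  where "positions_A m = sep (prod_set (funset (succ m) R) (funset (succ m) R))
    (\<lambda>p. \<exists>a b. pos_A m a b \<and> p = opair a b)"

lemma positions_A_iff [simp]: "p \<epsilon> positions_A m \<longleftrightarrow> (\<exists>a b. pos_A m a b \<and> p = opair a b)"
proof -
  have D: "Def (\<lambda>e. \<exists>a b. pos_A m a b \<and> e 0 = opair a b)" by (intro dfi)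
  show ?thesis
    unfolding positions_A_def sep_iff[OF D] by (auto simp: pos_A_def)
qed

lemma DefT_positions_A [dfi]: "DefT t \<Longrightarrow> DefT (\<lambda>e. positions_A (t e))"
  by (rule DefT_subst1[where F = positions_A]) (unfold positions_A_def, intro dfi)

lemma positions_A_eq: "m \<epsilon> omega \<Longrightarrow> the_set (\<lambda>p. \<exists>a b. position_A m a b \<and> p = opair a b) = positions_A m"
  by (rule the_set_eqI) (simp add: position_A_iff)

text \<open>A strategy without memory: whatever a move depends on must be recovered from the current
  interval, as \<open>recov\<close> does below.\<close>

definition positional_A :: "('v \<Rightarrow> 'v \<Rightarrow> 'v) \<Rightarrow> 'v"
  where "positional_A mv =
    lam omega (\<lambda>m. lam (positions_A m) (\<lambda>p. mv (ap (fst_of p) m) (ap (snd_of p) m)))"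

text \<open>Legality of the first m turns, stated for total sequences. Positions arise from these by
  restriction, which fits the recursion over total sequences.\<close>

definition nested :: "'v \<Rightarrow> 'v \<Rightarrow> 'v \<Rightarrow> bool"
  where "nested m a b \<longleftrightarrow> func a omega R \<and> func b omega R \<and> ap a zero = a0 \<and> ap b zero = b0 \<and>
    (\<forall>i\<in>elts m. ap a i \<prec> ap a (succ i) \<and> ap b (succ i) \<prec> ap b i) \<and> ap a m \<prec> ap b m"

lemma Def_nested [dfi]: "DefT s \<Longrightarrow> DefT t \<Longrightarrow> DefT u \<Longrightarrow> Def (\<lambda>e. nested (s e) (t e) (u e))"
  by (rule Def_subst3[where P = nested]) (unfold nested_def, intro dfi)

lemma nested_pos_A:
  assumes "nested m a b" "m \<epsilon> omega"
  shows "pos_A m (restr a (succ m)) (restr b (succ m))"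
proof -
  have f: "func a omega R" "func b omega R" "ap a zero = a0" "ap b zero = b0"
    and step: "\<And>i. i \<epsilon> m \<Longrightarrow> ap a i \<prec> ap a (succ i) \<and> ap b (succ i) \<prec> ap b i"
    and less: "ap a m \<prec> ap b m"
    using assms(1) unfolding nested_def by simp_all
  have sub: "elts (succ m) \<subseteq> elts omega" using assms by simp
  have r: "ap (restr a (succ m)) i = ap a i" "ap (restr b (succ m)) i = ap b i"
    if "i \<epsilon> succ m" for i
    using ap_restr[OF _ sub that] f by auto
  show ?thesis
    unfolding pos_A_def
    using func_restr[OF _ sub] f zero_less_succ[OF assms(2)] succ_less_succ[OF _ assms(2)] step less
    by (simp add: r del: succ_iff) (auto simp: r)
qed

lemma play_nested:
  assumes "play a b" "m \<epsilon> omega"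
  shows "nested m a b"
proof -
  have f: "func a omega R" "func b omega R" "app a zero = a0" "app b zero = b0"
    and step: "\<And>n. n \<epsilon> omega \<Longrightarrow> app a n \<prec> app a (succ n) \<and> app a (succ n) \<prec> app b (succ n) \<and>
      app b (succ n) \<prec> app b n"
    using assms(1) unfolding play_def by simp_all
  have app: "app a n = ap a n" "app b n = ap b n" if "n \<epsilon> omega" for n
    using func_app f that by auto
  \<comment> \<open>A play compares the two sequences at successors only; at 0 the comparison is
    \<open>a0_less_b0\<close>.\<close>
  have "app a m \<prec> app b m"
    using assms(2) by (rule omega_cases) (use step f a0_less_b0 in auto)
  then show ?thesis
    unfolding nested_def using f step omega_trans[OF _ assms(2)] assms(2)
    by (simp add: app[symmetric])
qed

context
  fixes mv :: "'v \<Rightarrow> 'v \<Rightarrow> 'v"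
  assumes D: "DefT (\<lambda>e. mv (e 0) (e (Suc 0)))"
    and between: "\<And>a b. a \<prec> b \<Longrightarrow> a \<prec> mv a b \<and> mv a b \<prec> b"
begin

lemma positional_A_move:
  assumes "m \<epsilon> omega"
  shows "fun_on (positional_A mv) omega"
    and "func (app (positional_A mv) m) (positions_A m) R"
    and "pos_A m a b \<Longrightarrow> app (app (positional_A mv) m) (opair a b) = mv (ap a m) (ap b m)"
proof -
  note [dfi] = DefT_subst2[where F = mv, OF D]
  have D1: "DefT (\<lambda>e. lam (positions_A (e 0)) (\<lambda>p. mv (ap (fst_of p) (e 0)) (ap (snd_of p) (e 0))))"
    by (intro dfi)
  have D2: "DefT (\<lambda>e. mv (ap (fst_of (e 0)) m) (ap (snd_of (e 0)) m))"
    by (intro dfi)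
  show f: "fun_on (positional_A mv) omega"
    unfolding positional_A_def by (rule fun_on_lam[OF D1])
  have eq: "app (positional_A mv) m = lam (positions_A m) (\<lambda>p. mv (ap (fst_of p) m) (ap (snd_of p) m))"
    using app_eq_ap[OF f assms] unfolding positional_A_def ap_lam[OF D1 assms] by simp
  show g: "func (app (positional_A mv) m) (positions_A m) R"
    unfolding eq
  proof (rule func_lam[OF D2])
    fix p assume "p \<epsilon> positions_A m"
    then obtain a b where p: "p = opair a b" "ap a m \<prec> ap b m"
      by (auto simp: pos_A_def)
    then show "mv (ap (fst_of p) m) (ap (snd_of p) m) \<epsilon> R"
      using between[OF p(2)] less_R_carrier by auto
  qed
  show "app (app (positional_A mv) m) (opair a b) = mv (ap a m) (ap b m)" if "pos_A m a b"
    using func_app[OF g, of "opair a b"] ap_lam[OF D2, of "opair a b" "positions_A m"] that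
    unfolding eq by auto
qed

lemma strategy_positional_A: "strategy_A (positional_A mv)"
  unfolding strategy_A_def
proof (intro conjI ballI allI impI)
  show "fun_on (positional_A mv) omega"
    using positional_A_move(1)[OF zero_omega] .
next
  fix m assume "m \<in> elts omega"
  then have m: "m \<epsilon> omega" by simp
  show "func (app (positional_A mv) m) (the_set (\<lambda>p. \<exists>a b. position_A m a b \<and> p = opair a b)) R"
    using positional_A_move(2)[OF m] by (simp add: positions_A_eq m)
  fix a b assume "position_A m a b"
  then have p: "pos_A m a b" using position_A_iff m by simp
  then have "ap a m \<prec> ap b m" "app a m = ap a m" "app b m = ap b m"
    using func_app[of _ "succ m" R m] unfolding pos_A_def by auto
  then show "app a m \<prec> app (app (positional_A mv) m) (opair a b)"
    and "app (app (positional_A mv) m) (opair a b) \<prec> app b m"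
    using positional_A_move(3)[OF m p] between by auto
qed

lemma consistent_positional_A:
  assumes "play a b" "consistent_A (positional_A mv) a b" "m \<epsilon> omega"
  shows "ap a (succ m) = mv (ap a m) (ap b m)"
proof -
  have f: "func a omega R" "func b omega R" using assms(1) unfolding play_def by auto
  have sub: "elts (succ m) \<subseteq> elts omega" using assms by simp
  have "app a (succ m) = app (app (positional_A mv) m) (opair (restr a (succ m)) (restr b (succ m)))"
    using assms(2,3) unfolding consistent_A_def by simp
  also have "\<dots> = mv (ap (restr a (succ m)) m) (ap (restr b (succ m)) m)"
    by (rule positional_A_move(3)[OF assms(3) nested_pos_A[OF play_nested[OF assms(1,3)] assms(3)]])
  finally show ?thesis
    using func_app[OF f(1), of "succ m"] ap_restr[OF _ sub, of _ m] f assms(3) by simp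
qed

end

end

subsection \<open>Player A wins on the range of a perfect scheme\<close>

text \<open>
  \<open>B Y\<close> is the expansion produced when the opponent answers according to \<open>Y\<close>; the opponent decides
  exactly the bits in \<open>T Y\<close>.
\<close>

locale perfect_scheme = zf_cantor +
  fixes T B :: "'a \<Rightarrow> 'a" and S :: 'a
  assumes DT: "DefT (\<lambda>e. T (e 0))" and DB: "DefT (\<lambda>e. B (e 0))"
    and T_omega: "i \<epsilon> T Y \<Longrightarrow> i \<epsilon> omega"
    and B_T: "i \<epsilon> T Y \<Longrightarrow> i \<epsilon> B Y \<longleftrightarrow> i \<epsilon> Y"
    and T_cong: "i \<epsilon> omega \<Longrightarrow> (\<And>j. j \<epsilon> i \<Longrightarrow> j \<epsilon> Y \<longleftrightarrow> j \<epsilon> Y') \<Longrightarrow> i \<epsilon> T Y \<longleftrightarrow> i \<epsilon> T Y'"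
    and B_cong: "i \<epsilon> omega \<Longrightarrow> (\<And>j. j \<epsilon> i \<Longrightarrow> j \<epsilon> Y \<longleftrightarrow> j \<epsilon> Y') \<Longrightarrow> \<not> i \<epsilon> T Y \<Longrightarrow>
      i \<epsilon> B Y \<longleftrightarrow> i \<epsilon> B Y'"
    and T_unbounded: "n \<epsilon> omega \<Longrightarrow> \<exists>i. i \<epsilon> T Y \<and> n \<epsilon> i"
    and S: "expands (B Y) x \<Longrightarrow> x \<epsilon> S"
begin

section \<open>Finite answer sets and the order of their outcomes\<close>

lemmas [dfi] = DefT_subst1[where F = T, OF DT] DefT_subst1[where F = B, OF DB]

text \<open>Passed bits copy \<open>Y\<close> and the other bits look at smaller positions only, so
  agreement of the answer sets below k carries over to the expansions.\<close>

lemma B_cong_below: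
  assumes "k \<epsilon> omega" "\<And>j. j \<epsilon> k \<Longrightarrow> j \<epsilon> Y \<longleftrightarrow> j \<epsilon> Y'" "i \<epsilon> k"
  shows "i \<epsilon> B Y \<longleftrightarrow> i \<epsilon> B Y'"
proof -
  have i: "i \<epsilon> omega" "\<And>j. j \<epsilon> i \<Longrightarrow> j \<epsilon> Y \<longleftrightarrow> j \<epsilon> Y'"
    using omega_trans less_trans assms by blast+
  have "i \<epsilon> T Y \<longleftrightarrow> i \<epsilon> T Y'" by (rule T_cong[OF i])
  then show ?thesis
    using B_T B_cong[OF i] assms(2,3) by blast
qed

text \<open>The finite sets of passed positions. An element outside \<open>T Y\<close> could leave
  the outcome unchanged, and then the outcome would not determine \<open>Y\<close>.\<close>

definition bounded :: "'a \<Rightarrow> bool"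
  where "bounded Y \<longleftrightarrow> elts Y \<subseteq> elts (T Y) \<and> (\<exists>n\<in>elts omega. elts Y \<subseteq> elts n)"

lemma Def_bounded [dfi]: "DefT t \<Longrightarrow> Def (\<lambda>e. bounded (t e))"
  by (rule Def_subst1[where P = bounded]) (unfold bounded_def, intro dfi)

text \<open>Beyond a finite \<open>Y\<close> there are passed positions that are answered with 0;
  they supply the zeros on which strictness of the order depends.\<close>

lemma T_beyond:
  assumes "bounded Y" "k \<epsilon> omega"
  obtains j where "j \<epsilon> omega" "k \<epsilon> j" "j \<epsilon> T Y" "elts Y \<subseteq> elts j"
proof -
  obtain n where n: "n \<epsilon> omega" "elts Y \<subseteq> elts n"
    using assms(1) unfolding bounded_def by auto
  obtain m where m: "m \<epsilon> omega" "n \<epsilon> succ m" "k \<epsilon> succ m"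
    using max_exists n(1) assms(2) by blast
  obtain j where j: "j \<epsilon> T Y" "m \<epsilon> j" using T_unbounded[OF m(1)] by blast
  then have j': "j \<epsilon> omega" using T_omega by blast
  moreover from this have "n \<epsilon> j" "k \<epsilon> j"
    using m(2,3) j(2) j' less_trans[of _ m j] by auto
  moreover from this have "elts n \<subseteq> elts j"
    using elts_less_subset[of n j] j' by simp
  ultimately show ?thesis
    using that j(1) n(2) by blast
qed

definition rho :: "'a \<Rightarrow> 'a"
  where "rho Y = the1 (expands (B Y))"

lemma rho: "expands (B Y) (rho Y)"
  unfolding rho_def by (rule the1I) (use expands_exists expands_unique in blast)

lemma DefT_rho [dfi]: "DefT t \<Longrightarrow> DefT (\<lambda>e. rho (t e))"
  by (rule DefT_subst1[where F = rho]) (unfold rho_def, intro dfi)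

lemma rho_R [simp]: "rho Y \<epsilon> R"
  using rho expandsD(1) by blast

text \<open>By causality the first difference k is passed in both runs, so the expansions first
  differ there. A later passed position outside the finite \<open>Y\<close> is a zero of
  \<open>B Y\<close>, as \<open>expands_less\<close> demands.\<close>

lemma rho_less:
  assumes Y: "bounded Y" "bounded Y'"
    and k: "k \<epsilon> omega" "\<And>j. j \<epsilon> k \<Longrightarrow> j \<epsilon> Y \<longleftrightarrow> j \<epsilon> Y'" "\<not> k \<epsilon> Y" "k \<epsilon> Y'"
  shows "rho Y \<prec> rho Y'"
proof -
  have "k \<epsilon> T Y'" using Y(2) k unfolding bounded_def by auto
  then have "k \<epsilon> B Y'" "\<not> k \<epsilon> B Y"
    using T_cong[OF k(1,2)] B_T k by auto
  moreover obtain j where j: "j \<epsilon> omega" "k \<epsilon> j" "j \<epsilon> T Y" "elts Y \<subseteq> elts j"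
    using T_beyond Y(1) k(1) by blast
  moreover have "\<not> j \<epsilon> B Y"
    using B_T j by auto
  ultimately show ?thesis
    using expands_less[OF rho rho k(1)] B_cong_below[OF k(1,2)] by blast
qed

lemma rho_inject:
  assumes Y: "bounded Y" "bounded Y'" and eq: "rho Y = rho Y'"
  shows "Y = Y'"
proof (rule ccontr)
  assume "Y \<noteq> Y'"
  then obtain n where n: "\<not> (n \<epsilon> Y \<longleftrightarrow> n \<epsilon> Y')" using ext by blast
  moreover from this have "n \<epsilon> omega"
    using Y T_omega unfolding bounded_def by auto
  moreover have "Def (\<lambda>e. \<not> (e 0 \<epsilon> Y \<longleftrightarrow> e 0 \<epsilon> Y'))" by (intro dfi)
  ultimately obtain k where k: "k \<epsilon> omega" "\<not> (k \<epsilon> Y \<longleftrightarrow> k \<epsilon> Y')"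
    "\<And>j. j \<epsilon> k \<Longrightarrow> \<not> \<not> (j \<epsilon> Y \<longleftrightarrow> j \<epsilon> Y')"
    by (rule omega_least[where P = "\<lambda>n. \<not> (n \<epsilon> Y \<longleftrightarrow> n \<epsilon> Y')"]) blast
  then have "rho Y \<prec> rho Y' \<or> rho Y' \<prec> rho Y"
    using rho_less[OF Y, of k] rho_less[OF Y(2,1), of k] by blast
  with eq show False by simp
qed

section \<open>The next move of player A\<close>

definition idx :: "'a \<Rightarrow> 'a \<Rightarrow> 'a"
  where "idx Y b = the1 (\<lambda>i. (i \<epsilon> T Y \<and> elts Y \<subseteq> elts i \<and> rgt (B Y) i \<prec> b) \<and>
    (\<forall>j\<in>elts i. \<not> (j \<epsilon> T Y \<and> elts Y \<subseteq> elts j \<and> rgt (B Y) j \<prec> b)))"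

lemma DefT_idx [dfi]: "DefT s \<Longrightarrow> DefT t \<Longrightarrow> DefT (\<lambda>e. idx (s e) (t e))"
  by (rule DefT_subst2[where F = idx]) (unfold idx_def, intro dfi)

text \<open>The right ends around \<open>rho Y\<close> eventually fall below b, and passed positions
  are unbounded. The least suitable one is taken because it is definable without choice.\<close>

lemma idx:
  assumes "bounded Y" "rho Y \<prec> b"
  shows "idx Y b \<epsilon> T Y" "elts Y \<subseteq> elts (idx Y b)" "rgt (B Y) (idx Y b) \<prec> b"
proof -
  define P where "P i \<longleftrightarrow> i \<epsilon> T Y \<and> elts Y \<subseteq> elts i \<and> rgt (B Y) i \<prec> b" for i
  obtain m where m: "m \<epsilon> omega" "rgt (B Y) m \<prec> b"
    using expands_rgt_less[OF rho assms(2)] by blast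
  obtain i where i: "i \<epsilon> omega" "m \<epsilon> i" "i \<epsilon> T Y" "elts Y \<subseteq> elts i"
    using T_beyond assms(1) m(1) by blast
  have "P i"
    using i m rgt_mono[of m i "B Y"] le_less_R_trans unfolding P_def by auto
  moreover have D: "Def (\<lambda>e. P (e 0))"
    unfolding P_def by (intro dfi)
  ultimately obtain k where k: "k \<epsilon> omega" "P k" "\<And>j. j \<epsilon> k \<Longrightarrow> \<not> P j"
    using omega_least[of P i] i(1) by blast
  have "P (the1 (\<lambda>i. P i \<and> (\<forall>j\<in>elts i. \<not> P j))) \<and>
      (\<forall>j\<in>elts (the1 (\<lambda>i. P i \<and> (\<forall>j\<in>elts i. \<not> P j))). \<not> P j)"
  proof (rule the1I, rule ex1I)
    show "P k \<and> (\<forall>j\<in>elts k. \<not> P j)" using k by simp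
    fix i assume "P i \<and> (\<forall>j\<in>elts i. \<not> P j)"
    then show "i = k"
      using k omega_linear[of i k] T_omega unfolding P_def ball_elts by blast
  qed
  then have "P (idx Y b)"
    unfolding idx_def P_def by blast
  then show "idx Y b \<epsilon> T Y" "elts Y \<subseteq> elts (idx Y b)" "rgt (B Y) (idx Y b) \<prec> b"
    unfolding P_def by blast+
qed

definition nxt :: "'a \<Rightarrow> 'a \<Rightarrow> 'a"
  where "nxt Y b = un Y (upair (idx Y b) (idx Y b))"

lemma DefT_nxt [dfi]: "DefT s \<Longrightarrow> DefT t \<Longrightarrow> DefT (\<lambda>e. nxt (s e) (t e))"
  unfolding nxt_def by (intro dfi)

lemma nxt_iff [simp]: "j \<epsilon> nxt Y b \<longleftrightarrow> j \<epsilon> Y \<or> j = idx Y b"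
  unfolding nxt_def by auto

text \<open>Adding i = \<open>idx Y b\<close> leaves the bits below i alone, so the new outcome
  stays in the i-th interval, whose right end is below b. It exceeds the old outcome because a 0
  turns into a 1 at i.\<close>

lemma nxt:
  assumes Y: "bounded Y" "rho Y \<prec> b"
  shows "bounded (nxt Y b)" "rho Y \<prec> rho (nxt Y b)" "rho (nxt Y b) \<prec> b"
proof -
  define i where "i = idx Y b"
  have i: "i \<epsilon> T Y" "elts Y \<subseteq> elts i" "rgt (B Y) i \<prec> b" "i \<epsilon> omega"
    using idx[OF Y] T_omega unfolding i_def by auto
  have agree: "k \<epsilon> Y \<longleftrightarrow> k \<epsilon> nxt Y b" if "k \<epsilon> i" for k
    using that by (auto simp: i_def[symmetric])
  \<comment> \<open>Whether j is passed depends on answers below j only, so this is preserved even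
    for j = i.\<close>
  have "j \<epsilon> T (nxt Y b)" if "j \<epsilon> T Y" "j \<epsilon> succ i" for j
    using T_cong[of j Y "nxt Y b"] that agree less_le_trans[OF _ that(2) i(4)] T_omega by blast
  moreover have "j \<epsilon> T Y \<and> j \<epsilon> succ i" if "j \<epsilon> nxt Y b" for j
    using that i Y(1) unfolding bounded_def subset_iff by (auto simp: i_def[symmetric])
  ultimately show b: "bounded (nxt Y b)"
    unfolding bounded_def subset_iff using i(4) by (metis elts_iff succ_omega)
  show "rho Y \<prec> rho (nxt Y b)"
    by (rule rho_less[OF Y(1) b i(4)]) (use i agree in \<open>auto simp: i_def[symmetric]\<close>)
  have "rho (nxt Y b) \<preceq> rgt (B (nxt Y b)) i"
    using expandsD(3)[OF rho i(4)] .
  also have "\<dots> = rgt (B Y) i"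
    by (rule rgt_cong[OF i(4)]) (use B_cong_below[OF i(4) agree] in blast)
  finally show "rho (nxt Y b) \<prec> b"
    using i(3) le_less_R_trans by blast
qed

text \<open>If \<open>a\<close> is not of the form \<open>rho Y\<close>, this is the junk value of \<open>the1\<close>, the empty set.\<close>

definition recov :: "'a \<Rightarrow> 'a"
  where "recov a = the1 (\<lambda>Y. bounded Y \<and> rho Y = a)"

lemma DefT_recov [dfi]: "DefT t \<Longrightarrow> DefT (\<lambda>e. recov (t e))"
  by (rule DefT_subst1[where F = recov]) (unfold recov_def, intro dfi)

lemma recov_rho: "bounded Y \<Longrightarrow> recov (rho Y) = Y"
  unfolding recov_def by (rule the1_eqI) (auto intro: rho_inject)

lemma bounded_recov: "bounded (recov a)"
proof (cases "\<exists>Y. bounded Y \<and> rho Y = a")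
  case True
  then obtain Y where "bounded Y" "rho Y = a" by blast
  then show ?thesis using recov_rho[of Y] by simp
next
  case False
  then have "\<not> (\<exists>!Y. bounded Y \<and> rho Y = a)" by blast
  then have "recov a = zero" unfolding recov_def the1_def by (rule if_not_P)
  moreover have "elts zero = {}" by (auto simp: elts_def)
  then have "bounded zero"
    unfolding bounded_def bex_elts using zero_omega by blast
  ultimately show ?thesis by simp
qed

text \<open>The test makes the move legal in every interval. The midpoint is a fallback for
  intervals that do not arise when the strategy is followed.\<close>

definition mv :: "'a \<Rightarrow> 'a \<Rightarrow> 'a"
  where "mv a b = (if a \<prec> rho (nxt (recov a) b) \<and> rho (nxt (recov a) b) \<prec> b
    then rho (nxt (recov a) b) else hf (a \<boxplus> b))"

lemma DefT_mv: "DefT (\<lambda>e. mv (e 0) (e (Suc 0)))"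
  unfolding mv_def by (intro dfi)

lemma mv_between: "a \<prec> b \<Longrightarrow> a \<prec> mv a b \<and> mv a b \<prec> b"
  unfolding mv_def using midpoint by auto

section \<open>Plays against this strategy and their limits\<close>

context
  fixes a b x
  assumes play: "play a b" and consistent: "consistent_A (positional_A mv) a b"
    and limit: "limit_of a x"
begin

lemma play_func: "func a omega R" "func b omega R"
  using play unfolding play_def by auto

lemma play_zero: "ap a zero = a0" "ap b zero = b0"
  using play func_app[OF play_func(1)] func_app[OF play_func(2)] unfolding play_def by auto

lemma play_step:
  assumes "n \<epsilon> omega"
  shows "ap a n \<prec> ap a (succ n)" "ap a (succ n) \<prec> ap b (succ n)"
  using play func_app[OF play_func(1)] func_app[OF play_func(2)] assms unfolding play_def by auto

definition pos :: "'a \<Rightarrow> 'a" where "pos n = recov (ap a n)"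

definition add :: "'a \<Rightarrow> 'a" where "add n = idx (pos n) (ap b n)"

lemma DefT_pos [dfi]: "DefT t \<Longrightarrow> DefT (\<lambda>e. pos (t e))"
  unfolding pos_def by (intro dfi)

lemma DefT_add [dfi]: "DefT t \<Longrightarrow> DefT (\<lambda>e. add (t e))"
  unfolding add_def by (intro dfi)

lemma pos_move:
  assumes n: "n \<epsilon> omega" and le: "ap a n \<preceq> rho (pos n)" "rho (pos n) \<prec> ap b n"
  shows "ap a (succ n) = rho (nxt (pos n) (ap b n))" "pos (succ n) = nxt (pos n) (ap b n)"
proof -
  note nxt = nxt[OF bounded_recov[of "ap a n"], folded pos_def, OF le(2)]
  have "ap a n \<prec> rho (nxt (pos n) (ap b n))"
    using le_less_R_trans[OF le(1) nxt(2)] .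
  then have "mv (ap a n) (ap b n) = rho (nxt (pos n) (ap b n))"
    unfolding mv_def pos_def[symmetric] using nxt(3) by simp
  then show eq: "ap a (succ n) = rho (nxt (pos n) (ap b n))"
    using consistent_positional_A[OF DefT_mv mv_between play consistent n] by simp
  show "pos (succ n) = nxt (pos n) (ap b n)"
    using recov_rho[OF nxt(1)] unfolding pos_def[of "succ n"] eq by simp
qed

text \<open>At 0 only an inequality can be claimed: a0 need not be an outcome, and then
  \<open>recov\<close> supplies the empty set, whose outcome is at least a0.\<close>

lemma pos_between: "n \<epsilon> omega \<Longrightarrow> ap a n \<preceq> rho (pos n) \<and> rho (pos n) \<prec> ap b n"
proof (induct rule: omega_induct)
  case Def show ?case by (intro dfi)
next
  case zero
  \<comment> \<open>A passed position beyond the finite set is a zero of the expansion and keeps the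
    outcome below b0.\<close>
  obtain j where j: "j \<epsilon> omega" "j \<epsilon> T (pos zero)" "elts (pos zero) \<subseteq> elts j"
    using T_beyond[OF bounded_recov zero_omega] unfolding pos_def by blast
  then have "\<not> j \<epsilon> B (pos zero)" using B_T by auto
  then show ?case
    using expands_less_b0[OF rho j(1)] expands_bounds[OF rho] play_zero by simp
next
  case (succ n)
  then show ?case
    using pos_move[of n] play_step[of n] by simp
qed

lemma pos_succ: "n \<epsilon> omega \<Longrightarrow> j \<epsilon> pos (succ n) \<longleftrightarrow> j \<epsilon> pos n \<or> j = add n"
  using pos_move pos_between by (simp add: add_def)

lemma rho_pos: "n \<epsilon> omega \<Longrightarrow> rho (pos (succ n)) = ap a (succ n)"
  using pos_move pos_between by simp

lemma add_omega: "n \<epsilon> omega \<Longrightarrow> add n \<epsilon> omega"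
  and pos_add: "n \<epsilon> omega \<Longrightarrow> elts (pos n) \<subseteq> elts (add n)"
  using idx[of "pos n" "ap b n"] pos_between[of n] bounded_recov T_omega
  unfolding add_def pos_def by blast+

lemma pos_mono: "m \<epsilon> succ n \<Longrightarrow> n \<epsilon> omega \<Longrightarrow> j \<epsilon> pos m \<Longrightarrow> j \<epsilon> pos n"
proof -
  assume m: "m \<epsilon> succ n" and n: "n \<epsilon> omega" and j: "j \<epsilon> pos m"
  have "\<forall>m\<in>elts (succ n). elts (pos m) \<subseteq> elts (pos n)"
    using n
  proof (induct rule: omega_induct)
    case Def show ?case by (intro dfi)
  next
    case (succ n)
    then show ?case by (auto simp: subset_iff pos_succ)
  qed simp
  with m j show ?thesis by (auto simp: subset_iff)
qed

text \<open>The element added at index m already belongs to \<open>pos n\<close>, and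
  \<open>add n\<close> lies above all of \<open>pos n\<close>.\<close>

lemma add_mono: "m \<epsilon> n \<Longrightarrow> n \<epsilon> omega \<Longrightarrow> add m \<epsilon> add n"
  using pos_mono[of "succ m" n "add m"] succ_less_succ[of m n] pos_succ[of m "add m"] omega_trans pos_add[of n]
  by auto

text \<open>Whatever enters after \<open>pos n\<close> is at least \<open>add n\<close>, because the
  added elements increase; below \<open>add n\<close> the set is final.\<close>

lemma pos_stable:
  assumes "n \<epsilon> succ m" "m \<epsilon> omega" "j \<epsilon> pos m" "j \<epsilon> add n"
  shows "j \<epsilon> pos n"
proof -
  have "\<forall>n\<in>elts (succ m). \<forall>j\<in>elts (pos m). j \<epsilon> add n \<longrightarrow> j \<epsilon> pos n"
    using assms(2)
  proof (induct rule: omega_induct)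
    case Def show ?case by (intro dfi)
  next
    case (succ m)
    have "j \<epsilon> pos n" if n: "n \<epsilon> succ m" and j: "j \<epsilon> pos (succ m)" "j \<epsilon> add n" for n j
    proof -
      have "\<not> add m \<epsilon> add n"
        using n add_mono[of n m] succ(1) mem_asym by auto
      then have "j \<epsilon> pos m" using j succ(1) by (auto simp: pos_succ)
      then show ?thesis using succ(2) n j by auto
    qed
    then show ?case by auto
  qed simp
  with assms show ?thesis by auto
qed

text \<open>A strictly increasing sequence of numbers dominates its index. Thus the agreement of
  \<open>pos n\<close> with the union below \<open>add n\<close> eventually covers every
  bit.\<close>

lemma le_add: "n \<epsilon> omega \<Longrightarrow> n \<epsilon> succ (add n)"
proof (induct rule: omega_induct)
  case Def show ?case by (intro dfi)
next
  case zero show ?case using zero_less_succ add_omega by simp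
next
  case (succ n)
  have "succ n \<epsilon> succ (succ (add n))"
    using succ_less_succ[OF succ(2)] add_omega succ(1) by simp
  moreover have "succ (add n) \<epsilon> succ (add (succ n))"
    using succ_less_succ[OF add_mono[of n "succ n"]] add_omega succ(1) by simp
  ultimately show ?case
    using less_trans[of "succ n" "succ (add n)" "succ (add (succ n))"] add_omega[of "succ n"] succ(1) by auto
qed

definition pos_lim :: 'a
  where "pos_lim = sep omega (\<lambda>j. \<exists>n\<in>elts omega. j \<epsilon> pos n)"

lemma pos_lim_agree:
  assumes "n \<epsilon> omega" "j \<epsilon> add n"
  shows "j \<epsilon> pos_lim \<longleftrightarrow> j \<epsilon> pos n"
proof -
  have D: "Def (\<lambda>e. \<exists>n\<in>elts omega. e 0 \<epsilon> pos n)" by (intro dfi)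
  have "j \<epsilon> pos n" if "m \<epsilon> omega" "j \<epsilon> pos m" for m
    using omega_linear[OF assms(1) that(1)] pos_stable[of n m j] pos_mono[of m n j] that assms by auto
  then show ?thesis
    unfolding pos_lim_def sep_iff[OF D] using assms omega_trans[OF assms(2)] add_omega by auto
qed

lemma lft_rgt_pos_lim:
  assumes "n \<epsilon> omega"
  shows "lft (B pos_lim) (add n) = lft (B (pos n)) (add n)" "rgt (B pos_lim) (add n) = rgt (B (pos n)) (add n)"
  using lft_cong rgt_cong B_cong_below[OF add_omega[OF assms] pos_lim_agree[OF assms]] add_omega[OF assms]
  by blast+

lemma a_mono: "m \<epsilon> succ n \<Longrightarrow> n \<epsilon> omega \<Longrightarrow> ap a m \<preceq> ap a n"
  using seq_mono play_step(1) less_imp_le_R by blast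

text \<open>Up to \<open>add n\<close> the union and \<open>pos n\<close> give the same intervals,
  and these contain \<open>rho (pos n)\<close>, which is \<open>ap a n\<close> for positive n. Since
  the intervals are closed, the limit inherits the bounds.\<close>

lemma expands_limit: "expands (B pos_lim) x"
  unfolding expands_def
proof (intro conjI ballI)
  show "x \<epsilon> R" using limit unfolding limit_of_def by simp
next
  fix i assume "i \<in> elts omega"
  then have i: "i \<epsilon> omega" by simp
  have below: "i \<epsilon> succ (add (succ n))" if "n \<epsilon> omega" "i \<epsilon> succ n" for n
    using less_le_trans[OF that(2) le_add[of "succ n"] add_omega[of "succ n"]] that by simp
  \<comment> \<open>The successor matters: \<open>rho (pos n)\<close> is known to equal
    \<open>ap a n\<close> only for positive n.\<close>
  have "lft (B pos_lim) i \<preceq> lft (B pos_lim) (add (succ i))"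
    using lft_mono[OF below[OF i]] add_omega i by simp
  also have "\<dots> \<preceq> rho (pos (succ i))"
    using lft_rgt_pos_lim expandsD(2)[OF rho] add_omega i by simp
  also have "\<dots> = ap a (succ i)"
    using rho_pos i by simp
  also have "\<dots> \<preceq> x"
    by (rule limit_ge[OF limit play_func(1), of _ "succ i"]) (use i a_mono play_func in auto)
  finally show "lft (B pos_lim) i \<preceq> x" .
  show "x \<preceq> rgt (B pos_lim) i"
  proof (rule limit_le[OF limit play_func(1)])
    fix m assume m: "m \<epsilon> omega"
    obtain n where n: "n \<epsilon> omega" "m \<epsilon> succ n" "i \<epsilon> succ n"
      using max_exists m i by blast
    have "ap a m \<preceq> ap a (succ n)"
      using a_mono[of m "succ n"] n by auto
    also have "\<dots> = rho (pos (succ n))"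
      using rho_pos n by simp
    also have "\<dots> \<preceq> rgt (B pos_lim) (add (succ n))"
      using lft_rgt_pos_lim expandsD(3)[OF rho] add_omega n by simp
    also have "\<dots> \<preceq> rgt (B pos_lim) i"
      using rgt_mono[OF below] n add_omega by simp
    finally show "ap a m \<preceq> rgt (B pos_lim) i" .
  qed (use i in simp)
qed

end

theorem A_wins: "A_has_winning_strategy S"
  unfolding A_has_winning_strategy_def winning_A_def
proof (intro exI conjI subsetI)
  show "strategy_A (positional_A mv)"
    by (rule strategy_positional_A[OF DefT_mv mv_between])
  show "x \<in> elts S" if "x \<in> limit_set_A (positional_A mv)" for x
    using that S[OF expands_limit] unfolding limit_set_A_def by auto
qed

end

context zf_cantor
begin

subsection \<open>The perfect set game\<close>

abbreviation one :: 'v where "one \<equiv> succ zero"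
abbreviation two :: 'v where "two \<equiv> succ one"

text \<open>
  At round \<open>i\<close> the first player either plays the bit \<open>i\<close> of an expansion or passes the choice of this
  bit to the second player, whose move \<open>0\<close> means the bit \<open>0\<close> and any other move the bit \<open>1\<close>. The
  first player must pass infinitely often.
\<close>

definition passes :: "'v \<Rightarrow> 'v \<Rightarrow> bool"
  where "passes x i \<longleftrightarrow> ap x i \<noteq> zero \<and> ap x i \<noteq> one"

definition bits :: "'v \<Rightarrow> 'v \<Rightarrow> 'v"
  where "bits x y = sep omega (\<lambda>i. ap x i = one \<or> passes x i \<and> ap y i \<noteq> zero)"

definition perfect_game :: "'v \<Rightarrow> 'v \<Rightarrow> 'v \<Rightarrow> bool"
  where "perfect_game S x y \<longleftrightarrow> (\<forall>n\<in>elts omega. \<exists>i\<in>elts omega. n \<epsilon> i \<and> passes x i) \<and>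
    (\<exists>s\<in>elts S. expands (bits x y) s)"

lemma Def_passes [dfi]: "DefT s \<Longrightarrow> DefT t \<Longrightarrow> Def (\<lambda>e. passes (s e) (t e))"
  unfolding passes_def by (intro dfi)

lemma DefT_bits [dfi]: "DefT s \<Longrightarrow> DefT t \<Longrightarrow> DefT (\<lambda>e. bits (s e) (t e))"
  by (rule DefT_subst2[where F = bits]) (unfold bits_def, intro dfi)

lemma Def_perfect_game: "Def (\<lambda>e. perfect_game S (e 0) (e (Suc 0)))"
  unfolding perfect_game_def by (intro dfi)

lemma bits_iff: "i \<epsilon> bits x y \<longleftrightarrow> i \<epsilon> omega \<and> (ap x i = one \<or> passes x i \<and> ap y i \<noteq> zero)"
  unfolding bits_def by (subst sep_iff) (intro dfi, simp)

definition chi :: "'v \<Rightarrow> 'v"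
  where "chi Y = lam omega (\<lambda>i. if i \<epsilon> Y then one else zero)"

lemma DefT_chi [dfi]: "DefT t \<Longrightarrow> DefT (\<lambda>e. chi (t e))"
  by (rule DefT_subst1[where F = chi]) (unfold chi_def, intro dfi)

lemma func_chi: "func (chi Y) omega omega"
  unfolding chi_def by (rule func_lam) (intro dfi, simp)

lemma ap_chi: "i \<epsilon> omega \<Longrightarrow> ap (chi Y) i = (if i \<epsilon> Y then one else zero)"
  unfolding chi_def by (rule ap_lam) (intro dfi)

text \<open>Answering with the characteristic function of Y turns the passed positions into the
  branching points of a perfect scheme. Winning says that they are unbounded and that the outcome
  lies in \<open>S\<close>.\<close>

lemma A_wins_if_first_wins:
  assumes F: "DefT (\<lambda>e. F (e 0))"
    and cong: "\<And>y y' i. func y omega omega \<Longrightarrow> func y' omega omega \<Longrightarrow> i \<epsilon> omega \<Longrightarrow>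
      (\<And>j. j \<epsilon> i \<Longrightarrow> ap y j = ap y' j) \<Longrightarrow> ap (F y) i = ap (F y') i"
    and wins: "\<And>y. func y omega omega \<Longrightarrow> perfect_game S (F y) y"
  shows "A_has_winning_strategy S"
proof -
  note [dfi] = DefT_subst1[where F = F, OF F]
  define T where "T Y = sep omega (\<lambda>i. passes (F (chi Y)) i)" for Y
  define B where "B Y = bits (F (chi Y)) (chi Y)" for Y
  have T: "i \<epsilon> T Y \<longleftrightarrow> i \<epsilon> omega \<and> passes (F (chi Y)) i" for i Y
    unfolding T_def by (subst sep_iff) (intro dfi, simp)
  have F_cong: "ap (F (chi Y)) i = ap (F (chi Y')) i"
    if "i \<epsilon> omega" "\<And>j. j \<epsilon> i \<Longrightarrow> j \<epsilon> Y \<longleftrightarrow> j \<epsilon> Y'" for Y Y' i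
    by (rule cong[OF func_chi func_chi that(1)])
       (use that omega_trans[OF _ that(1)] in \<open>simp add: ap_chi\<close>)
  interpret perfect_scheme mem R addR multR ltR a0 b0 T B S
  proof
    show "DefT (\<lambda>e. T (e 0))" unfolding T_def by (intro dfi)
    show "DefT (\<lambda>e. B (e 0))" unfolding B_def by (intro dfi)
    show "i \<epsilon> omega" if "i \<epsilon> T Y" for i Y using that T by simp
    show "i \<epsilon> B Y \<longleftrightarrow> i \<epsilon> Y" if "i \<epsilon> T Y" for i Y
      using that unfolding B_def by (auto simp: T bits_iff ap_chi passes_def)
    show "i \<epsilon> T Y \<longleftrightarrow> i \<epsilon> T Y'" if "i \<epsilon> omega" "\<And>j. j \<epsilon> i \<Longrightarrow> j \<epsilon> Y \<longleftrightarrow> j \<epsilon> Y'" for i Y Y'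
      using F_cong[OF that] by (simp add: T passes_def)
    show "i \<epsilon> B Y \<longleftrightarrow> i \<epsilon> B Y'"
      if "i \<epsilon> omega" "\<And>j. j \<epsilon> i \<Longrightarrow> j \<epsilon> Y \<longleftrightarrow> j \<epsilon> Y'" "\<not> i \<epsilon> T Y" for i Y Y'
      using F_cong[OF that(1,2)] that(1,3) unfolding B_def by (auto simp: T bits_iff passes_def)
    show "\<exists>i. i \<epsilon> T Y \<and> n \<epsilon> i" if "n \<epsilon> omega" for n Y
      using wins[OF func_chi[of Y]] that unfolding perfect_game_def by (auto simp: T)
    show "x \<epsilon> S" if "expands (B Y) x" for x Y
    proof -
      obtain s where "s \<epsilon> S" "expands (B Y) s"
        using wins[OF func_chi[of Y]] unfolding perfect_game_def B_def by auto
      then show ?thesis using that expands_unique by blast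
    qed
  qed
  show ?thesis by (rule A_wins)
qed

subsection \<open>Codes of finite binary sequences\<close>

text \<open>Heap numbering of binary words: entry n numbers the word of the first n bits, appending
  1 sends a number c to 2c + 1 and appending 0 sends it to 2c + 2. Words of different lengths get
  different numbers.\<close>

definition codes :: "'v \<Rightarrow> 'v \<Rightarrow> bool"
  where "codes c z \<longleftrightarrow> func c omega omega \<and> ap c zero = zero \<and>
    (\<forall>n\<in>elts omega. ap c (succ n) =
      (if n \<epsilon> z then succ (ap dbl (ap c n)) else succ (succ (ap dbl (ap c n)))))"

lemma Def_codes [dfi]: "DefT s \<Longrightarrow> DefT t \<Longrightarrow> Def (\<lambda>e. codes (s e) (t e))"
  by (rule Def_subst2[where P = codes]) (unfold codes_def, intro dfi)

lemma codes_exists: "\<exists>c. codes c z"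
proof -
  have D: "DefT (\<lambda>e. if e 0 \<epsilon> z then succ (ap dbl (e (Suc 0))) else succ (succ (ap dbl (e (Suc 0)))))"
    by (intro dfi)
  show ?thesis
    by (rule omega_recursion[where A = omega and a = zero, OF D]) (auto simp: codes_def)
qed

text \<open>Parity of a positive code reveals the last bit, and halving then reveals the code of the
  shorter word; only the empty word has code 0.\<close>

lemma codes_inject:
  assumes c: "codes c z" "codes c' z'" and "i \<epsilon> omega" "i' \<epsilon> omega" "ap c i = ap c' i'"
  shows "i = i' \<and> (\<forall>j\<in>elts i. j \<epsilon> z \<longleftrightarrow> j \<epsilon> z')"
proof -
  have cz: "ap c zero = zero" "ap c' zero = zero"
    and omega: "\<And>n. n \<epsilon> omega \<Longrightarrow> ap c n \<epsilon> omega" "\<And>n. n \<epsilon> omega \<Longrightarrow> ap c' n \<epsilon> omega"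
    and cs: "\<And>n. n \<epsilon> omega \<Longrightarrow> ap c (succ n) =
        (if n \<epsilon> z then succ (ap dbl (ap c n)) else succ (succ (ap dbl (ap c n))))"
      "\<And>n. n \<epsilon> omega \<Longrightarrow> ap c' (succ n) =
        (if n \<epsilon> z' then succ (ap dbl (ap c' n)) else succ (succ (ap dbl (ap c' n))))"
    using c unfolding codes_def by auto
  have "\<forall>i'. i' \<epsilon> omega \<longrightarrow> ap c i = ap c' i' \<longrightarrow> i = i' \<and> (\<forall>j\<in>elts i. j \<epsilon> z \<longleftrightarrow> j \<epsilon> z')"
    using \<open>i \<epsilon> omega\<close>
  proof (induct rule: omega_induct)
    case Def show ?case by (intro dfi)
  next
    case zero
    have "zero = i'" if "i' \<epsilon> omega" "ap c zero = ap c' i'" for i'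
      using that(1) by (rule omega_cases) (use that(2) cs cz in \<open>auto split: if_splits\<close>)
    then show ?case by auto
  next
    case (succ i)
    show ?case
    proof (intro allI impI)
      fix i' assume i': "i' \<epsilon> omega" "ap c (succ i) = ap c' i'"
      have "i' \<noteq> zero"
        using i'(2) cs(1)[OF succ(1)] cz(2) by (auto split: if_splits)
      then obtain k where k: "k \<epsilon> omega" "i' = succ k"
        using omega_cases[OF i'(1)] by metis
      note neq = dbl_neq_succ_dbl[OF omega(1)[OF succ(1)] omega(2)[OF k(1)]]
        dbl_neq_succ_dbl[OF omega(2)[OF k(1)] omega(1)[OF succ(1)]]
      have "i \<epsilon> z \<longleftrightarrow> k \<epsilon> z'" "ap dbl (ap c i) = ap dbl (ap c' k)"
        using i'(2) cs(1)[OF succ(1)] cs(2)[OF k(1)] neq unfolding k(2)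
        by (auto split: if_splits)
      moreover from this have "ap c i = ap c' k"
        using dbl_inject omega succ(1) k(1) by blast
      ultimately show "succ i = i' \<and> (\<forall>j\<in>elts (succ i). j \<epsilon> z \<longleftrightarrow> j \<epsilon> z')"
        using succ(2) k by auto
    qed
  qed
  with assms show ?thesis by blast
qed

subsection \<open>A winning strategy of the second player makes the target countable\<close>

text \<open>Every value other than 0 and 1 counts as a pass; 2 is the representative used
  here.\<close>

definition mixed :: "'v \<Rightarrow> 'v \<Rightarrow> 'v"
  where "mixed Q z = lam omega (\<lambda>k. if k \<epsilon> Q then two else if k \<epsilon> z then one else zero)"

lemma DefT_mixed [dfi]: "DefT s \<Longrightarrow> DefT t \<Longrightarrow> DefT (\<lambda>e. mixed (s e) (t e))"
  by (rule DefT_subst2[where F = mixed]) (unfold mixed_def, intro dfi)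

lemma func_mixed: "func (mixed Q z) omega omega"
  unfolding mixed_def by (rule func_lam) (intro dfi, simp)

lemma ap_mixed: "k \<epsilon> omega \<Longrightarrow> ap (mixed Q z) k = (if k \<epsilon> Q then two else if k \<epsilon> z then one else zero)"
  unfolding mixed_def by (rule ap_lam) (intro dfi)

lemma countable_if_second_wins:
  assumes G: "DefT (\<lambda>e. G (e 0))"
    and cong: "\<And>x x' i. func x omega omega \<Longrightarrow> func x' omega omega \<Longrightarrow> i \<epsilon> omega \<Longrightarrow>
        (\<And>j. j \<epsilon> succ i \<Longrightarrow> ap x j = ap x' j) \<Longrightarrow> ap (G x) i = ap (G x') i"
    and wins: "\<And>x. func x omega omega \<Longrightarrow> \<not> perfect_game S x (G x)"
    and S: "elts S \<subseteq> closed_interval a0 b0"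
  shows "countable_set S"
proof -
  note [dfi] = DefT_subst1[where F = G, OF G]
  \<comment> \<open>The bit answered to a pass at k, after passes at the positions in
    \<open>Q\<close> below k and bits of \<open>z\<close> elsewhere. By causality \<open>Q\<close>
    and \<open>z\<close> matter only below k.\<close>
  define resp where "resp Q z k \<longleftrightarrow> ap (G (mixed (un Q (upair k k)) z)) k \<noteq> zero" for Q z k
  define greedy where "greedy Q z \<longleftrightarrow> elts Q \<subseteq> elts omega \<and>
    (\<forall>k\<in>elts omega. k \<epsilon> Q \<longleftrightarrow> (resp Q z k \<longleftrightarrow> k \<epsilon> z))" for Q z
  have [dfi]: "Def (\<lambda>e. greedy (s e) (t e))" if "DefT s" "DefT t" for s t
    by (rule Def_subst2[where P = greedy, OF _ that]) (unfold greedy_def resp_def, intro dfi)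
  have resp_cong: "resp Q z k \<longleftrightarrow> resp Q' z' k"
    if "k \<epsilon> omega" "\<And>j. j \<epsilon> k \<Longrightarrow> j \<epsilon> Q \<longleftrightarrow> j \<epsilon> Q'" "\<And>j. j \<epsilon> k \<Longrightarrow> j \<epsilon> z \<longleftrightarrow> j \<epsilon> z'" for Q Q' z z' k
  proof -
    have "ap (G (mixed (un Q (upair k k)) z)) k = ap (G (mixed (un Q' (upair k k)) z')) k"
      by (rule cong[OF func_mixed func_mixed that(1)])
         (use that omega_trans[OF _ that(1)] in \<open>auto simp: ap_mixed\<close>)
    then show ?thesis unfolding resp_def by simp
  qed
  have greedy_exists: "\<exists>Q. greedy Q z" for z
  proof -
    have D: "Def (\<lambda>e. resp (e (Suc 0)) z (e 0) \<longleftrightarrow> e 0 \<epsilon> z)"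
      unfolding resp_def by (intro dfi)
    show ?thesis
    proof (rule causal_subset[OF D])
      fix n X Y assume n: "n \<epsilon> omega" and eq: "\<And>k. k \<epsilon> n \<Longrightarrow> k \<epsilon> X \<longleftrightarrow> k \<epsilon> Y"
      have "resp X z n \<longleftrightarrow> resp Y z n" by (rule resp_cong[OF n eq]) simp_all
      then show "(resp X z n \<longleftrightarrow> n \<epsilon> z) \<longleftrightarrow> (resp Y z n \<longleftrightarrow> n \<epsilon> z)" by simp
    next
      fix Q assume "elts Q \<subseteq> elts omega" "\<And>n. n \<epsilon> omega \<Longrightarrow> n \<epsilon> Q \<longleftrightarrow> (resp Q z n \<longleftrightarrow> n \<epsilon> z)"
      then show ?thesis unfolding greedy_def ball_elts by blast
    qed
  qed
  \<comment> \<open>The greedy run produces \<open>z\<close> at played and passed positions alike,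
    so with unboundedly many passes the first player would win.\<close>
  have greedy_bounded: "\<exists>i\<in>elts omega. elts Q \<subseteq> elts i"
    if "greedy Q z" "elts z \<subseteq> elts omega" "expands z s" "s \<epsilon> S" for Q z s
  proof -
    define x where "x = mixed Q z"
    have passes: "passes x i \<longleftrightarrow> i \<epsilon> Q" if "i \<epsilon> omega" for i
      unfolding passes_def x_def by (simp add: ap_mixed that)
    have "bits x (G x) = z"
    proof (rule ext)
      fix k
      show "k \<epsilon> bits x (G x) \<longleftrightarrow> k \<epsilon> z"
      proof (cases "k \<epsilon> omega")
        case True
        \<comment> \<open>For k in \<open>Q\<close> the hypothetical pass considered by
          \<open>resp\<close> is the one actually made.\<close>
        have "k \<epsilon> Q \<Longrightarrow> un Q (upair k k) = Q" by (intro ext) auto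
        then have "k \<epsilon> Q \<Longrightarrow> ap (G x) k \<noteq> zero \<longleftrightarrow> k \<epsilon> z"
          using \<open>greedy Q z\<close> True unfolding greedy_def resp_def x_def by auto
        then show ?thesis
          using passes[OF True] True by (auto simp: bits_iff x_def ap_mixed split: if_splits)
      next
        case False
        then show ?thesis using that(2) by (auto simp: bits_iff subset_iff)
      qed
    qed
    then obtain n where n: "n \<epsilon> omega" "\<And>i. i \<epsilon> omega \<Longrightarrow> n \<epsilon> i \<Longrightarrow> \<not> passes x i"
      using wins[OF func_mixed[of Q z]] \<open>expands z s\<close> \<open>s \<epsilon> S\<close> unfolding perfect_game_def x_def[symmetric] by auto
    have "i \<epsilon> succ n" if "i \<epsilon> Q" for i
    proof -
      have "i \<epsilon> omega" using \<open>greedy Q z\<close> that unfolding greedy_def by auto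
      with n that passes[OF this] omega_linear[of i n] show ?thesis by auto
    qed
    then show ?thesis using n(1) by (intro bexI[of _ "succ n"]) auto
  qed
  \<comment> \<open>A key codes the first i bits of \<open>z\<close>, where i bounds
    \<open>Q\<close>. Neither the expansion nor i is canonical, so s may have many keys;
    \<open>num\<close> takes the least.\<close>
  define key where "key s d \<longleftrightarrow> (\<exists>z Q i c. expands z s \<and> elts z \<subseteq> elts omega \<and> greedy Q z \<and>
    i \<epsilon> omega \<and> elts Q \<subseteq> elts i \<and> codes c z \<and> d = ap c i)" for s d
  have key_exists: "\<exists>d. d \<epsilon> omega \<and> key s d" if "s \<epsilon> S" for s
  proof -
    obtain z where z: "elts z \<subseteq> elts omega" "expands z s"
      using expansion_exists[of s] S \<open>s \<epsilon> S\<close> unfolding closed_interval_def by (auto simp: subset_iff)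
    obtain Q where Q: "greedy Q z" using greedy_exists by blast
    obtain i where i: "i \<epsilon> omega" "elts Q \<subseteq> elts i" using greedy_bounded[OF Q z \<open>s \<epsilon> S\<close>] by auto
    obtain c where c: "codes c z" using codes_exists by blast
    then have "ap c i \<epsilon> omega" using i unfolding codes_def by auto
    then show ?thesis using z Q i c unfolding key_def by blast
  qed
  have key_inject: "s = s'" if keys: "key s d" "key s' d" for s s' d
  proof -
    obtain z Q i c where z: "expands z s" "elts z \<subseteq> elts omega" "greedy Q z" "i \<epsilon> omega"
      "elts Q \<subseteq> elts i" "codes c z" "d = ap c i"
      using keys(1) unfolding key_def by blast
    obtain z' Q' i' c' where z': "expands z' s'" "elts z' \<subseteq> elts omega" "greedy Q' z'" "i' \<epsilon> omega"
      "elts Q' \<subseteq> elts i'" "codes c' z'" "d = ap c' i'"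
      using keys(2) unfolding key_def by blast
    have i: "i = i'" "\<And>j. j \<epsilon> i \<Longrightarrow> j \<epsilon> z \<longleftrightarrow> j \<epsilon> z'"
      using codes_inject[OF z(6) z'(6) z(4) z'(4)] z(7) z'(7) by auto
    \<comment> \<open>From i on nothing is passed, so every bit of \<open>z\<close> is opposite to
      the response, which depends on \<open>z\<close> and \<open>Q\<close> at smaller positions. The
      first i bits therefore determine \<open>z\<close> and \<open>Q\<close> together.\<close>
    have "(k \<epsilon> z \<longleftrightarrow> k \<epsilon> z') \<and> (k \<epsilon> Q \<longleftrightarrow> k \<epsilon> Q')" if "k \<epsilon> omega" for k
      using that
    proof (induct rule: omega_less_induct)
      case Def show ?case by (intro dfi)
    next
      case (less k)
      have "resp Q z k \<longleftrightarrow> resp Q' z' k"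
        using resp_cong[OF less(1)] less(2) by blast
      moreover have "k \<epsilon> Q \<longleftrightarrow> (resp Q z k \<longleftrightarrow> k \<epsilon> z)" "k \<epsilon> Q' \<longleftrightarrow> (resp Q' z' k \<longleftrightarrow> k \<epsilon> z')"
        using z(3) z'(3) less(1) unfolding greedy_def by auto
      moreover have "k \<epsilon> Q \<Longrightarrow> k \<epsilon> i" "k \<epsilon> Q' \<Longrightarrow> k \<epsilon> i"
        using z(5) z'(5) i(1) by auto
      ultimately show ?case using i(2) by blast
    qed
    then have "z = z'"
      using z(2) z'(2) by (intro ext) (auto simp: subset_iff)
    then show ?thesis using expands_unique z(1) z'(1) by blast
  qed
  have [dfi]: "Def (\<lambda>e. key (s e) (t e))" if "DefT s" "DefT t" for s t
    by (rule Def_subst2[where P = key, OF _ that]) (unfold key_def, intro dfi)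
  define num where "num s = the1 (\<lambda>d. (d \<epsilon> omega \<and> key s d) \<and> (\<forall>d'\<in>elts d. \<not> (d' \<epsilon> omega \<and> key s d')))" for s
  have D: "DefT (\<lambda>e. num (e 0))" unfolding num_def by (intro dfi)
  have num: "num s \<epsilon> omega \<and> key s (num s)" if "s \<epsilon> S" for s
  proof -
    have D': "Def (\<lambda>e. e 0 \<epsilon> omega \<and> key s (e 0))" by (intro dfi)
    obtain d0 where d0: "d0 \<epsilon> omega \<and> key s d0" using key_exists \<open>s \<epsilon> S\<close> by blast
    obtain d where d: "d \<epsilon> omega" "d \<epsilon> omega \<and> key s d" "\<And>d'. d' \<epsilon> d \<Longrightarrow> \<not> (d' \<epsilon> omega \<and> key s d')"
      by (rule omega_least[where P = "\<lambda>d. d \<epsilon> omega \<and> key s d", OF d0 conjunct1[OF d0] D']) blast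
    have "num s = d"
      unfolding num_def
      by (rule the1_eqI) (use d omega_linear[OF _ d(1)] in auto)
    with d show ?thesis by simp
  qed
  have f: "func (lam S num) S omega"
    by (rule func_lam[OF D]) (use num in blast)
  moreover have "app (lam S num) s = num s" if "s \<epsilon> S" for s
    using func_app[OF f that] ap_lam[OF D that] by simp
  then have "inj_on (app (lam S num)) (elts S)"
    using num key_inject by (intro inj_onI) (metis elts_iff)
  ultimately show ?thesis
    unfolding countable_set_def by blast
qed

subsection \<open>Playing two strategies against each other\<close>

text \<open>Limit sets collect actual limits, so two winning strategies contradict each other only
  once the run between them is known to converge.\<close>

lemma bounded_increasing_limit:
  assumes s: "func s omega R" and inc: "\<And>n. n \<epsilon> omega \<Longrightarrow> ap s n \<preceq> ap s (succ n)"
    and b: "b \<epsilon> R" "\<And>n. n \<epsilon> omega \<Longrightarrow> ap s n \<preceq> b"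
  shows "\<exists>x. limit_of s x"
proof -
  define P where "P x \<longleftrightarrow> (\<exists>n\<in>elts omega. x = ap s n)" for x
  have D: "Def (\<lambda>e. P (e 0))" unfolding P_def by (intro dfi)
  have "P (ap s zero)" unfolding P_def by (auto intro!: exI[of _ zero])
  moreover have bound: "x \<preceq> b" if "P x" for x
    using that b unfolding P_def by auto
  ultimately obtain u where u: "u \<epsilon> R" "\<And>x. x \<epsilon> R \<Longrightarrow> P x \<Longrightarrow> x \<preceq> u"
    "\<And>v. v \<epsilon> R \<Longrightarrow> (\<And>x. x \<epsilon> R \<Longrightarrow> P x \<Longrightarrow> x \<preceq> v) \<Longrightarrow> u \<preceq> v"
    using supremum[OF D func_ap[OF s zero_omega] _ b(1)] by metis
  have le: "ap s n \<preceq> u" if "n \<epsilon> omega" for n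
  proof -
    have "P (ap s n)" unfolding P_def using that by auto
    then show ?thesis using u(2) func_ap[OF s that] by blast
  qed
  have "\<exists>N\<in>elts omega. \<forall>n\<in>elts omega. N = n \<or> N \<epsilon> n \<longrightarrow> app s n \<prec> u \<oplus> e \<and> u \<prec> app s n \<oplus> e"
    if e: "e \<epsilon> R" "zero_R \<prec> e" for e
  proof -
    \<comment> \<open>Here v is u - e; some entry exceeds it because v is below the least upper
      bound.\<close>
    obtain v where v: "v \<epsilon> R" "e \<boxplus> v = u" using diff_exists e(1) u(1) by blast
    have vu: "v \<prec> u" using less_pl[OF e(2) v(1)] v e pl_commute by metis
    have "\<exists>N. N \<epsilon> omega \<and> v \<prec> ap s N"
    proof (rule ccontr)
      assume "\<not> ?thesis"
      then have "ap s n \<preceq> v" if "n \<epsilon> omega" for n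
        using that not_less_R[OF v(1) func_ap[OF s that]] by blast
      then have "u \<preceq> v" using u(3)[OF v(1)] unfolding P_def by auto
      with vu show False using less_le_R_trans less_R_irrefl by blast
    qed
    then obtain N where N: "N \<epsilon> omega" "v \<prec> ap s N" by blast
    have "app s n \<prec> u \<oplus> e \<and> u \<prec> app s n \<oplus> e" if n: "n \<epsilon> omega" "N \<epsilon> succ n" for n
    proof -
      have R: "ap s n \<epsilon> R" using func_ap[OF s n(1)] .
      have "v \<prec> ap s n" using less_le_R_trans[OF N(2) seq_mono[OF inc n(2,1)]] .
      then have "e \<boxplus> v \<prec> e \<boxplus> ap s n" using pl_strict_mono2 e(1) by blast
      then have "u \<prec> ap s n \<boxplus> e" using v(2) pl_commute[OF e(1) R] by simp
      moreover have "ap s n \<prec> u \<boxplus> e" using le_less_R_trans[OF le[OF n(1)] less_pl[OF e(2) u(1)]] .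
      ultimately show ?thesis
        using plus_R_eq R u(1) e(1) func_app[OF s n(1)] by simp
    qed
    then show ?thesis using N(1) by auto
  qed
  then have "limit_of s u" unfolding limit_of_def using u(1) by auto
  then show ?thesis by blast
qed

definition pos_B :: "'v \<Rightarrow> 'v \<Rightarrow> 'v \<Rightarrow> bool"
  where "pos_B m a b \<longleftrightarrow>
    func a (succ (succ m)) R \<and> func b (succ m) R \<and> ap a zero = a0 \<and> ap b zero = b0 \<and>
    (\<forall>i\<in>elts (succ m). ap a i \<prec> ap a (succ i)) \<and> ap a (succ m) \<prec> ap b m \<and>
    (\<forall>i\<in>elts m. ap b (succ i) \<prec> ap b i)"

lemma position_B_iff:
  assumes "m \<epsilon> omega"
  shows "position_B m a b \<longleftrightarrow> pos_B m a b"
proof (cases "func a (succ (succ m)) R \<and> func b (succ m) R")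
  case True
  have "app a i = ap a i" if "i \<epsilon> succ (succ m)" for i
    using func_app True that by blast
  moreover have "app b i = ap b i" if "i \<epsilon> succ m" for i
    using func_app True that by blast
  ultimately show ?thesis
    using True zero_less_succ[OF assms] zero_less_succ[OF succ_omega[OF assms]]
      succ_less_succ[OF _ assms] succ_less_succ[OF _ succ_omega[OF assms]]
    unfolding position_B_def pos_B_def by (simp del: succ_iff) (simp add: succ_iff)
next
  case False
  then show ?thesis
    unfolding position_B_def pos_B_def by blast
qed

lemma position_B_mem:
  assumes "m \<epsilon> omega" "position_B m a b"
  shows "opair a b \<epsilon> the_set (\<lambda>p. \<exists>a b. position_B m a b \<and> p = opair a b)"
  unfolding position_B_iff[OF assms(1)]
proof (subst the_set_bounded_mem[where A = "prod_set (funset (succ (succ m)) R) (funset (succ m) R)"])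
  show "Def (\<lambda>e. \<exists>a b. pos_B m a b \<and> e 0 = opair a b)"
    unfolding pos_B_def by (intro dfi)
qed (use assms position_B_iff in \<open>auto simp: pos_B_def\<close>)

text \<open>\<open>a'\<close> is \<open>a\<close> with player A's next move entered at
  \<open>succ m\<close>; the entries of \<open>a\<close> beyond m may still be arbitrary.\<close>

lemma nested_position_B:
  assumes nested: "nested m a b" and m: "m \<epsilon> omega"
    and a': "func a' omega R" "\<And>i. i \<epsilon> succ m \<Longrightarrow> ap a' i = ap a i"
      "ap a m \<prec> ap a' (succ m)" "ap a' (succ m) \<prec> ap b m"
  shows "position_B m (restr a' (succ (succ m))) (restr b (succ m))"
proof -
  have f: "func b omega R" "ap a zero = a0" "ap b zero = b0"
    and step: "\<And>i. i \<epsilon> m \<Longrightarrow> ap a i \<prec> ap a (succ i) \<and> ap b (succ i) \<prec> ap b i"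
    using nested unfolding nested_def by simp_all
  have sub: "elts (succ m) \<subseteq> elts omega" "elts (succ (succ m)) \<subseteq> elts omega" using m by simp_all
  have ra: "app (restr a' (succ (succ m))) i = ap a' i" if "i \<epsilon> succ (succ m)" for i
    using func_app[OF func_restr[OF a'(1) sub(2)] that] ap_restr[OF _ sub(2) that] a'(1) by simp
  have rb: "app (restr b (succ m)) i = ap b i" if "i \<epsilon> succ m" for i
    using func_app[OF func_restr[OF f(1) sub(1)] that] ap_restr[OF _ sub(1) that] f(1) by simp
  have "app (restr a' (succ (succ m))) i \<prec> app (restr a' (succ (succ m))) (succ i)" if i: "i \<epsilon> succ m" for i
  proof (cases "i = m")
    case True
    then show ?thesis using a'(2-4) by (simp add: ra)
  next
    case False
    then have "i \<epsilon> m" "succ i \<epsilon> succ m" using i succ_less_succ[OF _ m] by auto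
    then show ?thesis using step[of i] a'(2) i by (simp add: ra del: succ_iff) (auto simp: ra)
  qed
  moreover have "app (restr b (succ m)) (succ i) \<prec> app (restr b (succ m)) i" if i: "i \<epsilon> m" for i
    using succ_less_succ[OF i m] step[OF i] i by (simp add: rb del: succ_iff) (simp add: rb)
  moreover have "zero \<epsilon> succ m" "zero \<epsilon> succ (succ m)"
    using zero_less_succ m by simp_all
  ultimately show ?thesis
    unfolding position_B_def
    using func_restr[OF a'(1) sub(2)] func_restr[OF f(1) sub(1)] a' f
    by (simp add: ra rb del: succ_iff) (simp add: ra rb)
qed

text \<open>The run is the fixed point of an operator on sequences of pairs. The operator has to be
  total, while the strategies are controlled at legal positions only; a default pair covers the
  rest, and induction shows that the run stays legal.\<close>

lemma not_both_win:
  assumes f: "winning_A S f" and g: "winning_B S g"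
  shows False
proof -
  define upd where "upd s n v = lam omega (\<lambda>j. if j = n then v else ap s j)" for s n v
  define as where "as x = lam omega (\<lambda>j. fst_of (ap x j))" for x
  define bs where "bs x = lam omega (\<lambda>j. snd_of (ap x j))" for x
  define ma where "ma k a b = ap (ap f k) (opair (restr a (succ k)) (restr b (succ k)))" for k a b
  define mb where "mb k a b = ap (ap g k) (opair (restr a (succ (succ k))) (restr b (succ k)))" for k a b
  define nxa where "nxa k x = ma k (as x) (bs x)" for k x
  \<comment> \<open>Both moves of a turn form one entry of \<open>x\<close>, so player A's new move
    is not yet in \<open>x\<close> when the answer is computed; \<open>upd\<close> enters
    it.\<close>
  define nxb where "nxb k x = mb k (upd (as x) (succ k) (nxa k x)) (bs x)" for k x
  \<comment> \<open>The default pair is also the prescribed entry at 0; elsewhere it keeps the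
    values real when a strategy is applied to an illegal position.\<close>
  define h where "h n x = (if n \<noteq> zero \<and> nxa (union n) x \<epsilon> R \<and> nxb (union n) x \<epsilon> R
    then opair (nxa (union n) x) (nxb (union n) x) else opair a0 b0)" for n x
  have D: "DefT (\<lambda>e. h (e 0) (e (Suc 0)))"
    unfolding h_def nxa_def nxb_def ma_def mb_def as_def bs_def upd_def by (intro dfi)
  have as_D: "DefT (\<lambda>e. fst_of (ap x (e 0)))" and bs_D: "DefT (\<lambda>e. snd_of (ap x (e 0)))"
    and upd_D: "DefT (\<lambda>e. if e 0 = n then v else ap s (e 0))" for x n v s
    by (intro dfi)+
  have upd: "func (upd s n v) omega R" if "func s omega R" "v \<epsilon> R" for s n v
    unfolding upd_def by (rule func_lam[OF upd_D]) (use that in simp)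
  have ap_upd: "ap (upd s n v) j = (if j = n then v else ap s j)" if "j \<epsilon> omega" for s n v j
    unfolding upd_def by (rule ap_lam[OF upd_D that])
  have as: "func (as x) omega R" and bs: "func (bs x) omega R" if "func x omega (prod_set R R)" for x
  proof -
    have "fst_of (ap x j) \<epsilon> R \<and> snd_of (ap x j) \<epsilon> R" if "j \<epsilon> omega" for j
      using func_ap[OF \<open>func x omega (prod_set R R)\<close> that] by auto
    then show "func (as x) omega R" "func (bs x) omega R"
      unfolding as_def bs_def using func_lam[OF as_D] func_lam[OF bs_D] by blast+
  qed
  have ap_as: "ap (as x) j = fst_of (ap x j)" and ap_bs: "ap (bs x) j = snd_of (ap x j)" if "j \<epsilon> omega" for x j
    unfolding as_def bs_def using ap_lam[OF as_D that] ap_lam[OF bs_D that] by blast+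
  have fun_on: "fun_on (as x) omega" "fun_on (bs x) omega" "fun_on (upd s n v) omega" for x s n v
    unfolding as_def bs_def upd_def using fun_on_lam[OF as_D] fun_on_lam[OF bs_D] fun_on_lam[OF upd_D] by blast+
  have h_cong: "h n x = h n y" if n: "n \<epsilon> omega" and eq: "\<And>k. k \<epsilon> n \<Longrightarrow> ap x k = ap y k" for n x y
    using n
  proof (rule omega_cases)
    assume "n = zero" then show ?thesis unfolding h_def by simp
  next
    fix k assume k: "k \<epsilon> omega" "n = succ k"
    have a: "ap (as x) j = ap (as y) j" "ap (bs x) j = ap (bs y) j" if "j \<epsilon> n" for j
      using eq that omega_trans[OF that n] by (simp_all add: ap_as ap_bs)
    have r: "restr (as x) n = restr (as y) n" "restr (bs x) n = restr (bs y) n"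
      using restr_cong fun_on n a by blast+
    then have eqa: "nxa k x = nxa k y" unfolding nxa_def ma_def k(2) by simp
    have "restr (upd (as x) n v) (succ n) = restr (upd (as y) n v) (succ n)" for v
      by (rule restr_cong) (use fun_on n a omega_trans[OF _ n] in \<open>auto simp: ap_upd\<close>)
    then have "nxb k x = nxb k y" unfolding nxb_def mb_def eqa using r k(2) by simp
    with eqa show ?thesis unfolding h_def k(2) by (simp add: union_succ k(1))
  qed
  have h_closed: "h n x \<epsilon> prod_set R R" for n x
    unfolding h_def by auto
  obtain x where x: "func x omega (prod_set R R)" "\<And>n. n \<epsilon> omega \<Longrightarrow> ap x n = h n x"
  proof (rule causal_fixpoint[OF D, where A = "prod_set R R"])
    show "opair a0 b0 \<epsilon> prod_set R R" by simp
  qed (use h_closed h_cong in blast)+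
  define a where "a = as x"
  define b where "b = bs x"
  have fab: "func a omega R" "func b omega R" unfolding a_def b_def using as bs x(1) by auto
  have zero: "ap a zero = a0" "ap b zero = b0"
    unfolding a_def b_def using x(2)[OF zero_omega] by (simp_all add: ap_as ap_bs h_def)
  have fs: "strategy_A f" "limit_set_A f \<subseteq> elts S" using f unfolding winning_A_def by auto
  have gs: "strategy_B g" "limit_set_B g \<subseteq> closed_interval a0 b0 - elts S"
    using g unfolding winning_B_def by auto
  \<comment> \<open>Legality up to n places both strategies at legal positions, so their moves are
    reals, the default does not intervene, and the next turn is legal too.\<close>
  have step: "ap a (succ n) = app (app f n) (opair (restr a (succ n)) (restr b (succ n)))"
    "ap b (succ n) = app (app g n) (opair (restr a (succ (succ n))) (restr b (succ n)))"
    "ap a n \<prec> ap a (succ n)" "ap a (succ n) \<prec> ap b (succ n)" "ap b (succ n) \<prec> ap b n"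
    if n: "n \<epsilon> omega" and nested: "nested n a b" for n
  proof -
    have pos: "position_A n (restr a (succ n)) (restr b (succ n))"
      using nested_pos_A[OF nested n] position_A_iff[OF n] by simp
    define a' where "a' = upd a (succ n) (nxa n x)"
    have Af: "func (app f n) (the_set (\<lambda>p. \<exists>a b. position_A n a b \<and> p = opair a b)) R"
      using fs(1) n unfolding strategy_A_def by simp
    have "opair (restr a (succ n)) (restr b (succ n)) \<epsilon> the_set (\<lambda>p. \<exists>a b. position_A n a b \<and> p = opair a b)"
      unfolding positions_A_eq[OF n] using pos position_A_iff[OF n] by auto
    then have na: "nxa n x = app (app f n) (opair (restr a (succ n)) (restr b (succ n)))"
      unfolding nxa_def ma_def a_def b_def using func_app[OF Af] app_eq_ap[of f omega n] fs(1) n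
      unfolding strategy_A_def by simp
    have sub: "elts (succ n) \<subseteq> elts omega" using n by simp
    have "app (restr a (succ n)) n = ap a n" "app (restr b (succ n)) n = ap b n"
      using func_app[OF func_restr[OF fab(1) sub]] func_app[OF func_restr[OF fab(2) sub]]
        ap_restr[OF _ sub, of _ n] fab by simp_all
    moreover have "\<forall>a b. position_A n a b \<longrightarrow>
        app a n \<prec> app (app f n) (opair a b) \<and> app (app f n) (opair a b) \<prec> app b n"
      using fs(1) n unfolding strategy_A_def by simp
    ultimately have less: "ap a n \<prec> nxa n x" "nxa n x \<prec> ap b n"
      using pos unfolding na by fastforce+
    then have naR: "nxa n x \<epsilon> R" using less_R_carrier by blast
    have fa': "func a' omega R" unfolding a'_def using upd fab(1) naR by blast
    have a': "ap a' (succ n) = nxa n x" "\<And>i. i \<epsilon> succ n \<Longrightarrow> ap a' i = ap a i"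
      unfolding a'_def using n omega_trans[OF _ succ_omega[OF n]] not_mem_self[of "succ n"]
      by (auto simp: ap_upd simp del: succ_iff not_mem_self)
    have posB: "position_B n (restr a' (succ (succ n))) (restr b (succ n))"
      using nested_position_B[OF nested n fa' a'(2)] a'(1) less by simp
    have Bg: "func (app g n) (the_set (\<lambda>p. \<exists>a b. position_B n a b \<and> p = opair a b)) R"
      using gs(1) n unfolding strategy_B_def by simp
    have "opair (restr a' (succ (succ n))) (restr b (succ n)) \<epsilon> the_set (\<lambda>p. \<exists>a b. position_B n a b \<and> p = opair a b)"
      using position_B_mem n posB by blast
    then have nb: "nxb n x = app (app g n) (opair (restr a' (succ (succ n))) (restr b (succ n)))"
      unfolding nxb_def mb_def a_def b_def a'_def using func_app[OF Bg] app_eq_ap[of g omega n] gs(1) n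
      unfolding strategy_B_def by simp
    have sub2: "elts (succ (succ n)) \<subseteq> elts omega" using n by simp
    have "app (restr a' (succ (succ n))) (succ n) = nxa n x" "app (restr b (succ n)) n = ap b n"
      using func_app[OF func_restr[OF fa' sub2]] func_app[OF func_restr[OF fab(2) sub]]
        ap_restr[OF _ sub, of _ n] ap_restr[OF _ sub2, of _ "succ n"] fab fa' a'(1) by simp_all
    moreover have "\<forall>a b. position_B n a b \<longrightarrow>
        app a (succ n) \<prec> app (app g n) (opair a b) \<and> app (app g n) (opair a b) \<prec> app b n"
      using gs(1) n unfolding strategy_B_def by simp
    ultimately have lessb: "nxa n x \<prec> nxb n x" "nxb n x \<prec> ap b n"
      using posB unfolding nb by fastforce+
    then have nbR: "nxb n x \<epsilon> R" using less_R_carrier by blast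
    have "ap x (succ n) = opair (nxa n x) (nxb n x)"
      using x(2)[of "succ n"] n naR nbR by (simp add: h_def union_succ)
    then have eq: "ap a (succ n) = nxa n x" "ap b (succ n) = nxb n x"
      unfolding a_def b_def using n by (simp_all add: ap_as ap_bs)
    have "restr a' (succ (succ n)) = restr a (succ (succ n))"
      by (rule restr_cong) (use fab fa' n a' eq in auto)
    with eq na nb less lessb show "ap a (succ n) = app (app f n) (opair (restr a (succ n)) (restr b (succ n)))"
      "ap b (succ n) = app (app g n) (opair (restr a (succ (succ n))) (restr b (succ n)))"
      "ap a n \<prec> ap a (succ n)" "ap a (succ n) \<prec> ap b (succ n)" "ap b (succ n) \<prec> ap b n"
      by simp_all
  qed
  have nested: "nested n a b" if "n \<epsilon> omega" for n
    using that
  proof (induct rule: omega_induct)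
    case Def show ?case by (intro dfi)
  next
    case zero
    then show ?case unfolding nested_def using fab zero a0_less_b0 \<open>ap a zero = a0\<close> \<open>ap b zero = b0\<close> by simp
  next
    case (succ n)
    then show ?case using step[of n] unfolding nested_def by auto
  qed
  note step = step[OF _ nested]
  have app: "app a n = ap a n" "app b n = ap b n" if "n \<epsilon> omega" for n
    using func_app fab that by auto
  have play: "play a b"
    unfolding play_def using fab zero step app by simp
  have "ap a n \<preceq> b0" if n: "n \<epsilon> omega" for n
  proof -
    have "ap b n \<preceq> b0" using n
    proof (induct rule: omega_induct)
      case Def show ?case by (intro dfi)
    next
      case (succ n)
      then show ?case using step(5)[of n] less_le_R_trans less_imp_le_R by blast
    qed (simp add: zero)
    moreover have "ap a n \<prec> ap b n" using nested[OF n] unfolding nested_def by simp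
    ultimately show ?thesis using less_le_R_trans less_imp_le_R by blast
  qed
  then obtain l where l: "limit_of a l"
    using bounded_increasing_limit[OF fab(1) _ ab_R(2)] step(3) less_imp_le_R by blast
  have "consistent_A f a b" "consistent_B g a b"
    unfolding consistent_A_def consistent_B_def using step(1,2) app by simp_all
  then have "l \<in> limit_set_A f" "l \<in> limit_set_B g"
    unfolding limit_set_A_def limit_set_B_def using play l by blast+
  then show False using fs(2) gs(2) by blast
qed

theorem AD_uncountable_A_wins:
  assumes AD "uncountable_target S"
  shows "A_has_winning_strategy S"
proof -
  have S: "elts S \<subseteq> closed_interval a0 b0" "\<not> countable_set S"
    using assms(2) unfolding uncountable_target_def by auto
  show ?thesis
  proof (rule AD_causal[OF assms(1) Def_perfect_game[of S]])
    fix F assume "DefT (\<lambda>e. F (e 0))"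
      "\<And>y y' i. func y omega omega \<Longrightarrow> func y' omega omega \<Longrightarrow> i \<epsilon> omega \<Longrightarrow>
        (\<And>j. j \<epsilon> i \<Longrightarrow> ap y j = ap y' j) \<Longrightarrow> ap (F y) i = ap (F y') i"
      "\<And>y. func y omega omega \<Longrightarrow> perfect_game S (F y) y"
    then show ?thesis by (rule A_wins_if_first_wins)
  next
    fix G assume "DefT (\<lambda>e. G (e 0))"
      "\<And>x x' i. func x omega omega \<Longrightarrow> func x' omega omega \<Longrightarrow> i \<epsilon> omega \<Longrightarrow>
        (\<And>j. j \<epsilon> succ i \<Longrightarrow> ap x j = ap x' j) \<Longrightarrow> ap (G x) i = ap (G x') i"
      "\<And>x. func x omega omega \<Longrightarrow> \<not> perfect_game S x (G x)"
    then have "countable_set S"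
      by (rule countable_if_second_wins[OF _ _ _ S(1)])
    then show ?thesis using S(2) by blast
  qed
qed

theorem AD_no_uncountable_target_without_A_win:
  assumes AD
  shows "\<not> (\<exists>S. uncountable_target S \<and> \<not> A_has_winning_strategy S)
       \<and> \<not> (\<exists>S. uncountable_target S \<and> B_has_winning_strategy S)
       \<and> \<not> (\<exists>S. uncountable_target S \<and> \<not> A_has_winning_strategy S \<and> \<not> B_has_winning_strategy S)"
  using AD_uncountable_A_wins[OF assms] not_both_win
  unfolding A_has_winning_strategy_def B_has_winning_strategy_def by blast

end

theorem corollary1:
  fixes mem :: "'v \<Rightarrow> 'v \<Rightarrow> bool"
    and R addR multR ltR a0 b0 :: 'v
  assumes "set_universe.ZF mem"
    and "set_universe.AD mem"
    and "reals_in_universe.real_field mem R addR multR ltR"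
    and "mem a0 R" and "mem b0 R" and "reals_in_universe.less_R mem ltR a0 b0"
  shows "\<not> (\<exists>S. cantor_game.uncountable_target mem R ltR a0 b0 S \<and>
              \<not> cantor_game.A_has_winning_strategy mem R addR ltR a0 b0 S)
       \<and> \<not> (\<exists>S. cantor_game.uncountable_target mem R ltR a0 b0 S \<and>
              cantor_game.B_has_winning_strategy mem R addR ltR a0 b0 S)
       \<and> \<not> (\<exists>S. cantor_game.uncountable_target mem R ltR a0 b0 S \<and>
              \<not> cantor_game.A_has_winning_strategy mem R addR ltR a0 b0 S \<and>
              \<not> cantor_game.B_has_winning_strategy mem R addR ltR a0 b0 S)"
proof -
  interpret zf_cantor mem R addR multR ltR a0 b0
    by unfold_locales (use assms in blast)+
  show ?thesis
    by (rule AD_no_uncountable_target_without_A_win) (rule assms(2))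
qed

end
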